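(* For any Hermitian positive definite linear map $\tilde{\mathcal{L}}:\mathrm{V}_h(\Omega)\to \mathrm{V}_h(\Omega)^*$, we have $$\mathrm{cond}\big((\mathcal{B}\,\tilde{\mathcal{L}}^{-1}\mathcal{B}^* )(\mathrm{R}^*\,\mathrm{T}_{\mathrm{L}}\,\mathrm{R})\big)\le \mathrm{cond}\big(\tilde{\mathcal{L}}^{-1}\mathcal{L}\big).$$
   Context: Conventions: for a (complex) finite-dimensional space $\mathrm{H}$, $\mathrm{H}^*$ is the space of linear forms on $\mathrm{H}$, $\langle\varphi,v\rangle=\varphi(v)$ is the duality pairing (bilinear, no complex conjugation), and for linear $\mathrm{A}:\mathrm{V}\to\mathrm{H}$ the dual map $\mathrm{A}^*:\mathrm{H}^*\to\mathrm{V}^*$ is defined by $\langle \mathrm{A}^*\varphi,u\rangle=\langle\varphi,\mathrm{A}u\rangle$. Hermitian positive definite means that $(u,v)\mapsto\langle\tilde{\mathcal{L}}u,\overline{v}\rangle$ is a Hermitian positive definite form. $\mathrm{cond}$ denotes the ratio of the largest to the smallest eigenvalue (the operators considered have real positive spectrum). Geometry: $\Omega\subset\mathbb{R}^3$ is a bounded polyhedral domain with a regular (conforming) tetrahedral triangulation $\mathcal{T}_h(\Omega)$ (no shape-regularity required). $\overline{\Omega}=\cup_{j=1}^{J}\overline{\Omega}_j$ where the $\Omega_j\subset\Omega$ are pairwise disjoint polyhedral domains, each exactly resolved by the triangulation (i.e. $\overline{\Omega}_j$ is a union of closed mesh elements). $\Gamma_j:=\partial\Omega_j$ and $\Sigma:=\cup_{j=1}^J\Gamma_j$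 (the skeleton). Spaces: $\mathrm{V}_h(\Omega):=\{v\in \mathrm{H}^1(\Omega): v|_\tau\in\mathbb{P}_1(\tau)\ \forall\tau\in\mathcal{T}_h(\Omega)\}$ (complex-valued continuous piecewise linear functions), $\mathrm{V}_h(\Omega_j):=\{v|_{\Omega_j}: v\in \mathrm{V}_h(\Omega)\}$, $\mathrm{V}_h(\Gamma_j):=\{v|_{\Gamma_j}: v\in \mathrm{V}_h(\Omega)\}$, $\mathrm{V}_h(\Sigma):=\{v|_\Sigma: v\in \mathrm{V}_h(\Omega)\}$, $\mathbb{V}_h(\Omega):=\mathrm{V}_h(\Omega_1)\times\cdots\times \mathrm{V}_h(\Omega_J)$, $\mathbb{V}_h(\Sigma):=\mathrm{V}_h(\Gamma_1)\times\cdots\times \mathrm{V}_h(\Gamma_J)$. Trace and restriction maps: $\mathcal{B}:\mathrm{V}_h(\Omega)\to \mathrm{V}_h(\Sigma)$, $\mathcal{B}(u):=u|_\Sigma$; $\mathrm{B}:\mathbb{V}_h(\Omega)\to\mathbb{V}_h(\Sigma)$, $\mathrm{B}(v_1,\dots,v_J):=(v_1|_{\Gamma_1},\dots,v_J|_{\Gamma_J})$; $\mathrm{R}:\mathrm{V}_h(\Sigma)\to\mathbb{V}_h(\Sigma)$, $\mathrm{R}(p):=(p|_{\Gamma_1},\dots,p|_{\Gamma_J})$. Operators: $\alpha,\beta:\Omega\to(0,+\infty)$ are measurable with $\alpha_-\le\alpha(\boldsymbol{x})\le\alpha_+$ and $\beta_-\le\beta(\boldsymbol{x})\le\beta_+$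 for all $\boldsymbol{x}\in\Omega$, for constants $\alpha_\pm,\beta_\pm>0$. $\mathcal{L}:\mathrm{V}_h(\Omega)\to \mathrm{V}_h(\Omega)^*$ is defined by $\langle\mathcal{L}(u),v\rangle:=\int_\Omega \alpha\nabla u\cdot\nabla v+\beta uv\,d\boldsymbol{x}$. $\mathrm{L}=\mathrm{diag}(\mathrm{L}_{\Omega_1},\dots,\mathrm{L}_{\Omega_J}):\mathbb{V}_h(\Omega)\to\mathbb{V}_h(\Omega)^*$ is block-diagonal with $\langle \mathrm{L}_{\Omega_j}u,v\rangle:=\int_{\Omega_j}\alpha\nabla u\cdot\nabla v+\beta uv\,d\boldsymbol{x}$. $\mathrm{T}_{\mathrm{L}}:\mathbb{V}_h(\Sigma)\to\mathbb{V}_h(\Sigma)^*$ is defined by $\mathrm{T}_{\mathrm{L}}^{-1}:=\mathrm{B}\,\mathrm{L}^{-1}\,\mathrm{B}^*$. *)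

theory Defs
  imports "HOL-Analysis.Analysis"
begin

section \<open>Complex linear algebra on spaces of functions\<close>

text \<open>
  Every vector space below is a set of complex-valued functions, with the pointwise operations.
  A function on a set \<open>S\<close> is represented by its extension by zero outside \<open>S\<close>, so that equality of
  representatives is equality on \<open>S\<close>. The same convention applies to linear forms, which are
  functions on a space \<open>V\<close>: the dual of a space is then again a set of complex-valued functions.
\<close>

definition restrict0 :: "'a set \<Rightarrow> ('a \<Rightarrow> complex) \<Rightarrow> 'a \<Rightarrow> complex" where
  "restrict0 S f = (\<lambda>x. if x \<in> S then f x else 0)"

definition linear_map ::
  "('a \<Rightarrow> complex) set \<Rightarrow> ('b \<Rightarrow> complex) set \<Rightarrow> (('a \<Rightarrow> complex) \<Rightarrow> ('b \<Rightarrow> complex)) \<Rightarrow> bool" where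
  "linear_map V W A \<longleftrightarrow>
     A \<in> V \<rightarrow> W \<and>
     (\<forall>u\<in>V. \<forall>v\<in>V. A (\<lambda>x. u x + v x) = (\<lambda>y. A u y + A v y)) \<and>
     (\<forall>c. \<forall>u\<in>V. A (\<lambda>x. c * u x) = (\<lambda>y. c * A u y))"

definition dual_space :: "('a \<Rightarrow> complex) set \<Rightarrow> (('a \<Rightarrow> complex) \<Rightarrow> complex) set" where
  "dual_space V = {\<phi>.
     (\<forall>u\<in>V. \<forall>v\<in>V. \<phi> (\<lambda>x. u x + v x) = \<phi> u + \<phi> v) \<and>
     (\<forall>c. \<forall>u\<in>V. \<phi> (\<lambda>x. c * u x) = c * \<phi> u) \<and>
     (\<forall>u. u \<notin> V \<longrightarrow> \<phi> u = 0)}"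

text \<open>The dual of a linear map \<open>A\<close> with domain \<open>V\<close>.\<close>

definition dual_map ::
  "('a \<Rightarrow> complex) set \<Rightarrow> (('a \<Rightarrow> complex) \<Rightarrow> ('b \<Rightarrow> complex)) \<Rightarrow>
   (('b \<Rightarrow> complex) \<Rightarrow> complex) \<Rightarrow> ('a \<Rightarrow> complex) \<Rightarrow> complex" where
  "dual_map V A \<phi> = restrict0 V (\<lambda>u. \<phi> (A u))"

text \<open>The pairing is bilinear, so the conjugation in the sesquilinear form is explicit.\<close>

definition hermitian_pos_def ::
  "('a \<Rightarrow> complex) set \<Rightarrow> (('a \<Rightarrow> complex) \<Rightarrow> ('a \<Rightarrow> complex) \<Rightarrow> complex) \<Rightarrow> bool" where
  "hermitian_pos_def V A \<longleftrightarrow>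
     (\<forall>u\<in>V. \<forall>v\<in>V. A u (\<lambda>x. cnj (v x)) = cnj (A v (\<lambda>x. cnj (u x)))) \<and>
     (\<forall>u\<in>V. u \<noteq> (\<lambda>x. 0) \<longrightarrow> Re (A u (\<lambda>x. cnj (u x))) > 0)"

definition eigenvalues ::
  "('a \<Rightarrow> complex) set \<Rightarrow> (('a \<Rightarrow> complex) \<Rightarrow> ('a \<Rightarrow> complex)) \<Rightarrow> complex set" where
  "eigenvalues V A = {l. \<exists>u\<in>V. u \<noteq> (\<lambda>x. 0) \<and> A u = (\<lambda>x. l * u x)}"

text \<open>
  Meant for operators with positive real spectrum; \<open>Re\<close> only serves to transfer the eigenvalues to
  the ordered type of real numbers.
\<close>

definition cond_number ::
  "('a \<Rightarrow> complex) set \<Rightarrow> (('a \<Rightarrow> complex) \<Rightarrow> ('a \<Rightarrow> complex)) \<Rightarrow> real" where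
  "cond_number V A = Max (Re ` eigenvalues V A) / Min (Re ` eigenvalues V A)"

section \<open>Geometry\<close>

text \<open>
  The condition \<open>interior (closure \<Omega>) = \<Omega>\<close> says that the domain lies on one side of its boundary
  (no cracks).
\<close>

definition polyhedral_domain :: "(real^3) set \<Rightarrow> bool" where
  "polyhedral_domain \<Omega> \<longleftrightarrow>
     \<Omega> \<noteq> {} \<and> open \<Omega> \<and> connected \<Omega> \<and> bounded \<Omega> \<and> interior (closure \<Omega>) = \<Omega> \<and>
     (\<exists>F. finite F \<and> (\<forall>P\<in>F. polytope P) \<and> closure \<Omega> = \<Union>F)"

text \<open>
  Mesh elements are closed tetrahedra; conformity is part of \<^const>\<open>triangulation\<close>.
\<close>

definition tetrahedral_mesh :: "(real^3) set \<Rightarrow> (real^3) set set \<Rightarrow> bool" where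
  "tetrahedral_mesh \<Omega> \<T> \<longleftrightarrow>
     triangulation \<T> \<and> (\<forall>\<tau>\<in>\<T>. 3 simplex \<tau>) \<and> \<Union>\<T> = closure \<Omega>"

definition subdomain_partition ::
  "(real^3) set \<Rightarrow> (real^3) set set \<Rightarrow> nat \<Rightarrow> (nat \<Rightarrow> (real^3) set) \<Rightarrow> bool" where
  "subdomain_partition \<Omega> \<T> J D \<longleftrightarrow>
     (\<forall>j\<in>{1..J}. polyhedral_domain (D j) \<and> D j \<subseteq> \<Omega> \<and> (\<exists>S\<subseteq>\<T>. closure (D j) = \<Union>S)) \<and>
     disjoint_family_on D {1..J} \<and>
     closure \<Omega> = (\<Union>j\<in>{1..J}. closure (D j))"

definition skeleton :: "nat \<Rightarrow> (nat \<Rightarrow> (real^3) set) \<Rightarrow> (real^3) set" where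
  "skeleton J D = (\<Union>j\<in>{1..J}. frontier (D j))"

section \<open>Finite element spaces\<close>

definition partial_deriv ::
  "3 \<Rightarrow> (real^3 \<Rightarrow> 'b::real_normed_vector) \<Rightarrow> real^3 \<Rightarrow> 'b" where
  "partial_deriv i u x = vector_derivative (\<lambda>t. u (x + t *\<^sub>R axis i 1)) (at 0)"

text \<open>\<open>P [i\<^sub>1, \<dots>, i\<^sub>k]\<close> is the iterated partial derivative with respect to these indices.\<close>

definition smooth :: "(real^3 \<Rightarrow> real) \<Rightarrow> bool" where
  "smooth f \<longleftrightarrow> (\<exists>P :: 3 list \<Rightarrow> real^3 \<Rightarrow> real. P [] = f \<and>
     (\<forall>is x. (P is has_derivative (\<lambda>h. \<Sum>i\<in>UNIV. h $ i * P (i # is) x)) (at x)))"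

definition test_functions :: "(real^3) set \<Rightarrow> (real^3 \<Rightarrow> real) set" where
  "test_functions \<Omega> =
     {\<phi>. smooth \<phi> \<and> (\<exists>K. compact K \<and> K \<subseteq> \<Omega> \<and> (\<forall>x. x \<notin> K \<longrightarrow> \<phi> x = 0))}"

definition L2 :: "(real^3) set \<Rightarrow> (real^3 \<Rightarrow> complex) set" where
  "L2 \<Omega> = {v. v \<in> borel_measurable (lebesgue_on \<Omega>) \<and>
     integrable (lebesgue_on \<Omega>) (\<lambda>x. (norm (v x))\<^sup>2)}"

definition H1 :: "(real^3) set \<Rightarrow> (real^3 \<Rightarrow> complex) set" where
  "H1 \<Omega> = {v. v \<in> L2 \<Omega> \<and>
     (\<forall>i. \<exists>g\<in>L2 \<Omega>. \<forall>\<phi>\<in>test_functions \<Omega>.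
        (\<integral>x. v x * of_real (partial_deriv i \<phi> x) \<partial>lebesgue_on \<Omega>)
          = - (\<integral>x. g x * of_real (\<phi> x) \<partial>lebesgue_on \<Omega>))}"

definition P1 :: "(real^3) set \<Rightarrow> (real^3 \<Rightarrow> complex) set" where
  "P1 \<tau> = {v. \<exists>(a::complex) (b::complex^3). \<forall>x\<in>\<tau>. v x = a + (\<Sum>i\<in>UNIV. b $ i * of_real (x $ i))}"

text \<open>
  Elements are functions on the closure of \<open>\<Omega>\<close>. Since the elements of the mesh are closed, the
  second condition selects the continuous representative of the class in \<open>H\<^sup>1(\<Omega>)\<close>, extended to
  the boundary, so that restrictions to surfaces are pointwise restrictions.
\<close>

definition Vh :: "(real^3) set \<Rightarrow> (real^3) set set \<Rightarrow> (real^3 \<Rightarrow> complex) set" where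
  "Vh \<Omega> \<T> = {v. v \<in> H1 \<Omega> \<and> (\<forall>\<tau>\<in>\<T>. v \<in> P1 \<tau>) \<and> (\<forall>x. x \<notin> closure \<Omega> \<longrightarrow> v x = 0)}"

text \<open>
  With \<open>S\<close> the closure of a subdomain (on which the functions are determined by their values in the
  interior), the boundary of a subdomain, or the skeleton.
\<close>

definition Vh_on ::
  "(real^3) set \<Rightarrow> (real^3) set \<Rightarrow> (real^3) set set \<Rightarrow> (real^3 \<Rightarrow> complex) set" where
  "Vh_on S \<Omega> \<T> = restrict0 S ` Vh \<Omega> \<T>"

text \<open>A tuple \<open>(u\<^sub>1, \<dots>, u\<^sub>J)\<close> of functions is represented by \<open>(j, x) \<mapsto> u\<^sub>j(x)\<close>.\<close>

definition product_space ::
  "nat \<Rightarrow> (nat \<Rightarrow> ('a \<Rightarrow> complex) set) \<Rightarrow> (nat \<times> 'a \<Rightarrow> complex) set" where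
  "product_space J W = {u. (\<forall>j\<in>{1..J}. (\<lambda>x. u (j, x)) \<in> W j) \<and> (\<forall>j x. j \<notin> {1..J} \<longrightarrow> u (j, x) = 0)}"

definition VVh_dom ::
  "(real^3) set \<Rightarrow> (real^3) set set \<Rightarrow> nat \<Rightarrow> (nat \<Rightarrow> (real^3) set) \<Rightarrow> (nat \<times> (real^3) \<Rightarrow> complex) set" where
  "VVh_dom \<Omega> \<T> J D = product_space J (\<lambda>j. Vh_on (closure (D j)) \<Omega> \<T>)"

definition VVh_skel ::
  "(real^3) set \<Rightarrow> (real^3) set set \<Rightarrow> nat \<Rightarrow> (nat \<Rightarrow> (real^3) set) \<Rightarrow> (nat \<times> (real^3) \<Rightarrow> complex) set" where
  "VVh_skel \<Omega> \<T> J D = product_space J (\<lambda>j. Vh_on (frontier (D j)) \<Omega> \<T>)"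

section \<open>Trace and restriction maps\<close>

definition skel_trace ::
  "nat \<Rightarrow> (nat \<Rightarrow> (real^3) set) \<Rightarrow> (real^3 \<Rightarrow> complex) \<Rightarrow> real^3 \<Rightarrow> complex" where
  "skel_trace J D u = restrict0 (skeleton J D) u"

definition local_traces ::
  "nat \<Rightarrow> (nat \<Rightarrow> (real^3) set) \<Rightarrow> (nat \<times> (real^3) \<Rightarrow> complex) \<Rightarrow> nat \<times> (real^3) \<Rightarrow> complex" where
  "local_traces J D u = restrict0 (SIGMA j:{1..J}. frontier (D j)) u"

definition skel_restriction ::
  "nat \<Rightarrow> (nat \<Rightarrow> (real^3) set) \<Rightarrow> (real^3 \<Rightarrow> complex) \<Rightarrow> nat \<times> (real^3) \<Rightarrow> complex" where
  "skel_restriction J D p = restrict0 (SIGMA j:{1..J}. frontier (D j)) (\<lambda>(j, x). p x)"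

section \<open>Operators\<close>

text \<open>
  The gradients are taken classically: a function in \<^const>\<open>Vh\<close> is affine on each mesh element,
  hence differentiable off a null set. Only points of the open set \<open>G\<close> matter, so the extension by
  zero does not interfere.
\<close>

definition energy_form ::
  "(real^3 \<Rightarrow> real) \<Rightarrow> (real^3 \<Rightarrow> real) \<Rightarrow> (real^3) set \<Rightarrow>
   (real^3 \<Rightarrow> complex) \<Rightarrow> (real^3 \<Rightarrow> complex) \<Rightarrow> complex" where
  "energy_form \<alpha> \<beta> G u v =
     (\<integral>x. of_real (\<alpha> x) * (\<Sum>i\<in>UNIV. partial_deriv i u x * partial_deriv i v x)
          + of_real (\<beta> x) * u x * v x \<partial>lebesgue_on G)"

definition global_op ::
  "(real^3 \<Rightarrow> real) \<Rightarrow> (real^3 \<Rightarrow> real) \<Rightarrow> (real^3) set \<Rightarrow> (real^3) set set \<Rightarrow>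
   (real^3 \<Rightarrow> complex) \<Rightarrow> (real^3 \<Rightarrow> complex) \<Rightarrow> complex" where
  "global_op \<alpha> \<beta> \<Omega> \<T> u = restrict0 (Vh \<Omega> \<T>) (energy_form \<alpha> \<beta> \<Omega> u)"

definition block_op ::
  "(real^3 \<Rightarrow> real) \<Rightarrow> (real^3 \<Rightarrow> real) \<Rightarrow> (real^3) set \<Rightarrow> (real^3) set set \<Rightarrow>
   nat \<Rightarrow> (nat \<Rightarrow> (real^3) set) \<Rightarrow>
   (nat \<times> (real^3) \<Rightarrow> complex) \<Rightarrow> (nat \<times> (real^3) \<Rightarrow> complex) \<Rightarrow> complex" where
  "block_op \<alpha> \<beta> \<Omega> \<T> J D u = restrict0 (VVh_dom \<Omega> \<T> J D)
     (\<lambda>v. \<Sum>j\<in>{1..J}. energy_form \<alpha> \<beta> (D j) (\<lambda>x. u (j, x)) (\<lambda>x. v (j, x)))"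

text \<open>The operator \<open>T\<^sub>L\<close>, defined as the inverse of \<open>B L\<^sup>-\<^sup>1 B\<^sup>*\<close>.\<close>

definition DtN_op ::
  "(real^3 \<Rightarrow> real) \<Rightarrow> (real^3 \<Rightarrow> real) \<Rightarrow> (real^3) set \<Rightarrow> (real^3) set set \<Rightarrow>
   nat \<Rightarrow> (nat \<Rightarrow> (real^3) set) \<Rightarrow>
   (nat \<times> (real^3) \<Rightarrow> complex) \<Rightarrow> (nat \<times> (real^3) \<Rightarrow> complex) \<Rightarrow> complex" where
  "DtN_op \<alpha> \<beta> \<Omega> \<T> J D =
     inv_into (dual_space (VVh_skel \<Omega> \<T> J D))
       (local_traces J D
        \<circ> inv_into (VVh_dom \<Omega> \<T> J D) (block_op \<alpha> \<beta> \<Omega> \<T> J D)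
        \<circ> dual_map (VVh_dom \<Omega> \<T> J D) (local_traces J D))"

end

(*
  Since T_L inverts B L^-1 B^*, the form <T_L q, conj q> is the least energy of a tuple of local
  functions with boundary traces q. A tuple whose traces are R p for a single function p on the
  skeleton glues to a conforming function, and the global energy is the sum of the local ones; so
  R^* T_L R is the Schur complement of the global operator, i.e. the inverse of its Bcal Lcal^-1 Bcal^*.
  The inverse of Bcal Ltilde^-1 Bcal^* is likewise the Schur complement of Ltilde. The inequalities
  m Ltilde <= Lcal <= M Ltilde, with m and M the extreme eigenvalues of Ltilde^-1 Lcal, pass to
  energies of minimal lifts, that is, to Schur complements, and confine the eigenvalues of the
  preconditioned skeleton operator to [m, M].
*)
theory Submission
  imports Defs "HOL-Library.Function_Algebras" "HOL-Computational_Algebra.Fundamental_Theorem_Algebra"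
begin

section \<open>Hermitian forms on finite-dimensional spaces\<close>

text \<open>\<open>DtN_op\<close> is an \<open>inv_into\<close> and \<open>cond_number\<close> a
  quotient of \<open>Max\<close> and \<open>Min\<close>. They carry their intended meaning once B
  L^-1 B^* is known to be bijective and the spectra to be finite and nonempty. On a zero space the
  spectrum is empty, hence the check that the skeleton space is nontrivial. The spaces are carriers
  inside function types, so a spectral theorem for a pair of Hermitian forms is built relative to a
  carrier; it is what turns extreme eigenvalues into two-sided bounds between forms, and attained
  values of their quotient back into eigenvalues. On the analytic side the obstacle is the weak
  derivative in \<open>Vh\<close>: gluing local minimisers yields a function of which only the
  behaviour on each cell is known. Closed cells share their faces, so cellwise affinity already
  forces continuity; weak derivatives are then obtained from difference quotients and translation
  invariance, which replaces a divergence theorem on tetrahedra and a cancellation of face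
  terms.\<close>

definition linear_within ::
  "(complex \<Rightarrow> 'v \<Rightarrow> 'v) \<Rightarrow> 'v set \<Rightarrow> ('v::ab_group_add \<Rightarrow> 'v) \<Rightarrow> bool" where
  "linear_within sc W A \<longleftrightarrow> A ` W \<subseteq> W \<and> (\<forall>u\<in>W. \<forall>v\<in>W. A (u + v) = A u + A v) \<and>
     (\<forall>c. \<forall>u\<in>W. A (sc c u) = sc c (A u))"

text \<open>Horner's scheme for the vector p(A)u. With u fixed, no powers of A as operators are
  needed, and A is applied only to vectors of the invariant carrier.\<close>

definition poly_action ::
  "(complex \<Rightarrow> 'v \<Rightarrow> 'v) \<Rightarrow> ('v::ab_group_add \<Rightarrow> 'v) \<Rightarrow> 'v \<Rightarrow> complex poly \<Rightarrow> 'v" where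
  "poly_action sc A u p = fold_coeffs (\<lambda>a w. sc a u + A w) p 0"

locale complex_space = vector_space scale
  for scale :: "complex \<Rightarrow> 'v::ab_group_add \<Rightarrow> 'v" (infixr \<open>\<cdot>\<close> 75)
begin

definition finite_dim :: "'v set \<Rightarrow> bool" where
  "finite_dim V \<longleftrightarrow> subspace V \<and> (\<exists>S. finite S \<and> V \<subseteq> span S)"

section \<open>Eigenvectors by evaluating polynomials at an operator\<close>

context
  fixes W A u
  assumes W: "subspace W" and A: "linear_within scale W A" and u: "u \<in> W"
begin

private lemma A_0: "A 0 = 0"
  using A W subspace_0[of W] unfolding linear_within_def by (metis scale_zero_left)

private lemma A_in: "w \<in> W \<Longrightarrow> A w \<in> W"
  using A unfolding linear_within_def by blast

private abbreviation "pa \<equiv> poly_action scale A u"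

private lemma pa_0: "pa 0 = 0"
  by (simp add: poly_action_def)

private lemma pa_pCons: "pa (pCons a p) = a \<cdot> u + A (pa p)"
\<comment> \<open>\<open>pCons 0 0\<close> is the zero polynomial, through which
  \<open>fold_coeffs\<close> makes no step; there the recursion holds because A 0 = 0.\<close>
proof (cases "a = 0 \<and> p = 0")
  case True
  then show ?thesis by (simp add: poly_action_def A_0)
next
  case False
  then show ?thesis by (auto simp: poly_action_def)
qed

private lemma pa_in: "pa p \<in> W"
  by (induction p) (auto simp: pa_0 pa_pCons subspace_0[OF W] intro!: subspace_add[OF W] subspace_scale[OF W] u A_in)

private lemma pa_add: "pa (p + q) = pa p + pa q"
proof (induction p q rule: poly_induct2)
  case (pCons a p b q)
  have "A (pa p + pa q) = A (pa p) + A (pa q)"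
    using A pa_in unfolding linear_within_def by blast
  then show ?case using pCons
    by (simp add: pa_pCons scale_left_distrib)
qed (simp add: pa_0)

private lemma pa_smult: "pa (smult c p) = c \<cdot> pa p"
proof (induction p)
  case (pCons a p)
  have "A (c \<cdot> pa p) = c \<cdot> A (pa p)"
    using A pa_in unfolding linear_within_def by blast
  then show ?case using pCons
    by (simp add: pa_pCons scale_right_distrib)
qed (simp add: pa_0)

private lemma pa_sum: "finite I \<Longrightarrow> pa (\<Sum>i\<in>I. f i) = (\<Sum>i\<in>I. pa (f i))"
  by (induction I rule: finite_induct) (auto simp: pa_0 pa_add)

text \<open>Otherwise p |-> p(A)u would be injective, and the images of the monomials an infinite
  independent family in the span of a finite set.\<close>

private lemma annihilating_poly:
  assumes fd: "finite S" "W \<subseteq> span S"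
  shows "\<exists>p. p \<noteq> 0 \<and> pa p = 0"
proof (rule ccontr)
  assume "\<not> ?thesis"
  then have nz: "p = 0" if "pa p = 0" for p using that by blast
  have inj: "inj pa"
  proof (rule injI)
    fix p q assume "pa p = pa q"
    moreover have "pa p = pa (p - q) + pa q" using pa_add[of "p - q" q] by simp
    ultimately show "p = q" using nz[of "p - q"] by simp
  qed
  let ?b = "\<lambda>i::nat. pa (monom 1 i)"
  have injb: "inj ?b" 
  proof (rule injI)
    fix i j assume "?b i = ?b j"
    then have "monom (1::complex) i = monom 1 j" by (rule injD[OF inj])
    then show "i = j" by (simp add: monom_eq_iff')
  qed
  have "independent (range ?b)"
    unfolding independent_explicit_module
  proof (intro allI impI)
    fix t c v assume t: "finite t" "t \<subseteq> range ?b" and s: "(\<Sum>v\<in>t. c v \<cdot> v) = 0" and v: "v \<in> t"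
    obtain I where I: "t = ?b ` I" using t(2) by (meson subset_imageE)
    have finI: "finite I" using t(1) I injb by (metis finite_imageD inj_on_subset subset_UNIV)
    have "0 = (\<Sum>i\<in>I. c (?b i) \<cdot> ?b i)"
      using s unfolding I by (subst (asm) sum.reindex) (auto intro: inj_on_subset[OF injb])
    also have "\<dots> = pa (\<Sum>i\<in>I. monom (c (?b i)) i)"
      by (simp add: pa_sum[OF finI] flip: pa_smult) (simp add: smult_monom)
    finally have z: "(\<Sum>i\<in>I. monom (c (?b i)) i) = 0" using nz by metis
    obtain k where k: "k \<in> I" "v = ?b k" using v I by blast
    have "0 = coeff (\<Sum>i\<in>I. monom (c (?b i)) i) k" using z by simp
    also have "\<dots> = c v" using finI k by (simp add: coeff_sum)
    finally show "c v = 0" by simp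
  qed
  moreover have "range ?b \<subseteq> span S" using pa_in fd by blast
  ultimately have "finite (range ?b)" using independent_span_bound[OF fd(1)] by blast
  then show False using injb finite_imageD by blast
qed

text \<open>Take a nonzero p of least degree with p(A)u = 0 and split off a root z, so p = (X - z)
  q. Minimality gives q(A)u \<noteq> 0, and A multiplies this vector by z. Since u \<noteq> 0, p is
  not constant and the fundamental theorem of algebra applies.\<close>

lemma eigenvector_exists:
  assumes fd: "finite S" "W \<subseteq> span S" and u0: "u \<noteq> 0"
  shows "\<exists>w\<in>W. w \<noteq> 0 \<and> (\<exists>z. A w = z \<cdot> w)"
proof -
  obtain p where p: "p \<noteq> 0 \<and> pa p = 0"
    and least: "\<And>q. q \<noteq> 0 \<and> pa q = 0 \<Longrightarrow> degree p \<le> degree q"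
    using ex_has_least_nat[of "\<lambda>p. p \<noteq> 0 \<and> pa p = 0" _ degree] annihilating_poly[OF fd] by blast
  have "degree p \<noteq> 0"
  proof
    assume "degree p = 0"
    then obtain a where a: "p = [:a:]" using degree_eq_zeroE by blast
    then have "a \<cdot> u = 0" using p by (auto simp: pa_pCons pa_0 A_0)
    then show False using p u0 a by simp
  qed
  then have "\<not> constant (poly p)" by (simp add: constant_degree)
  then obtain z where "poly p z = 0" using fundamental_theorem_of_algebra by blast
  then obtain q where q: "p = [:- z, 1:] * q" unfolding poly_eq_0_iff_dvd by blast
  have q0: "q \<noteq> 0" using p q by auto
  have "degree p = Suc (degree q)" unfolding q using q0 by (subst degree_mult_eq) auto
  then have w0: "pa q \<noteq> 0" using least[of q] q0 by force
  have "pa p = pa (smult (- z) q + pCons 0 q)" unfolding q by simp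
  also have "\<dots> = (- z) \<cdot> pa q + A (pa q)" by (simp only: pa_add pa_smult pa_pCons) simp
  finally have "A (pa q) = z \<cdot> pa q" using p by simp
  then show ?thesis using w0 pa_in by blast
qed

end

end

text \<open>The form is linear in the first slot and, by symmetry, antilinear in the second. It will
  be instantiated with u, w |-> \<open>A u (cconj w)\<close>, where the conjugation is the one that
  the bilinear pairing leaves explicit.\<close>

locale hermitian_space = complex_space scale
  for scale :: "complex \<Rightarrow> 'v::ab_group_add \<Rightarrow> 'v" (infixr \<open>\<cdot>\<close> 75) +
  fixes V :: "'v set" and g :: "'v \<Rightarrow> 'v \<Rightarrow> complex"
  assumes fd: "finite_dim V"
    and add_left: "\<And>u v w. u \<in> V \<Longrightarrow> v \<in> V \<Longrightarrow> w \<in> V \<Longrightarrow> g (u + v) w = g u w + g v w"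
    and scale_left: "\<And>c u w. u \<in> V \<Longrightarrow> w \<in> V \<Longrightarrow> g (c \<cdot> u) w = c * g u w"
    and hermitian: "\<And>u w. u \<in> V \<Longrightarrow> w \<in> V \<Longrightarrow> g u w = cnj (g w u)"
    and positive: "\<And>u. u \<in> V \<Longrightarrow> u \<noteq> 0 \<Longrightarrow> Re (g u u) > 0"
begin

lemma sub: "subspace V"
  using fd by (simp add: finite_dim_def)

lemmas V_closed = subspace_0[OF sub] subspace_add[OF sub] subspace_scale[OF sub]
  subspace_diff[OF sub] subspace_neg[OF sub] subspace_sum[OF sub]

lemma zero_left: "w \<in> V \<Longrightarrow> g 0 w = 0"
  using scale_left[of 0 w 0] V_closed by simp

lemma diff_left: "u \<in> V \<Longrightarrow> v \<in> V \<Longrightarrow> w \<in> V \<Longrightarrow> g (u - v) w = g u w - g v w"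
  using add_left[of "u - v" v w] V_closed by simp

lemma sum_left: "finite I \<Longrightarrow> (\<And>i. i \<in> I \<Longrightarrow> f i \<in> V) \<Longrightarrow> w \<in> V \<Longrightarrow> g (\<Sum>i\<in>I. f i) w = (\<Sum>i\<in>I. g (f i) w)"
  by (induction I rule: finite_induct) (auto simp: zero_left add_left V_closed)

lemma add_right: "u \<in> V \<Longrightarrow> v \<in> V \<Longrightarrow> w \<in> V \<Longrightarrow> g w (u + v) = g w u + g w v"
  using hermitian V_closed add_left by (metis complex_cnj_add)

lemma scale_right: "u \<in> V \<Longrightarrow> w \<in> V \<Longrightarrow> g w (c \<cdot> u) = cnj c * g w u"
  using hermitian V_closed scale_left by (metis complex_cnj_mult)

lemma self_real: "u \<in> V \<Longrightarrow> g u u = of_real (Re (g u u))"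
  using hermitian[of u u] by (metis Reals_cnj_iff of_real_Re)

lemma nonneg: "u \<in> V \<Longrightarrow> Re (g u u) \<ge> 0"
  using positive[of u] zero_left[of u] by (cases "u = 0") auto

section \<open>Orthonormal bases, Riesz representation and simultaneous diagonalisation\<close>

definition orthonormal :: "'v set \<Rightarrow> bool" where
  "orthonormal E \<longleftrightarrow> E \<subseteq> V \<and> (\<forall>e\<in>E. \<forall>f\<in>E. g e f = (if e = f then 1 else 0))"

lemma orthonormal_coeff:
  assumes "orthonormal E" "finite E" "f \<in> E"
  shows "g (\<Sum>e\<in>E. c e \<cdot> e) f = c f"
proof -
  have EV: "e \<in> V" if "e \<in> E" for e using assms that by (auto simp: orthonormal_def)
  have "g (\<Sum>e\<in>E. c e \<cdot> e) f = (\<Sum>e\<in>E. c e * g e f)"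
    using assms(2,3) EV by (subst sum_left) (auto simp: scale_left V_closed)
  also have "\<dots> = (\<Sum>e\<in>E. if e = f then c f else 0)"
    using assms by (intro sum.cong) (auto simp: orthonormal_def)
  finally show ?thesis using assms by simp
qed

lemma orthonormal_independent:
  assumes "orthonormal E"
  shows "independent E"
  unfolding independent_explicit_module
proof (intro allI impI)
  fix t c v assume t: "finite t" "t \<subseteq> E" "(\<Sum>v\<in>t. c v \<cdot> v) = 0" "v \<in> t"
  have o: "orthonormal t" using assms t(2) unfolding orthonormal_def by (meson subset_iff)
  then have "v \<in> V" using t by (auto simp: orthonormal_def)
  then show "c v = 0" using orthonormal_coeff[OF o t(1,4), of c] t(3) by (simp add: zero_left)
qed

text \<open>An orthonormal family in \<open>Q\<close> of largest cardinality already spans: if some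
  u differed from its expansion, the remainder would be orthogonal to the family, and
  \<open>step\<close> would supply one more vector to normalise and add. With \<open>Q\<close>
  trivial this gives an orthonormal basis; with \<open>Q\<close> meaning eigenvector it gives the
  spectral theorem.\<close>

lemma orthonormal_basis_within:
  assumes Q: "\<And>c w. Q w \<Longrightarrow> Q (c \<cdot> w)"
    and step: "\<And>E u. orthonormal E \<Longrightarrow> finite E \<Longrightarrow> (\<forall>e\<in>E. Q e) \<Longrightarrow> u \<in> V \<Longrightarrow> u \<noteq> 0 \<Longrightarrow>
       (\<forall>e\<in>E. g u e = 0) \<Longrightarrow> \<exists>w\<in>V. w \<noteq> 0 \<and> Q w \<and> (\<forall>e\<in>E. g w e = 0)"
  obtains E where "orthonormal E" "finite E" "\<forall>e\<in>E. Q e" "\<And>u. u \<in> V \<Longrightarrow> u = (\<Sum>e\<in>E. g u e \<cdot> e)"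
proof -
  obtain S where S: "finite S" "V \<subseteq> span S" using fd by (auto simp: finite_dim_def)
  let ?P = "\<lambda>E. orthonormal E \<and> (\<forall>e\<in>E. Q e)"
  have bd: "finite E \<and> card E \<le> card S" if "?P E" for E
    using that S orthonormal_independent independent_span_bound[OF S(1), of E]
    by (auto simp: orthonormal_def)
  have "?P {}" by (auto simp: orthonormal_def)
  moreover have "\<forall>E. ?P E \<longrightarrow> card E < Suc (card S)" using bd by (simp add: less_Suc_eq_le)
  ultimately obtain E where E: "?P E" and max: "\<And>E'. ?P E' \<Longrightarrow> card E' \<le> card E"
    using ex_has_greatest_nat[of ?P "{}" card "Suc (card S)"] by auto
  have finE: "finite E" using bd E by blast
  have EV: "e \<in> V" if "e \<in> E" for e using E that by (auto simp: orthonormal_def)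
  have "u = (\<Sum>e\<in>E. g u e \<cdot> e)" if u: "u \<in> V" for u
  proof (rule ccontr)
    assume ne: "u \<noteq> (\<Sum>e\<in>E. g u e \<cdot> e)"
    let ?s = "\<Sum>e\<in>E. g u e \<cdot> e"
    have s: "?s \<in> V" using EV by (intro V_closed) auto
    have "\<forall>e\<in>E. g (u - ?s) e = 0"
      using E EV u s by (auto simp: diff_left orthonormal_coeff[OF _ finE])
    then obtain w where w: "w \<in> V" "w \<noteq> 0" "Q w" "\<forall>e\<in>E. g w e = 0"
      using step[of E "u - ?s"] E finE u s ne V_closed by auto
    define c where "c = complex_of_real (1 / sqrt (Re (g w w)))"
    have pos: "Re (g w w) > 0" using positive w by blast
    have cV: "c \<cdot> w \<in> V" using w V_closed by blast
    have "g (c \<cdot> w) (c \<cdot> w) = c * (cnj c * g w w)"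
      using w cV by (simp add: scale_left scale_right)
    also have "\<dots> = of_real ((1 / sqrt (Re (g w w)))^2 * Re (g w w))"
      by (subst self_real[OF w(1)]) (simp add: c_def power2_eq_square flip: of_real_mult)
    also have "(1 / sqrt (Re (g w w)))^2 * Re (g w w) = 1"
      using pos by (simp add: power_divide)
    finally have n: "g (c \<cdot> w) (c \<cdot> w) = 1" by simp
    have orth: "g (c \<cdot> w) e = 0 \<and> g e (c \<cdot> w) = 0" if "e \<in> E" for e
    proof -
      have "g (c \<cdot> w) e = 0" using that w EV by (simp add: scale_left)
      then show ?thesis using hermitian[of e "c \<cdot> w"] EV[OF that] cV by simp
    qed
    \<comment> \<open>The new vector has norm 1 but is orthogonal to every element of
      \<open>E\<close>, so the family really grows, against maximality.\<close>
    have notin: "c \<cdot> w \<notin> E" using orth n by force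
    have "?P (insert (c \<cdot> w) E)"
      using E orth n cV Q[OF w(3)] notin unfolding orthonormal_def by auto
    then show False using max[of "insert (c \<cdot> w) E"] notin finE by simp
  qed
  then show ?thesis using that E finE by blast
qed

lemma orthonormal_basis:
  obtains E where "orthonormal E" "finite E" "\<And>u. u \<in> V \<Longrightarrow> u = (\<Sum>e\<in>E. g u e \<cdot> e)"
  by (rule orthonormal_basis_within[of "\<lambda>_. True"]) blast+

lemma eq_if_form_eq:
  assumes "u \<in> V" "v \<in> V" "\<And>w. w \<in> V \<Longrightarrow> g u w = g v w"
  shows "u = v"
proof -
  have "Re (g (u - v) (u - v)) = 0" using assms V_closed by (simp add: diff_left)
  then show ?thesis using positive[of "u - v"] assms V_closed by force
qed

text \<open>The representing vector has the coordinates \<psi> e. Antilinearity of \<psi> matches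
  that of the form in its second slot: expanding w puts the same conjugate coefficients on both
  sides.\<close>

lemma riesz:
  assumes add: "\<And>u v. u \<in> V \<Longrightarrow> v \<in> V \<Longrightarrow> \<psi> (u + v) = \<psi> u + \<psi> v"
    and scl: "\<And>c u. u \<in> V \<Longrightarrow> \<psi> (c \<cdot> u) = cnj c * \<psi> u"
  shows "\<exists>u\<in>V. \<forall>w\<in>V. g u w = \<psi> w"
proof -
  obtain E where E: "orthonormal E" "finite E" "\<And>u. u \<in> V \<Longrightarrow> u = (\<Sum>e\<in>E. g u e \<cdot> e)"
    using orthonormal_basis by blast
  have EV: "e \<in> V" if "e \<in> E" for e using E that by (auto simp: orthonormal_def)
  have z: "\<psi> 0 = 0" using scl[of 0 0] V_closed by simp
  have sum: "\<psi> (\<Sum>i\<in>I. f i) = (\<Sum>i\<in>I. \<psi> (f i))" if "finite I" "\<And>i. i \<in> I \<Longrightarrow> f i \<in> V" for I and f :: "'v \<Rightarrow> 'v"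
    using that by (induction I rule: finite_induct) (auto simp: z add V_closed)
  let ?u = "\<Sum>e\<in>E. \<psi> e \<cdot> e"
  have u: "?u \<in> V" by (intro V_closed EV)
  have "g ?u w = \<psi> w" if w: "w \<in> V" for w
  proof -
    have "g ?u w = (\<Sum>e\<in>E. \<psi> e * g e w)"
      using E EV w by (subst sum_left) (auto simp: scale_left V_closed)
    also have "\<dots> = (\<Sum>e\<in>E. \<psi> (g w e \<cdot> e))"
      using EV w by (intro sum.cong) (auto simp: scl hermitian[of _ w])
    also have "\<dots> = \<psi> (\<Sum>e\<in>E. g w e \<cdot> e)" using E EV by (subst sum) (auto simp: V_closed)
    also have "\<dots> = \<psi> w" using E(3)[OF w] by simp
    finally show ?thesis .
  qed
  then show ?thesis using u by blast
qed

text \<open>Riesz turns h into an operator A with h u w = g (A u) w, self-adjoint for g. The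
  g-orthogonal complement of the eigenvectors found so far is therefore A-invariant and, unless it
  is zero, contains a further eigenvector; \<open>orthonormal_basis_within\<close> collects
  them.\<close>

lemma pencil_eigenbasis:
  assumes hadd: "\<And>u v w. u \<in> V \<Longrightarrow> v \<in> V \<Longrightarrow> w \<in> V \<Longrightarrow> h (u + v) w = h u w + h v w"
    and hscl: "\<And>c u w. u \<in> V \<Longrightarrow> w \<in> V \<Longrightarrow> h (c \<cdot> u) w = c * h u w"
    and hherm: "\<And>u w. u \<in> V \<Longrightarrow> w \<in> V \<Longrightarrow> h u w = cnj (h w u)"
  obtains E where "orthonormal E" "finite E" "\<And>u. u \<in> V \<Longrightarrow> u = (\<Sum>e\<in>E. g u e \<cdot> e)"
    "\<And>e. e \<in> E \<Longrightarrow> \<exists>l. \<forall>w\<in>V. h e w = l * g e w"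
proof -
  have hadd': "h w (u + v) = h w u + h w v" if "u \<in> V" "v \<in> V" "w \<in> V" for u v w
    using that hherm hadd V_closed by (metis complex_cnj_add)
  have hscl': "h w (c \<cdot> u) = cnj c * h w u" if "u \<in> V" "w \<in> V" for u w c
    using that hherm hscl V_closed by (metis complex_cnj_mult)
  have "\<exists>a\<in>V. \<forall>w\<in>V. g a w = h u w" if "u \<in> V" for u
    by (rule riesz) (use that in \<open>auto simp: hadd' hscl'\<close>)
  then obtain A where A: "\<And>u. u \<in> V \<Longrightarrow> A u \<in> V" "\<And>u w. u \<in> V \<Longrightarrow> w \<in> V \<Longrightarrow> g (A u) w = h u w"
    by metis
  have Aadd: "A (u + v) = A u + A v" if "u \<in> V" "v \<in> V" for u v
    by (rule eq_if_form_eq) (use that A in \<open>auto simp: V_closed add_left hadd\<close>)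
  have Ascl: "A (c \<cdot> u) = c \<cdot> A u" if "u \<in> V" for u c
    by (rule eq_if_form_eq) (use that A in \<open>auto simp: V_closed scale_left hscl\<close>)
  let ?Q = "\<lambda>e. \<exists>l. A e = l \<cdot> e \<and> e \<in> V"
  obtain E where E: "orthonormal E" "finite E" "\<forall>e\<in>E. ?Q e" "\<And>u. u \<in> V \<Longrightarrow> u = (\<Sum>e\<in>E. g u e \<cdot> e)"
  proof (rule orthonormal_basis_within[of ?Q, OF _ _ that])
    fix c w assume "?Q w"
    then show "?Q (c \<cdot> w)" using Ascl V_closed by (metis scale_left_commute)
  next
    fix E u assume E: "orthonormal E" "finite E" "\<forall>e\<in>E. ?Q e"
      and u: "u \<in> V" "u \<noteq> 0" "\<forall>e\<in>E. g u e = 0"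
    define W where "W = {u \<in> V. \<forall>e\<in>E. g u e = 0}"
    have EV: "e \<in> V" if "e \<in> E" for e using E that by (auto simp: orthonormal_def)
    have W: "subspace W"
      unfolding W_def by (rule subspaceI) (use EV in \<open>auto simp: V_closed zero_left add_left scale_left\<close>)
    have inv: "A w \<in> W" if w: "w \<in> W" for w
    proof -
      have "g (A w) e = 0" if e: "e \<in> E" for e
      proof -
        have wV: "w \<in> V" and we: "g w e = 0" using w e by (auto simp: W_def)
        obtain l where l: "A e = l \<cdot> e" using E e by blast
        have "g (A w) e = cnj (h e w)" using A hherm[of w e] wV EV[OF e] by simp
        also have "\<dots> = cnj (g (l \<cdot> e) w)" using A(2)[of e w] l wV EV[OF e] by simp
        also have "\<dots> = cnj l * g w e" using wV EV[OF e] hermitian[of w e] by (simp add: scale_left)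
        finally show ?thesis using we by simp
      qed
      then show ?thesis using w A by (auto simp: W_def)
    qed
    have lin: "linear_within scale W A"
      unfolding linear_within_def using inv Aadd Ascl by (auto simp: W_def)
    obtain S where S: "finite S" "V \<subseteq> span S" using fd by (auto simp: finite_dim_def)
    have "W \<subseteq> span S" "u \<in> W" using S u by (auto simp: W_def)
    then have "\<exists>w\<in>W. w \<noteq> 0 \<and> (\<exists>z. A w = z \<cdot> w)"
      using eigenvector_exists[OF W lin _ S(1)] u by blast
    then show "\<exists>w\<in>V. w \<noteq> 0 \<and> ?Q w \<and> (\<forall>e\<in>E. g w e = 0)" by (auto simp: W_def)
  qed
  moreover have "\<exists>l. \<forall>w\<in>V. h e w = l * g e w" if "e \<in> E" for e
    using E(3) that A(2) scale_left by metis
  ultimately show ?thesis using that by blast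
qed

end

section \<open>Operators between function spaces and their duals\<close>

definition cscale :: "complex \<Rightarrow> ('a \<Rightarrow> complex) \<Rightarrow> 'a \<Rightarrow> complex" where
  "cscale c f = (\<lambda>x. c * f x)"

definition cconj :: "('a \<Rightarrow> complex) \<Rightarrow> 'a \<Rightarrow> complex" where
  "cconj f = (\<lambda>x. cnj (f x))"

interpretation cfun: complex_space cscale
  by unfold_locales (auto simp: cscale_def fun_eq_iff algebra_simps)

lemma cscale_apply [simp]: "cscale c f x = c * f x"
  by (simp add: cscale_def)

lemma cconj_apply [simp]: "cconj f x = cnj (f x)"
  by (simp add: cconj_def)

lemma cconj_cconj [simp]: "cconj (cconj f) = f"
  by (simp add: fun_eq_iff)

lemma cconj_add: "cconj (f + g) = cconj f + cconj g"
  by (simp add: fun_eq_iff)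

lemma cconj_cscale: "cconj (cscale c f) = cscale (cnj c) (cconj f)"
  by (simp add: fun_eq_iff)

text \<open>Conjugation belongs to the notion because the dual pairing is bilinear: the sesquilinear
  form tests with the conjugate of an element, which has to lie in the space again.\<close>

definition conj_space :: "('a \<Rightarrow> complex) set \<Rightarrow> bool" where
  "conj_space V \<longleftrightarrow> cfun.finite_dim V \<and> (\<forall>u\<in>V. cconj u \<in> V)"

lemma conj_spaceD:
  assumes "conj_space V"
  shows "0 \<in> V" "u \<in> V \<Longrightarrow> v \<in> V \<Longrightarrow> u + v \<in> V" "u \<in> V \<Longrightarrow> v \<in> V \<Longrightarrow> u - v \<in> V"
    "u \<in> V \<Longrightarrow> cscale c u \<in> V" "u \<in> V \<Longrightarrow> cconj u \<in> V"
  using assms unfolding conj_space_def cfun.finite_dim_def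
  by (auto intro: cfun.subspace_0 cfun.subspace_add cfun.subspace_diff cfun.subspace_scale)

text \<open>This and the next three lemmas rewrite pointwise definitions with \<open>+\<close>,
  \<open>0\<close>, \<open>cscale\<close> and \<open>cconj\<close>, so that the vector space locale
  applies to them.\<close>

lemma dual_space_iff:
  "\<phi> \<in> dual_space V \<longleftrightarrow> (\<forall>u\<in>V. \<forall>v\<in>V. \<phi> (u + v) = \<phi> u + \<phi> v) \<and>
     (\<forall>c. \<forall>u\<in>V. \<phi> (cscale c u) = c * \<phi> u) \<and> (\<forall>u. u \<notin> V \<longrightarrow> \<phi> u = 0)"
  unfolding dual_space_def plus_fun_def cscale_def by simp

lemma linear_map_iff:
  "linear_map V W A \<longleftrightarrow> A \<in> V \<rightarrow> W \<and> (\<forall>u\<in>V. \<forall>v\<in>V. A (u + v) = A u + A v) \<and>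
     (\<forall>c. \<forall>u\<in>V. A (cscale c u) = cscale c (A u))"
  unfolding linear_map_def plus_fun_def cscale_def by simp

lemma hermitian_pos_def_iff:
  "hermitian_pos_def V A \<longleftrightarrow> (\<forall>u\<in>V. \<forall>v\<in>V. A u (cconj v) = cnj (A v (cconj u))) \<and>
     (\<forall>u\<in>V. u \<noteq> 0 \<longrightarrow> Re (A u (cconj u)) > 0)"
  unfolding hermitian_pos_def_def zero_fun_def cconj_def by simp

lemma eigenvalues_iff: "l \<in> eigenvalues V A \<longleftrightarrow> (\<exists>u\<in>V. u \<noteq> 0 \<and> A u = cscale l u)"
  unfolding eigenvalues_def zero_fun_def cscale_def by simp

lemma dual_space_closed:
  shows "\<phi> \<in> dual_space V \<Longrightarrow> \<psi> \<in> dual_space V \<Longrightarrow> \<phi> + \<psi> \<in> dual_space V"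
    and "\<phi> \<in> dual_space V \<Longrightarrow> cscale c \<phi> \<in> dual_space V"
  by (auto simp: dual_space_iff algebra_simps)

lemma dual_space_0:
  assumes "conj_space V" "\<phi> \<in> dual_space V"
  shows "\<phi> 0 = 0"
proof -
  have "cscale 0 0 = (0 :: 'a \<Rightarrow> complex)" by (simp add: fun_eq_iff)
  then show ?thesis using assms conj_spaceD(1)[OF assms(1)] by (metis dual_space_iff mult_zero_left)
qed

lemma dual_space_eqI:
  assumes "\<phi> \<in> dual_space V" "\<psi> \<in> dual_space V" "\<And>u. u \<in> V \<Longrightarrow> \<phi> u = \<psi> u"
  shows "\<phi> = \<psi>"
  using assms by (auto simp: dual_space_iff fun_eq_iff) metis

text \<open>A basis is taken inside \<open>V\<close>, and the span induction carries membership in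
  \<open>V\<close> along, since B is known to be linear only there. The images of the basis then
  span \<open>W\<close>.\<close>

lemma conj_space_image:
  assumes V: "conj_space V" and B: "linear_map V W B" "B ` V = W"
    and cnj: "\<And>u. u \<in> V \<Longrightarrow> B (cconj u) = cconj (B u)"
  shows "conj_space W"
proof -
  note Vc = conj_spaceD[OF V]
  have Badd: "B (u + v) = B u + B v" if "u \<in> V" "v \<in> V" for u v
    using B that by (auto simp: linear_map_iff)
  have Bscl: "B (cscale c u) = cscale c (B u)" if "u \<in> V" for u c
    using B that by (auto simp: linear_map_iff)
  have B0: "B 0 = 0" using Bscl[OF Vc(1), of 0] by simp
  obtain S where S: "finite S" "V \<subseteq> cfun.span S"
    using V by (auto simp: conj_space_def cfun.finite_dim_def)
  have subV: "cfun.subspace V" using V by (simp add: conj_space_def cfun.finite_dim_def)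
  obtain E where E: "E \<subseteq> V" "cfun.independent E" "V \<subseteq> cfun.span E"
    using cfun.maximal_independent_subset by blast
  have finE: "finite E" using cfun.independent_span_bound[OF S(1) E(2)] E(1) S(2) by blast
  have "W \<subseteq> cfun.span (B ` E)"
  proof -
    have "u \<in> V \<and> B u \<in> cfun.span (B ` E)" if "u \<in> cfun.span E" for u
      using that
    proof (induction rule: cfun.span_induct_alt)
      case base
      show ?case unfolding B0 using cfun.span_zero Vc(1) by blast
    next
      case (step c x y)
      then have "x \<in> V" using E by blast
      then have "B (cscale c x + y) = cscale c (B x) + B y" "cscale c x + y \<in> V"
        using step by (simp_all add: Badd Bscl Vc)
      moreover have "cscale c (B x) + B y \<in> cfun.span (B ` E)"
        by (intro cfun.span_add cfun.span_scale cfun.span_base imageI step(1) conjunct2[OF step(2)])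
      ultimately show ?case by (simp only: conj_commute)
    qed
    then show ?thesis using E B(2) by blast
  qed
  moreover have "cfun.subspace W"
  proof (rule cfun.subspaceI)
    show "0 \<in> W" using B(2) B0 Vc(1) by (metis imageI)
    show "x + y \<in> W" if xy: "x \<in> W" "y \<in> W" for x y
    proof -
      obtain u v where "u \<in> V" "v \<in> V" "x = B u" "y = B v" using xy B(2) by blast
      then show ?thesis using Badd[of u v] Vc(2)[of u v] B(2) by (metis imageI)
    qed
    show "cscale c x \<in> W" if x: "x \<in> W" for c x
    proof -
      obtain u where "u \<in> V" "x = B u" using x B(2) by blast
      then show ?thesis using Bscl[of u c] Vc(4)[of u c] B(2) by (metis imageI)
    qed
  qed
  moreover have "cconj x \<in> W" if x: "x \<in> W" for x
  proof -
    obtain u where "u \<in> V" "x = B u" using x B(2) by blast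
    then show ?thesis using cnj[of u] Vc(5)[of u] B(2) by (metis imageI)
  qed
  ultimately show ?thesis using finE unfolding conj_space_def cfun.finite_dim_def by blast
qed

locale hpd_operator =
  fixes V :: "('a \<Rightarrow> complex) set" and A :: "('a \<Rightarrow> complex) \<Rightarrow> ('a \<Rightarrow> complex) \<Rightarrow> complex"
  assumes V: "conj_space V" and linear: "linear_map V (dual_space V) A"
    and hpd: "hermitian_pos_def V A"
begin

lemmas V_cl = conj_spaceD[OF V]

lemma in_dual: "u \<in> V \<Longrightarrow> A u \<in> dual_space V"
  using linear by (auto simp: linear_map_iff)

lemma op_add: "u \<in> V \<Longrightarrow> v \<in> V \<Longrightarrow> A (u + v) = A u + A v"
  using linear by (auto simp: linear_map_iff)

lemma op_scale: "u \<in> V \<Longrightarrow> A (cscale c u) = cscale c (A u)"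
  using linear by (auto simp: linear_map_iff)

sublocale hermitian_space cscale V "\<lambda>u w. A u (cconj w)"
proof unfold_locales
  show "cfun.finite_dim V" using V by (simp add: conj_space_def)
  show "A u (cconj w) = cnj (A w (cconj u))" if "u \<in> V" "w \<in> V" for u w
    using hpd that unfolding hermitian_pos_def_iff by blast
  show "Re (A u (cconj u)) > 0" if "u \<in> V" "u \<noteq> 0" for u
    using hpd that unfolding hermitian_pos_def_iff by blast
qed (auto simp: op_add op_scale)

lemma op_eqI: "u \<in> V \<Longrightarrow> v \<in> V \<Longrightarrow> (\<And>w. w \<in> V \<Longrightarrow> A u w = A v w) \<Longrightarrow> u = v"
  using eq_if_form_eq V_cl(5) by blast

text \<open>Finite-dimensional Lax-Milgram: injectivity from definiteness, surjectivity from Riesz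
  applied to the antilinear w |-> \<phi> (\<open>cconj\<close> w).\<close>

lemma bij: "bij_betw A V (dual_space V)"
  unfolding bij_betw_def
proof
  show "inj_on A V" by (rule inj_onI) (auto intro: op_eqI)
  have "\<phi> \<in> A ` V" if \<phi>: "\<phi> \<in> dual_space V" for \<phi>
  proof -
    have "\<exists>u\<in>V. \<forall>w\<in>V. A u (cconj w) = \<phi> (cconj w)"
      by (rule riesz) (use \<phi> V_cl in \<open>auto simp: cconj_add cconj_cscale dual_space_iff\<close>)
    then obtain u where u: "u \<in> V" "\<And>w. w \<in> V \<Longrightarrow> A u (cconj w) = \<phi> (cconj w)" by blast
    have "A u w = \<phi> w" if "w \<in> V" for w using u(2)[of "cconj w"] V_cl(5)[OF that] by simp
    then have "A u = \<phi>" using dual_space_eqI[OF in_dual[OF u(1)] \<phi>] by blast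
    then show ?thesis using u(1) by blast
  qed
  then show "A ` V = dual_space V" using in_dual by blast
qed

lemma inv_op:
  assumes "\<phi> \<in> dual_space V"
  shows "inv_into V A \<phi> \<in> V" "A (inv_into V A \<phi>) = \<phi>"
  using assms bij by (auto simp: bij_betw_def f_inv_into_f inv_into_into)

lemma inv_op_eq: "u \<in> V \<Longrightarrow> inv_into V A (A u) = u"
  using bij by (auto simp: bij_betw_def)

end

text \<open>Replaces the spectrum of G^-1 A by the generalised eigenvalue problem A u = l G u, to
  which the theory of two Hermitian forms applies.\<close>

lemma eigenvalues_pencil:
  assumes "hpd_operator V A" "hpd_operator V G"
  shows "l \<in> eigenvalues V (inv_into V G \<circ> A) \<longleftrightarrow> (\<exists>u\<in>V. u \<noteq> 0 \<and> (\<forall>w\<in>V. A u w = l * G u w))"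
proof -
  interpret A: hpd_operator V A by fact
  interpret G: hpd_operator V G by fact
  have "inv_into V G (A u) = cscale l u \<longleftrightarrow> (\<forall>w\<in>V. A u w = l * G u w)" if u: "u \<in> V" for u
  proof
    assume "inv_into V G (A u) = cscale l u"
    then have "A u = cscale l (G u)" using G.inv_op(2)[OF A.in_dual[OF u]] G.op_scale[OF u] by simp
    then show "\<forall>w\<in>V. A u w = l * G u w" by simp
  next
    assume "\<forall>w\<in>V. A u w = l * G u w"
    then have "A u = G (cscale l u)"
      using u A.V_cl by (intro dual_space_eqI[of _ V]) (simp_all add: G.op_scale A.in_dual G.in_dual dual_space_closed(2))
    then show "inv_into V G (A u) = cscale l u" using G.inv_op_eq A.V_cl(4)[OF u] by simp
  qed
  then show ?thesis by (auto simp: eigenvalues_iff)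
qed

text \<open>In a G-orthonormal basis \<open>E\<close> that diagonalises A, both forms are sums of
  |c_e|^2, with weights l e for A and 1 for G, and the eigenvalues are exactly these weights. It
  serves twice: on the finite element space and on the skeleton space.\<close>

lemma pencil_eigenvalues:
  assumes "hpd_operator V A" "hpd_operator V G" and nontriv: "V \<noteq> {0}"
  defines "\<Lambda> \<equiv> Re ` eigenvalues V (inv_into V G \<circ> A)"
  shows "finite \<Lambda>" "\<Lambda> \<noteq> {}" "\<And>x. x \<in> \<Lambda> \<Longrightarrow> x > 0"
    "\<And>u. u \<in> V \<Longrightarrow> Min \<Lambda> * Re (G u (cconj u)) \<le> Re (A u (cconj u))"
    "\<And>u. u \<in> V \<Longrightarrow> Re (A u (cconj u)) \<le> Max \<Lambda> * Re (G u (cconj u))"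
    "\<And>x. x \<in> \<Lambda> \<Longrightarrow> \<exists>u\<in>V. u \<noteq> 0 \<and> Re (A u (cconj u)) = x * Re (G u (cconj u))"
proof -
  interpret A: hpd_operator V A by fact
  interpret G: hpd_operator V G by fact
  note eig = eigenvalues_pencil[OF assms(1,2)]
  obtain E where E: "G.orthonormal E" "finite E" "\<And>u. u \<in> V \<Longrightarrow> u = (\<Sum>e\<in>E. cscale (G u (cconj e)) e)"
    "\<And>e. e \<in> E \<Longrightarrow> \<exists>l. \<forall>w\<in>V. A e (cconj w) = l * G e (cconj w)"
  proof (rule G.pencil_eigenbasis[of "\<lambda>u w. A u (cconj w)", OF _ _ _ that])
    show "A (u + v) (cconj w) = A u (cconj w) + A v (cconj w)" if "u \<in> V" "v \<in> V" "w \<in> V" for u v w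
      by (rule A.add_left[OF that])
    show "A (cscale c u) (cconj w) = c * A u (cconj w)" if "u \<in> V" "w \<in> V" for c u w
      by (rule A.scale_left[OF that])
    show "A u (cconj w) = cnj (A w (cconj u))" if "u \<in> V" "w \<in> V" for u w
      by (rule A.hermitian[OF that])
  qed
  then obtain l where l: "\<And>e w. e \<in> E \<Longrightarrow> w \<in> V \<Longrightarrow> A e (cconj w) = l e * G e (cconj w)" by metis
  have EV: "e \<in> V" if "e \<in> E" for e using E(1) that by (auto simp: G.orthonormal_def)
  have Ge: "G e (cconj e) = 1" if "e \<in> E" for e using E(1) that by (auto simp: G.orthonormal_def)
  have e0: "e \<noteq> 0" if "e \<in> E" for e using Ge[OF that] G.zero_left[of e] EV[OF that] by auto
  have lA: "l e = A e (cconj e)" if "e \<in> E" for e using l[OF that EV[OF that]] Ge[OF that] by simp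
  have lreal: "cnj (l e) = l e" if "e \<in> E" for e
    using A.hermitian[OF EV[OF that] EV[OF that]] lA[OF that] by simp
  have lpos: "Re (l e) > 0" if "e \<in> E" for e
    using A.positive[OF EV[OF that] e0[OF that]] lA[OF that] by simp
  have self: "Re (A u (cconj u)) = x * Re (G u (cconj u))" "x > 0"
    if "u \<in> V" "u \<noteq> 0" "x = Re k" "\<forall>w\<in>V. A u w = k * G u w" for u k x
  proof -
    have "A u (cconj u) = k * G u (cconj u)" using that A.V_cl(5) by blast
    then have k: "A u (cconj u) = k * of_real (Re (G u (cconj u)))"
      using G.self_real[OF that(1)] by simp
    then show "Re (A u (cconj u)) = x * Re (G u (cconj u))" using that(3) by simp
    then show "x > 0" using A.positive[OF that(1,2)] G.positive[OF that(1,2)] zero_less_mult_pos2 by metis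
  qed
  have eigE: "eigenvalues V (inv_into V G \<circ> A) = l ` E"
  proof (intro equalityI subsetI)
    fix k assume "k \<in> l ` E"
    then obtain e where e: "e \<in> E" "k = l e" by blast
    have "A e w = k * G e w" if "w \<in> V" for w
      using l[OF e(1) A.V_cl(5)[OF that]] e(2) by simp
    then show "k \<in> eigenvalues V (inv_into V G \<circ> A)" using eig EV e0 e by blast
  next
    fix k assume "k \<in> eigenvalues V (inv_into V G \<circ> A)"
    then obtain u where u: "u \<in> V" "u \<noteq> 0" "\<And>w. w \<in> V \<Longrightarrow> A u w = k * G u w" using eig by blast
    \<comment> \<open>An eigenvector u has a nonzero coordinate on some e; moving A from u to e by
      Hermitian symmetry, with l e real, forces k = l e.\<close>
    have "\<exists>e\<in>E. G u (cconj e) \<noteq> 0"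
    proof (rule ccontr)
      assume "\<not> ?thesis"
      then have "(\<Sum>e\<in>E. cscale (G u (cconj e)) e) = 0"
        by (intro sum.neutral) (auto simp: fun_eq_iff)
      then have "u = 0" using E(3)[OF u(1)] by (rule trans[rotated])
      then show False using u by blast
    qed
    then obtain e where e: "e \<in> E" "G u (cconj e) \<noteq> 0" by blast
    have "k * G u (cconj e) = A u (cconj e)" using u(3) A.V_cl(5) EV e by simp
    also have "\<dots> = cnj (l e * G e (cconj u))" using A.hermitian[OF u(1) EV[OF e(1)]] l[OF e(1) u(1)] by simp
    also have "\<dots> = l e * G u (cconj e)" using G.hermitian[OF u(1) EV[OF e(1)]] lreal[OF e(1)] by simp
    finally show "k \<in> l ` E" using e by simp
  qed
  show fin: "finite \<Lambda>" unfolding \<Lambda>_def eigE using E(2) by blast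
  have "E \<noteq> {}"
  proof
    assume "E = {}"
    then have "u = 0" if "u \<in> V" for u using E(3)[OF that] unfolding \<open>E = {}\<close> by simp
    then show False using nontriv A.V_cl(1) by blast
  qed
  then show "\<Lambda> \<noteq> {}" unfolding \<Lambda>_def eigE by blast
  show "x > 0" if "x \<in> \<Lambda>" for x using that lpos unfolding \<Lambda>_def eigE by blast
  show "\<exists>u\<in>V. u \<noteq> 0 \<and> Re (A u (cconj u)) = x * Re (G u (cconj u))" if x: "x \<in> \<Lambda>" for x
  proof -
    obtain k where k: "x = Re k" "k \<in> eigenvalues V (inv_into V G \<circ> A)" using x \<Lambda>_def by blast
    then obtain u where "u \<in> V" "u \<noteq> 0" "\<forall>w\<in>V. A u w = k * G u w" using eig by blast
    then show ?thesis using self(1) k(1) by blast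
  qed
  \<comment> \<open>Parseval: only the first argument is expanded, and the second then contributes
    the conjugate coordinate.\<close>
  have forms: "Re (A u (cconj u)) = (\<Sum>e\<in>E. Re (l e) * (cmod (G u (cconj e)))\<^sup>2)"
    "Re (G u (cconj u)) = (\<Sum>e\<in>E. (cmod (G u (cconj e)))\<^sup>2)" if u: "u \<in> V" for u
  proof -
    let ?c = "\<lambda>e. G u (cconj e)"
    have m: "?c e * G e (cconj u) = of_real ((cmod (?c e))\<^sup>2)" if "e \<in> E" for e
      using G.hermitian[OF EV[OF that] u] by (simp add: complex_norm_square[symmetric])
    have "A u (cconj u) = A (\<Sum>e\<in>E. cscale (?c e) e) (cconj u)"
      by (rule arg_cong[where f = "\<lambda>x. A x (cconj u)", OF E(3)[OF u]])
    also have "\<dots> = (\<Sum>e\<in>E. ?c e * A e (cconj u))"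
      using E(2) EV u by (subst A.sum_left) (auto simp: A.scale_left A.V_cl)
    also have "\<dots> = (\<Sum>e\<in>E. l e * of_real ((cmod (?c e))\<^sup>2))"
      by (intro sum.cong refl) (simp only: l[OF _ u] m[symmetric] mult.left_commute)
    also have "Re \<dots> = (\<Sum>e\<in>E. Re (l e) * (cmod (?c e))\<^sup>2)"
      unfolding Re_sum by (intro sum.cong refl) (simp flip: of_real_power)
    finally show "Re (A u (cconj u)) = (\<Sum>e\<in>E. Re (l e) * (cmod (G u (cconj e)))\<^sup>2)" .
    have "G u (cconj u) = G (\<Sum>e\<in>E. cscale (?c e) e) (cconj u)"
      by (rule arg_cong[where f = "\<lambda>x. G x (cconj u)", OF E(3)[OF u]])
    also have "\<dots> = (\<Sum>e\<in>E. ?c e * G e (cconj u))"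
      using E(2) EV u by (subst G.sum_left) (auto simp: G.scale_left A.V_cl)
    also have "\<dots> = (\<Sum>e\<in>E. of_real ((cmod (?c e))\<^sup>2))"
      by (intro sum.cong refl) (simp only: m)
    finally show "Re (G u (cconj u)) = (\<Sum>e\<in>E. (cmod (G u (cconj e)))\<^sup>2)"
      by (simp flip: of_real_power of_real_sum)
  qed
  have bnd: "Min \<Lambda> \<le> Re (l e)" "Re (l e) \<le> Max \<Lambda>" if "e \<in> E" for e
    using fin that unfolding \<Lambda>_def eigE by auto
  show "Min \<Lambda> * Re (G u (cconj u)) \<le> Re (A u (cconj u))" if "u \<in> V" for u
    unfolding forms[OF that] sum_distrib_left by (intro sum_mono mult_right_mono bnd) auto
  show "Re (A u (cconj u)) \<le> Max \<Lambda> * Re (G u (cconj u))" if "u \<in> V" for u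
    unfolding forms[OF that] sum_distrib_left by (intro sum_mono mult_right_mono bnd) auto
qed

lemma cond_number_cong:
  assumes "\<And>u. u \<in> V \<Longrightarrow> A u = B u"
  shows "cond_number V A = cond_number V B"
proof -
  have "eigenvalues V A = eigenvalues V B" using assms by (auto simp: eigenvalues_def)
  then show ?thesis by (simp add: cond_number_def)
qed

section \<open>Schur complements\<close>

lemma dual_map_in_dual:
  assumes "conj_space V" "linear_map V W A" "\<phi> \<in> dual_space W"
  shows "dual_map V A \<phi> \<in> dual_space V"
proof -
  note Vc = conj_spaceD[OF assms(1)]
  have "A u \<in> W" if "u \<in> V" for u using assms(2) that by (auto simp: linear_map_iff)
  then show ?thesis
    using assms Vc by (simp add: dual_space_iff dual_map_def restrict0_def linear_map_iff)
qed

text \<open>Common shape of the skeleton trace, of the tuple of local traces and of restriction to a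
  set. Commuting with conjugation ensures that a conjugated test function has the conjugated
  trace.\<close>

locale trace_map =
  fixes V :: "('a \<Rightarrow> complex) set" and W :: "('b \<Rightarrow> complex) set"
    and B :: "('a \<Rightarrow> complex) \<Rightarrow> 'b \<Rightarrow> complex"
  assumes V: "conj_space V" and B: "linear_map V W B" and surj: "B ` V = W"
    and B_conj: "\<And>u. u \<in> V \<Longrightarrow> B (cconj u) = cconj (B u)"
begin

lemma W: "conj_space W"
  using conj_space_image[OF V B surj B_conj] .

lemmas Vc = conj_spaceD[OF V]
lemmas Wc = conj_spaceD[OF W]

lemma B_in: "u \<in> V \<Longrightarrow> B u \<in> W"
  using surj by blast

lemma B_add: "u \<in> V \<Longrightarrow> v \<in> V \<Longrightarrow> B (u + v) = B u + B v"
  using B by (auto simp: linear_map_iff)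

lemma B_scale: "u \<in> V \<Longrightarrow> B (cscale c u) = cscale c (B u)"
  using B by (auto simp: linear_map_iff)

lemma B_diff: "u \<in> V \<Longrightarrow> v \<in> V \<Longrightarrow> B (u - v) = B u - B v"
  using B_add[of "u - v" v] Vc by simp

lemma dual_map_in:
  assumes "\<phi> \<in> dual_space W"
  shows "dual_map V B \<phi> \<in> dual_space V"
  by (rule dual_map_in_dual[OF V B assms])

lemma dual_map_apply: "w \<in> V \<Longrightarrow> dual_map V B \<phi> w = \<phi> (B w)"
  by (simp add: dual_map_def restrict0_def)

end

locale schur = trace_map V W B + hpd_operator V A
  for V :: "('a \<Rightarrow> complex) set" and W :: "('b \<Rightarrow> complex) set"
    and B :: "('a \<Rightarrow> complex) \<Rightarrow> 'b \<Rightarrow> complex"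
    and A :: "('a \<Rightarrow> complex) \<Rightarrow> ('a \<Rightarrow> complex) \<Rightarrow> complex"
begin

definition K :: "(('b \<Rightarrow> complex) \<Rightarrow> complex) \<Rightarrow> 'b \<Rightarrow> complex" where
  "K = B \<circ> inv_into V A \<circ> dual_map V B"

text \<open>The Schur complement of A with respect to B. The \<open>inv_into\<close> on the dual
  space is literally the shape of \<open>DtN_op\<close>; that it is a genuine inverse follows from
  \<open>K_bij\<close>.\<close>

definition S :: "('b \<Rightarrow> complex) \<Rightarrow> ('b \<Rightarrow> complex) \<Rightarrow> complex" where
  "S = inv_into (dual_space W) K"

text \<open>K \<phi> is the trace of the solution of a variational problem whose datum sees only
  traces. This lemma and \<open>K_lift\<close> let that problem stand in for the inverse of A from
  here on.\<close>

lemma K_eqI: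
  assumes "v \<in> V" "\<phi> \<in> dual_space W" "\<And>w. w \<in> V \<Longrightarrow> A v w = \<phi> (B w)"
  shows "K \<phi> = B v"
proof -
  have "dual_map V B \<phi> = A v"
    by (rule dual_space_eqI[OF dual_map_in[OF assms(2)] in_dual[OF assms(1)]])
      (simp add: dual_map_apply assms(3))
  then show ?thesis using inv_op_eq[OF assms(1)] by (simp add: K_def)
qed

lemma K_lift:
  assumes "\<phi> \<in> dual_space W"
  obtains v where "v \<in> V" "K \<phi> = B v" "\<And>w. w \<in> V \<Longrightarrow> A v w = \<phi> (B w)"
proof -
  let ?v = "inv_into V A (dual_map V B \<phi>)"
  have "A ?v w = \<phi> (B w)" if "w \<in> V" for w
    using inv_op(2)[OF dual_map_in[OF assms]] dual_map_apply[OF that] by simp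
  then show ?thesis using that inv_op(1)[OF dual_map_in[OF assms]] by (simp add: K_def)
qed

text \<open>The difference d of the two lifts has zero trace, and so has its conjugate; both data
  vanish on it, so A d (conj d) = 0. The data may differ, which is what injectivity of
  \<open>K\<close> requires.\<close>

lemma lift_eqI:
  assumes v: "v \<in> V" "v' \<in> V" "B v = B v'"
    and eq: "\<And>w. w \<in> V \<Longrightarrow> A v w = \<phi> (B w)" "\<And>w. w \<in> V \<Longrightarrow> A v' w = \<phi>' (B w)"
    and \<phi>: "\<phi> \<in> dual_space W" "\<phi>' \<in> dual_space W"
  shows "v = v'"
proof -
  have d: "v - v' \<in> V" "cconj (v - v') \<in> V" using v Vc by auto
  have "B (cconj (v - v')) = 0" using v d by (simp add: B_conj B_diff fun_eq_iff)
  then have "A (v - v') (cconj (v - v')) = 0"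
    using eq[OF d(2)] v(1,2) d(1) dual_space_0[OF W \<phi>(1)] dual_space_0[OF W \<phi>(2)]
    by (simp add: diff_left)
  then show ?thesis using positive[OF d(1)] by force
qed

text \<open>
  Surjectivity: a lift of \<open>q\<close> is corrected by its orthogonal projection on the kernel of \<open>B\<close>; what
  remains pairs with \<open>w\<close> only through \<open>B w\<close>.
\<close>

lemma K_surj:
  assumes q: "q \<in> W"
  shows "\<exists>\<phi>\<in>dual_space W. K \<phi> = q"
proof -
  obtain v0 where v0: "v0 \<in> V" "q = B v0" using q surj by blast
  define N where "N = {u \<in> V. B u = 0}"
  have NV: "u \<in> V" if "u \<in> N" for u using that by (simp add: N_def)
  have B0: "B 0 = 0" using B_diff[OF Vc(1) Vc(1)] by simp
  have subN: "cfun.subspace N"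
    by (rule cfun.subspaceI) (auto simp: N_def B_add B_scale B0 Vc fun_eq_iff)
  interpret N: hermitian_space cscale N "\<lambda>u w. A u (cconj w)"
  proof unfold_locales
    obtain F where F: "finite F" "V \<subseteq> cfun.span F"
      using fd unfolding cfun.finite_dim_def by blast
    then have "N \<subseteq> cfun.span F" using NV by blast
    then show "cfun.finite_dim N" unfolding cfun.finite_dim_def using subN F by blast
    show "A u (cconj w) = cnj (A w (cconj u))" if "u \<in> N" "w \<in> N" for u w
      using hermitian NV that by blast
    show "0 < Re (A u (cconj u))" if "u \<in> N" "u \<noteq> 0" for u
      using positive NV that by blast
  qed (auto simp: op_add op_scale NV)
  have "\<exists>n\<in>N. \<forall>w\<in>N. A n (cconj w) = A v0 (cconj w)"
    by (rule N.riesz) (auto simp: NV add_right scale_right v0)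
  then obtain n where n: "n \<in> N" "\<And>w. w \<in> N \<Longrightarrow> A n (cconj w) = A v0 (cconj w)" by blast
  define v where "v = v0 - n"
  have v: "v \<in> V" "B v = q"
    using v0 n(1) by (simp_all add: v_def N_def Vc B_diff)
  have vN: "A v w = 0" if "w \<in> N" for w
  proof -
    have "cconj w \<in> N" using that B_conj by (auto simp: N_def Vc fun_eq_iff)
    then show ?thesis
      using n(2)[of "cconj w"] diff_left[OF v0(1) NV[OF n(1)] Vc(5)[OF NV[OF that]]] by (simp add: v_def)
  qed
  have Avd: "A v \<in> dual_space V" using in_dual v by blast
  have wd: "A v w = A v w'" if "w \<in> V" "w' \<in> V" "B w = B w'" for w w'
  proof -
    have "w - w' \<in> N" using that by (simp add: N_def Vc B_diff)
    moreover have "A v ((w - w') + w') = A v (w - w') + A v w'"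
      using that Avd Vc(3)[OF that(1,2)] unfolding dual_space_iff by blast
    ultimately show ?thesis using vN by simp
  qed
  \<comment> \<open>\<open>inv_into V B\<close> picks some lift of p; by \<open>wd\<close> the
    choice does not matter, and \<phi> inherits its linearity from A v.\<close>
  define \<phi> where "\<phi> p = (if p \<in> W then A v (inv_into V B p) else 0)" for p
  have \<phi>B: "\<phi> (B w) = A v w" if "w \<in> V" for w
  proof -
    have "B (inv_into V B (B w)) = B w" "inv_into V B (B w) \<in> V"
      using that by (simp_all add: f_inv_into_f inv_into_into)
    then have "A v (inv_into V B (B w)) = A v w" using wd that by blast
    then show ?thesis using that B_in by (simp add: \<phi>_def)
  qed
  have "\<phi> \<in> dual_space W"
    unfolding dual_space_iff
  proof (intro conjI ballI allI impI)
    fix p p' assume "p \<in> W" "p' \<in> W"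
    then obtain u u' where "u \<in> V" "u' \<in> V" "p = B u" "p' = B u'" using surj by blast
    then show "\<phi> (p + p') = \<phi> p + \<phi> p'"
      using \<phi>B Avd Vc by (simp add: dual_space_iff flip: B_add)
  next
    fix c p assume "p \<in> W"
    then obtain u where "u \<in> V" "p = B u" using surj by blast
    then show "\<phi> (cscale c p) = c * \<phi> p"
      using \<phi>B Avd Vc by (simp add: dual_space_iff flip: B_scale)
  qed (simp add: \<phi>_def)
  moreover from this have "K \<phi> = q" using K_eqI[OF v(1)] \<phi>B v(2) by simp
  ultimately show ?thesis by blast
qed

lemma K_bij: "bij_betw K (dual_space W) W"
  unfolding bij_betw_def
proof
  show "inj_on K (dual_space W)"
  proof (rule inj_onI)
    fix \<phi> \<phi>' assume \<phi>: "\<phi> \<in> dual_space W" "\<phi>' \<in> dual_space W" and eq: "K \<phi> = K \<phi>'"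
    obtain v where v: "v \<in> V" "K \<phi> = B v" "\<And>w. w \<in> V \<Longrightarrow> A v w = \<phi> (B w)"
      using K_lift[OF \<phi>(1)] by blast
    obtain v' where v': "v' \<in> V" "K \<phi>' = B v'" "\<And>w. w \<in> V \<Longrightarrow> A v' w = \<phi>' (B w)"
      using K_lift[OF \<phi>(2)] by blast
    have "v = v'" using lift_eqI[OF v(1) v'(1) _ v(3) v'(3) \<phi>] v(2) v'(2) eq by simp
    then have "\<phi> (B w) = \<phi>' (B w)" if "w \<in> V" for w using v(3) v'(3) that by simp
    then show "\<phi> = \<phi>'" using surj by (intro dual_space_eqI[OF \<phi>]) blast
  qed
  show "K ` dual_space W = W"
  proof (intro equalityI subsetI)
    fix q assume "q \<in> K ` dual_space W"
    then show "q \<in> W" using K_lift B_in by (metis imageE)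
  next
    fix q assume "q \<in> W"
    then show "q \<in> K ` dual_space W" using K_surj by blast
  qed
qed

lemma S_in: "q \<in> W \<Longrightarrow> S q \<in> dual_space W"
  unfolding S_def using K_bij by (metis bij_betw_def inv_into_into)

lemma K_S: "q \<in> W \<Longrightarrow> K (S q) = q"
  unfolding S_def using K_bij by (metis bij_betw_def f_inv_into_f)

text \<open>The lift v is the discrete harmonic extension of q: A v vanishes on every w with zero
  trace.\<close>

lemma S_lift:
  assumes "q \<in> W"
  obtains v where "v \<in> V" "B v = q" "\<And>w. w \<in> V \<Longrightarrow> A v w = S q (B w)"
  using K_lift[OF S_in[OF assms]] K_S[OF assms] by metis

lemma S_eqI:
  assumes "v \<in> V" "\<phi> \<in> dual_space W" "\<And>w. w \<in> V \<Longrightarrow> A v w = \<phi> (B w)"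
  shows "S (B v) = \<phi>"
  using K_eqI[OF assms] K_bij assms(2) unfolding S_def by (metis bij_betw_def inv_into_f_f)

text \<open>Everything is read off from harmonic lifts u of p and v of q: they add and scale like
  their data, S p (conj q) = A u (conj v), and u \<noteq> 0 when p \<noteq> 0.\<close>

lemma S_hpd_operator: "hpd_operator W S"
proof
  show "conj_space W" by (rule W)
  show "linear_map W (dual_space W) S"
    unfolding linear_map_iff
  proof (intro conjI ballI allI)
    show "S \<in> W \<rightarrow> dual_space W" using S_in by blast
    show "S (p + q) = S p + S q" if pq: "p \<in> W" "q \<in> W" for p q
    proof -
      obtain u where u: "u \<in> V" "B u = p" "\<And>w. w \<in> V \<Longrightarrow> A u w = S p (B w)"
        using S_lift[OF pq(1)] by blast
      obtain v where v: "v \<in> V" "B v = q" "\<And>w. w \<in> V \<Longrightarrow> A v w = S q (B w)"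
        using S_lift[OF pq(2)] by blast
      have "S (B (u + v)) = S p + S q"
        by (rule S_eqI) (use u v pq in \<open>auto simp: Vc op_add intro!: dual_space_closed S_in\<close>)
      then show ?thesis using u v by (simp add: B_add)
    qed
    show "S (cscale c p) = cscale c (S p)" if p: "p \<in> W" for c p
    proof -
      obtain u where u: "u \<in> V" "B u = p" "\<And>w. w \<in> V \<Longrightarrow> A u w = S p (B w)"
        using S_lift[OF p] by blast
      have "S (B (cscale c u)) = cscale c (S p)"
        by (rule S_eqI) (use u p in \<open>auto simp: Vc op_scale intro!: dual_space_closed S_in\<close>)
      then show ?thesis using u by (simp add: B_scale)
    qed
  qed
  have form: "\<exists>u\<in>V. \<exists>v\<in>V. B u = p \<and> B v = q \<and> S p (cconj q) = A u (cconj v) \<and> S q (cconj p) = A v (cconj u)"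
    if pq: "p \<in> W" "q \<in> W" for p q
  proof -
    obtain u where u: "u \<in> V" "B u = p" "\<And>w. w \<in> V \<Longrightarrow> A u w = S p (B w)"
      using S_lift[OF pq(1)] by blast
    obtain v where v: "v \<in> V" "B v = q" "\<And>w. w \<in> V \<Longrightarrow> A v w = S q (B w)"
      using S_lift[OF pq(2)] by blast
    show ?thesis
      using u(1,2) v(1,2) u(3)[OF Vc(5)[OF v(1)]] v(3)[OF Vc(5)[OF u(1)]] B_conj by metis
  qed
  show "hermitian_pos_def W S"
    unfolding hermitian_pos_def_iff
  proof (intro conjI ballI impI)
    show "S p (cconj q) = cnj (S q (cconj p))" if "p \<in> W" "q \<in> W" for p q
      using form[OF that] hermitian by metis
    show "0 < Re (S p (cconj p))" if p: "p \<in> W" "p \<noteq> 0" for p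
    proof -
      obtain u where u: "u \<in> V" "B u = p" "\<And>w. w \<in> V \<Longrightarrow> A u w = S p (B w)"
        using S_lift[OF p(1)] by blast
      have "B 0 = 0" using B_diff[OF Vc(1) Vc(1)] by simp
      then have "u \<noteq> 0" using u(2) p(2) by blast
      then show ?thesis using u(3)[OF Vc(5)[OF u(1)]] positive[OF u(1)] B_conj[OF u(1)] u(2) by simp
    qed
  qed
qed

text \<open>Pythagoras: any other lift differs from the harmonic one v by some d with zero trace,
  and A v (conj d) = S p (B (conj d)) = 0.\<close>

lemma S_minimal:
  assumes p: "p \<in> W"
  shows "\<exists>v\<in>V. B v = p \<and> Re (S p (cconj p)) = Re (A v (cconj v))"
    and "\<And>u. u \<in> V \<Longrightarrow> B u = p \<Longrightarrow> Re (S p (cconj p)) \<le> Re (A u (cconj u))"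
proof -
  obtain v where v: "v \<in> V" "B v = p" "\<And>w. w \<in> V \<Longrightarrow> A v w = S p (B w)"
    using S_lift[OF p] by blast
  have e: "S p (cconj p) = A v (cconj v)" using v(3)[OF Vc(5)[OF v(1)]] B_conj[OF v(1)] v(2) by simp
  then show "\<exists>v\<in>V. B v = p \<and> Re (S p (cconj p)) = Re (A v (cconj v))" using v by auto
  fix u assume u: "u \<in> V" "B u = p"
  let ?d = "u - v"
  have d: "?d \<in> V" using u v Vc by blast
  have "B (cconj ?d) = 0" using u v d by (simp add: B_conj B_diff fun_eq_iff)
  then have o: "A v (cconj ?d) = 0" using v(3)[OF Vc(5)[OF d]] dual_space_0[OF W S_in[OF p]] by simp
  then have o': "A ?d (cconj v) = 0" using hermitian[OF d v(1)] by simp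
  have "A u (cconj u) = A (?d + v) (cconj (?d + v))" by simp
  also have "\<dots> = A ?d (cconj ?d) + A v (cconj v)"
    using d v(1) V_cl(2)[OF d v(1)] o o' by (simp only: add_left add_right) simp
  finally show "Re (S p (cconj p)) \<le> Re (A u (cconj u))" using nonneg[OF d] e by simp
qed

end

text \<open>G is the preconditioner. Its \<open>K\<close> inverts its own Schur complement on the
  dual space, so the operator on the left is again a pencil, now of two Schur complements. The
  minimal lift for one form serves as a competitor in the minimisation for the other.\<close>

lemma cond_number_schur_le:
  assumes "schur V W B A" "schur V W B G" and nontriv: "W \<noteq> {0}"
  shows "cond_number W (schur.K V B G \<circ> schur.S V W B A) \<le> cond_number V (inv_into V G \<circ> A)"
proof -
  interpret A: schur V W B A by fact
  interpret G: schur V W B G by fact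
  interpret SA: hpd_operator W A.S by (rule A.S_hpd_operator)
  interpret SG: hpd_operator W G.S by (rule G.S_hpd_operator)
  have KG: "G.K \<phi> = inv_into W G.S \<phi>" if \<phi>: "\<phi> \<in> dual_space W" for \<phi>
    using G.K_S[of "inv_into W G.S \<phi>"] SG.inv_op[OF \<phi>] by simp
  have eq: "cond_number W (G.K \<circ> A.S) = cond_number W (inv_into W G.S \<circ> A.S)"
    by (rule cond_number_cong) (simp add: KG A.S_in)
  have "V \<noteq> {0}"
  proof
    assume "V = {0}"
    moreover have "B 0 = 0" using A.B_diff[OF A.Vc(1) A.Vc(1)] by simp
    ultimately show False using nontriv A.surj by auto
  qed
  note v = pencil_eigenvalues[OF A.hpd_operator_axioms G.hpd_operator_axioms this]
  note w = pencil_eigenvalues[OF SA.hpd_operator_axioms SG.hpd_operator_axioms nontriv]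
  let ?V = "Re ` eigenvalues V (inv_into V G \<circ> A)"
  let ?W = "Re ` eigenvalues W (inv_into W G.S \<circ> A.S)"
  have Vpos: "Min ?V > 0" "Max ?V > 0" using v(1,2,3) by auto
  have bnd: "Min ?V \<le> x \<and> x \<le> Max ?V" if x: "x \<in> ?W" for x
  proof -
    obtain p where p: "p \<in> W" "p \<noteq> 0" and xp: "Re (A.S p (cconj p)) = x * Re (G.S p (cconj p))"
      using w(6)[OF x] by blast
    have pos: "Re (G.S p (cconj p)) > 0" using SG.positive p by blast
    \<comment> \<open>The A-minimal lift u gives the lower bound, S_G p \<le> G u and Min * G u
      \<le> A u = S_A p; the G-minimal lift s gives the upper one, S_A p \<le> A s \<le> Max * G
      s.\<close>
    obtain u where u: "u \<in> V" "B u = p" "Re (A.S p (cconj p)) = Re (A u (cconj u))"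
      using A.S_minimal(1)[OF p(1)] by blast
    obtain s where s: "s \<in> V" "B s = p" "Re (G.S p (cconj p)) = Re (G s (cconj s))"
      using G.S_minimal(1)[OF p(1)] by blast
    have "Min ?V * Re (G.S p (cconj p)) \<le> Min ?V * Re (G u (cconj u))"
      using G.S_minimal(2)[OF p(1) u(1,2)] Vpos(1) by (intro mult_left_mono) auto
    also have "\<dots> \<le> x * Re (G.S p (cconj p))" using v(4)[OF u(1)] u(3) xp by simp
    finally have 1: "Min ?V \<le> x" using pos by simp
    have "x * Re (G.S p (cconj p)) \<le> Re (A s (cconj s))"
      using A.S_minimal(2)[OF p(1) s(1,2)] xp by simp
    also have "\<dots> \<le> Max ?V * Re (G.S p (cconj p))" using v(5)[OF s(1)] s(3) by simp
    finally have 2: "x \<le> Max ?V" using pos by simp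
    show ?thesis using 1 2 by blast
  qed
  have "Max ?W \<le> Max ?V" "Min ?V \<le> Min ?W" using bnd w(1,2) by auto
  \<comment> \<open>Monotone because the smallest eigenvalue on \<open>V\<close> is
    positive.\<close>
  then have "Max ?W / Min ?W \<le> Max ?V / Min ?V" using Vpos by (intro frac_le) auto
  then show ?thesis unfolding eq by (simp add: cond_number_def)
qed

section \<open>Integration of piecewise smooth functions on the mesh\<close>

text \<open>A class closed under sums, products and conjugation that will contain the coefficients,
  the finite element functions and their derivatives; on sets of finite measure it gives
  integrability and membership in \<open>L2\<close>. The bound is only almost everywhere because
  derivatives are controlled only off the cell boundaries.\<close>

definition ess_bounded :: "(real^3) set \<Rightarrow> (real^3 \<Rightarrow> complex) \<Rightarrow> bool" where
  "ess_bounded G f \<longleftrightarrow> f \<in> borel_measurable (lebesgue_on G) \<and> (\<exists>C. AE x in lebesgue_on G. norm (f x) \<le> C)"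

lemma ess_boundedI:
  "f \<in> borel_measurable (lebesgue_on G) \<Longrightarrow> AE x in lebesgue_on G. norm (f x) \<le> C \<Longrightarrow> ess_bounded G f"
  by (auto simp: ess_bounded_def)

lemma ess_bounded_const: "ess_bounded G (\<lambda>x. c)"
  by (rule ess_boundedI[of _ _ "norm c"]) auto

lemma ess_bounded_add:
  assumes "ess_bounded G f" "ess_bounded G g"
  shows "ess_bounded G (\<lambda>x. f x + g x)"
proof -
  obtain C C' where "AE x in lebesgue_on G. norm (f x) \<le> C" "AE x in lebesgue_on G. norm (g x) \<le> C'"
    using assms by (auto simp: ess_bounded_def)
  then have "AE x in lebesgue_on G. norm (f x + g x) \<le> C + C'"
    by eventually_elim (rule norm_add_rule_thm)
  then show ?thesis using assms by (intro ess_boundedI) (auto simp: ess_bounded_def)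
qed

lemma ess_bounded_mult:
  assumes "ess_bounded G f" "ess_bounded G g"
  shows "ess_bounded G (\<lambda>x. f x * g x)"
proof -
  obtain C C' where "AE x in lebesgue_on G. norm (f x) \<le> C" "AE x in lebesgue_on G. norm (g x) \<le> C'"
    using assms by (auto simp: ess_bounded_def)
  then have "AE x in lebesgue_on G. norm (f x * g x) \<le> \<bar>C\<bar> * \<bar>C'\<bar>"
    by eventually_elim (auto simp: norm_mult intro!: mult_mono)
  then show ?thesis using assms by (intro ess_boundedI) (auto simp: ess_bounded_def)
qed

lemma ess_bounded_sum:
  "finite I \<Longrightarrow> (\<And>i. i \<in> I \<Longrightarrow> ess_bounded G (f i)) \<Longrightarrow> ess_bounded G (\<lambda>x. \<Sum>i\<in>I. f i x)"
  by (induction I rule: finite_induct) (auto intro: ess_bounded_const ess_bounded_add)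

lemma ess_bounded_cnj: "ess_bounded G f \<Longrightarrow> ess_bounded G (\<lambda>x. cnj (f x))"
  using measurable_compose[OF _ borel_measurable_continuous_onI[OF continuous_on_cnj[OF continuous_on_id]], of f]
  by (auto simp: ess_bounded_def)

lemma AE_lebesgue_on_mono:
  assumes "AE x in lebesgue_on S. P x" "G \<subseteq> S" "G \<in> sets lebesgue" "S \<in> sets lebesgue"
  shows "AE x in lebesgue_on G. P x"
  using assms by (auto simp: AE_restrict_space_iff elim!: eventually_mono)

lemma ess_bounded_mono:
  assumes "ess_bounded S f" "G \<subseteq> S" "G \<in> sets lebesgue" "S \<in> sets lebesgue"
  shows "ess_bounded G f"
proof -
  obtain C where "f \<in> borel_measurable (lebesgue_on S)" "AE x in lebesgue_on S. norm (f x) \<le> C"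
    using assms(1) by (auto simp: ess_bounded_def)
  then show ?thesis
    using measurable_restrict_mono[OF _ assms(2)] AE_lebesgue_on_mono[OF _ assms(2-4)]
    by (intro ess_boundedI)
qed

lemma ess_bounded_integrable:
  assumes "ess_bounded G f" "G \<in> lmeasurable"
  shows "integrable (lebesgue_on G) f"
proof -
  obtain C where C: "AE x in lebesgue_on G. norm (f x) \<le> C" and m: "f \<in> borel_measurable (lebesgue_on G)"
    using assms by (auto simp: ess_bounded_def)
  have "finite_measure (lebesgue_on G)" using assms(2)
    by (intro finite_measureI) (auto simp: emeasure_restrict_space fmeasurable_def)
  then show ?thesis using finite_measure.integrable_const_bound C m by blast
qed

lemma ess_bounded_L2:
  assumes "ess_bounded G f" "G \<in> lmeasurable"
  shows "f \<in> L2 G"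
proof -
  have "ess_bounded G (\<lambda>x. f x * cnj (f x))"
    using assms(1) by (intro ess_bounded_mult ess_bounded_cnj)
  then have "integrable (lebesgue_on G) (\<lambda>x. Re (f x * cnj (f x)))"
    using ess_bounded_integrable assms(2) by (intro integrable_Re) blast
  also have "(\<lambda>x. Re (f x * cnj (f x))) = (\<lambda>x. (norm (f x))\<^sup>2)"
    by (simp add: fun_eq_iff cmod_power2) (simp add: power2_eq_square)
  finally show ?thesis using assms(1) by (auto simp: L2_def ess_bounded_def)
qed

text \<open>The slope c depends only on the cell and the direction. It provides the derivative in
  the interior and a Lipschitz constant along lines in the closed cell.\<close>

lemma P1_affine_on_line:
  assumes "u \<in> P1 \<tau>"
  shows "\<exists>c. \<forall>x. x \<in> \<tau> \<longrightarrow> (\<forall>t. x + t *\<^sub>R axis i 1 \<in> \<tau> \<longrightarrow> u (x + t *\<^sub>R axis i 1) = u x + of_real t * c)"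
proof -
  obtain a b where ab: "\<And>x. x \<in> \<tau> \<Longrightarrow> u x = a + (\<Sum>k\<in>UNIV. b $ k * of_real (x $ k))"
    using assms by (auto simp: P1_def)
  have "u (x + t *\<^sub>R axis i 1) = u x + of_real t * b $ i"
    if "x \<in> \<tau>" "x + t *\<^sub>R axis i 1 \<in> \<tau>" for x t
  proof -
    have "(\<Sum>k\<in>UNIV. b $ k * of_real ((x + t *\<^sub>R axis i 1) $ k)) =
        (\<Sum>k\<in>UNIV. b $ k * of_real (x $ k)) + (\<Sum>k\<in>UNIV. if k = i then of_real t * b $ i else 0)"
      unfolding sum.distrib[symmetric]
      by (intro sum.cong) (auto simp: axis_def algebra_simps)
    then show ?thesis using ab that by simp
  qed
  then show ?thesis by blast
qed

lemma P1_continuous_on: "u \<in> P1 \<tau> \<Longrightarrow> continuous_on \<tau> u"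
proof -
  assume "u \<in> P1 \<tau>"
  then obtain a b where ab: "\<And>x. x \<in> \<tau> \<Longrightarrow> u x = a + (\<Sum>k\<in>UNIV. b $ k * of_real (x $ k))"
    by (auto simp: P1_def)
  have "continuous_on \<tau> (\<lambda>x::real^3. a + (\<Sum>k\<in>UNIV. b $ k * of_real (x $ k)))"
    by (intro continuous_intros)
  then show ?thesis by (rule continuous_on_eq) (simp add: ab)
qed

lemma P1_has_vector_derivative:
  assumes u: "u \<in> P1 \<tau>"
  shows "\<exists>c. \<forall>x\<in>interior \<tau>. ((\<lambda>t. u (x + t *\<^sub>R axis i 1)) has_vector_derivative c) (at 0)"
proof -
  obtain c where c: "\<And>x t. x \<in> \<tau> \<Longrightarrow> x + t *\<^sub>R axis i 1 \<in> \<tau> \<Longrightarrow> u (x + t *\<^sub>R axis i 1) = u x + of_real t * c"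
    using P1_affine_on_line[OF u] by blast
  have "((\<lambda>t. u (x + t *\<^sub>R axis i 1)) has_vector_derivative c) (at 0)" if x: "x \<in> interior \<tau>" for x
  proof -
    let ?S = "(\<lambda>t. x + t *\<^sub>R axis i 1) -` interior \<tau>"
    have op: "open ?S" by (intro open_vimage open_interior continuous_intros)
    have "((\<lambda>t. u x + of_real t * c) has_vector_derivative c) (at 0)"
      by (auto intro!: derivative_eq_intros)
    then show ?thesis
    proof (rule has_vector_derivative_transform_within_open[OF _ op])
      show "0 \<in> ?S" using x by simp
      show "u x + of_real t * c = u (x + t *\<^sub>R axis i 1)" if "t \<in> ?S" for t
        using c[of x t] subsetD[OF interior_subset x] subsetD[OF interior_subset, of _ \<tau>] that by simp
    qed
  qed
  then show ?thesis by blast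
qed

lemma partial_deriv_eq:
  "((\<lambda>t. u (x + t *\<^sub>R axis i 1)) has_vector_derivative c) (at 0) \<Longrightarrow> partial_deriv i u x = c"
  by (simp add: partial_deriv_def vector_derivative_at)

text \<open>A derivative sees only a neighbourhood of x; this makes extension by zero and
  restriction to a subdomain harmless for the energy.\<close>

lemma partial_deriv_cong_open:
  assumes "open G" "x \<in> G" "\<And>y. y \<in> G \<Longrightarrow> u y = v y"
  shows "partial_deriv i u x = partial_deriv i v x"
proof -
  have "open ((\<lambda>t. x + t *\<^sub>R axis i 1) -` G)"
    by (intro open_vimage assms continuous_intros)
  then have "eventually (\<lambda>t. t \<in> (\<lambda>t. x + t *\<^sub>R axis i 1) -` G) (nhds 0)"
    by (rule eventually_nhds_in_open) (simp add: assms)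
  then have "eventually (\<lambda>t. t \<in> UNIV \<longrightarrow> u (x + t *\<^sub>R axis i 1) = v (x + t *\<^sub>R axis i 1)) (nhds 0)"
    by eventually_elim (simp add: assms)
  then show ?thesis unfolding partial_deriv_def
    by (intro vector_derivative_cong_eq) auto
qed

lemma energy_form_cong:
  assumes "open G" "\<And>x. x \<in> G \<Longrightarrow> u x = u' x" "\<And>x. x \<in> G \<Longrightarrow> v x = v' x"
  shows "energy_form \<alpha> \<beta> G u v = energy_form \<alpha> \<beta> G u' v'"
  unfolding energy_form_def
  using assms partial_deriv_cong_open[OF assms(1), of _ u u'] partial_deriv_cong_open[OF assms(1), of _ v v']
  by (intro Bochner_Integration.integral_cong) auto

lemma energy_form_commute: "energy_form \<alpha> \<beta> G u v = energy_form \<alpha> \<beta> G v u"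
  by (simp add: energy_form_def mult_ac)

section \<open>Mesh geometry and almost-everywhere arguments over cells\<close>

locale mesh =
  fixes \<Omega> :: "(real^3) set" and \<T> :: "(real^3) set set"
  assumes domain: "polyhedral_domain \<Omega>" and mesh: "tetrahedral_mesh \<Omega> \<T>"
begin

lemma open_domain: "open \<Omega>" and bounded_domain: "bounded \<Omega>" and domain_nonempty: "\<Omega> \<noteq> {}"
  using domain by (auto simp: polyhedral_domain_def)

lemma domain_measurable: "\<Omega> \<in> lmeasurable" "\<Omega> \<in> sets lebesgue"
  using open_domain bounded_domain lmeasurable_open by auto

lemma sub_measurable:
  assumes "open G" "G \<subseteq> \<Omega>"
  shows "G \<in> lmeasurable" "G \<in> sets lebesgue"
  using assms bounded_domain bounded_subset lmeasurable_open by auto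

lemma mesh_finite: "finite \<T>"
  using mesh by (simp add: tetrahedral_mesh_def triangulation_def)

lemma mesh_Union: "\<Union>\<T> = closure \<Omega>"
  using mesh by (simp add: tetrahedral_mesh_def)

lemma mesh_cell:
  assumes "\<tau> \<in> \<T>"
  shows "compact \<tau>" "closed \<tau>" "convex \<tau>" "interior \<tau> \<noteq> {}" "rel_interior \<tau> = interior \<tau>" "\<tau> \<subseteq> closure \<Omega>"
proof -
  have s: "3 simplex \<tau>" using mesh assms by (simp add: tetrahedral_mesh_def)
  show "compact \<tau>" "closed \<tau>" and c: "convex \<tau>"
    using s compact_simplex closed_simplex convex_simplex by auto
  have "aff_dim \<tau> = int DIM(real^3)" using aff_dim_simplex[OF s] by simp
  then have h: "affine hull \<tau> = UNIV" by (simp only: aff_dim_eq_full)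
  then show "rel_interior \<tau> = interior \<tau>" by (rule rel_interior_interior)
  moreover have "\<tau> \<noteq> {}" using h by auto
  ultimately show "interior \<tau> \<noteq> {}" using c rel_interior_eq_empty by metis
  show "\<tau> \<subseteq> closure \<Omega>" using assms mesh_Union by blast
qed

text \<open>Conformity makes the intersection a face of \<tau>, and a face that meets the relative
  interior is all of \<tau>.\<close>

lemma mesh_absorb:
  assumes "\<tau> \<in> \<T>" "\<tau>' \<in> \<T>" "x \<in> interior \<tau>" "x \<in> \<tau>'"
  shows "\<tau> \<subseteq> \<tau>'"
proof -
  have "(\<tau> \<inter> \<tau>') face_of \<tau>" using mesh assms by (auto simp: tetrahedral_mesh_def triangulation_def)
  then have "\<tau> \<inter> \<tau>' = \<tau>"
    using face_of_disjoint_rel_interior[of "\<tau> \<inter> \<tau>'" \<tau>] mesh_cell(5)[OF assms(1)] assms(3,4) interior_subset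
    by blast
  then show ?thesis by blast
qed

definition null :: "(real^3) set" where "null = (\<Union>\<tau>\<in>\<T>. frontier \<tau>)"

lemma null_negligible: "negligible null"
  unfolding null_def using mesh_finite mesh_cell(3)
  by (intro negligible_Union) (auto intro: negligible_convex_frontier)

lemma cell_cases:
  assumes "x \<in> \<Omega>"
  obtains "x \<in> null" | \<tau> where "\<tau> \<in> \<T>" "x \<in> interior \<tau>"
proof -
  have "x \<in> \<Union>\<T>" using assms closure_subset mesh_Union by blast
  then obtain \<tau> where t: "\<tau> \<in> \<T>" "x \<in> \<tau>" by blast
  then have "x \<in> interior \<tau> \<or> x \<in> frontier \<tau>"
    using mesh_cell(2)[OF t(1)] by (auto simp: frontier_def)
  then show ?thesis using that t by (auto simp: null_def)
qed

text \<open>The passage from rules valid inside cells to integrals over an open part of the domain: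
  a point in no cell interior lies in the negligible set \<open>null\<close>.\<close>

lemma AE_cells:
  assumes G: "open G" "G \<subseteq> \<Omega>" and P: "\<And>\<tau> x. \<tau> \<in> \<T> \<Longrightarrow> x \<in> interior \<tau> \<Longrightarrow> x \<in> G \<Longrightarrow> P x"
  shows "AE x in lebesgue_on G. P x"
proof -
  have "AE x in lebesgue. x \<notin> null"
    using null_negligible negligible_iff_null_sets by (intro AE_not_in) blast
  then have "AE x in lebesgue. x \<in> G \<longrightarrow> P x"
  proof eventually_elim
    case (elim x)
    show ?case
    proof
      assume "x \<in> G"
      moreover from this have "x \<in> \<Omega>" using G by blast
      ultimately show "P x" using cell_cases[of x] elim P by metis
    qed
  qed
  then show ?thesis using sub_measurable[OF G] by (simp add: AE_restrict_space_iff)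
qed

lemma piecewise_ess_bounded:
  assumes cont: "\<And>\<tau>. \<tau> \<in> \<T> \<Longrightarrow> continuous_on (interior \<tau>) f"
    and bd: "\<And>\<tau>. \<tau> \<in> \<T> \<Longrightarrow> bounded (f ` interior \<tau>)"
  shows "ess_bounded \<Omega> f"
proof -
  have "bounded (\<Union>\<tau>\<in>\<T>. f ` interior \<tau>)" using mesh_finite bd by auto
  then obtain C where C: "\<And>\<tau> x. \<tau> \<in> \<T> \<Longrightarrow> x \<in> interior \<tau> \<Longrightarrow> norm (f x) \<le> C"
    unfolding bounded_iff by blast
  have null: "null \<in> null_sets lebesgue"
    using null_negligible negligible_iff_null_sets by blast
  have "f \<in> borel_measurable (lebesgue_on \<Omega>)"
  proof (rule measurable_piecewise_restrict[of "insert null (interior ` \<T>)"])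
    show "countable (insert null (interior ` \<T>))" using mesh_finite by (simp add: countable_finite)
    show "X \<inter> space (lebesgue_on \<Omega>) \<in> sets (lebesgue_on \<Omega>)" if "X \<in> insert null (interior ` \<T>)" for X
    proof -
      have "X \<in> sets lebesgue" using that null by auto
      then show ?thesis using domain_measurable by (simp add: sets_restrict_space_iff sets.Int)
    qed
    show "space (lebesgue_on \<Omega>) \<subseteq> \<Union> (insert null (interior ` \<T>))"
    proof
      fix x assume "x \<in> space (lebesgue_on \<Omega>)"
      then have "x \<in> \<Omega>" by simp
      then show "x \<in> \<Union> (insert null (interior ` \<T>))" by (cases rule: cell_cases) auto
    qed
    show "f \<in> borel_measurable (restrict_space (lebesgue_on \<Omega>) X)" if X: "X \<in> insert null (interior ` \<T>)" for X
    proof -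
      have Xs: "X \<in> sets lebesgue" using X null by auto
      have "f \<in> borel_measurable (lebesgue_on (\<Omega> \<inter> X))"
      proof (cases "X = null")
        \<comment> \<open>Lebesgue measure is complete, so every subset of \<open>null\<close> is
          measurable and f may be arbitrary there, as \<open>partial_deriv\<close> is on cell
          boundaries.\<close>
        case True
        have sub: "A \<in> sets lebesgue" if "A \<subseteq> null" for A
          by (rule completion.complete[OF that null])
        have "f -` S \<inter> (\<Omega> \<inter> null) \<in> sets lebesgue" for S by (rule sub) blast
        moreover have "\<Omega> \<inter> null \<in> sets lebesgue" by (rule sub) blast
        ultimately show ?thesis unfolding True
          by (intro borel_measurableI) (auto simp: sets_restrict_space_iff)
      next
        case False
        then obtain \<tau> where "\<tau> \<in> \<T>" "X = interior \<tau>" using X by blast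
        then have "continuous_on (\<Omega> \<inter> X) f" using cont continuous_on_subset by blast
        then show ?thesis
          using Xs domain_measurable by (intro continuous_imp_measurable_on_sets_lebesgue) auto
      qed
      then show ?thesis using Xs domain_measurable by (subst restrict_restrict_space) auto
    qed
  qed
  moreover have "AE x in lebesgue_on \<Omega>. norm (f x) \<le> C"
    using open_domain C by (intro AE_cells) auto
  ultimately show ?thesis by (rule ess_boundedI)
qed

text \<open>A single function has to be affine on each closed cell, so the values on shared faces
  coincide and continuity is built in. Together with extension by zero this becomes
  \<open>Vh\<close>, see \<open>Vh_iff\<close>.\<close>

definition pw_affine :: "(real^3 \<Rightarrow> complex) set" where
  "pw_affine = {u. \<forall>\<tau>\<in>\<T>. u \<in> P1 \<tau>}"

lemma pw_affineD: "u \<in> pw_affine \<Longrightarrow> \<tau> \<in> \<T> \<Longrightarrow> u \<in> P1 \<tau>"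
  by (simp add: pw_affine_def)

lemma pw_affine_add: "u \<in> pw_affine \<Longrightarrow> v \<in> pw_affine \<Longrightarrow> u + v \<in> pw_affine"
proof -
  have "u + v \<in> P1 \<tau>" if uv: "u \<in> P1 \<tau>" "v \<in> P1 \<tau>" for \<tau>
  proof -
    obtain a b a' b' where "\<forall>x\<in>\<tau>. u x = a + (\<Sum>i\<in>UNIV. b $ i * of_real (x $ i))"
      "\<forall>x\<in>\<tau>. v x = a' + (\<Sum>i\<in>UNIV. b' $ i * of_real (x $ i))"
      using uv unfolding P1_def by blast
    then have "\<forall>x\<in>\<tau>. (u + v) x = (a + a') + (\<Sum>i\<in>UNIV. (b + b') $ i * of_real (x $ i))"
      by (simp add: sum.distrib algebra_simps)
    then show ?thesis unfolding P1_def by blast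
  qed
  then show "u \<in> pw_affine \<Longrightarrow> v \<in> pw_affine \<Longrightarrow> u + v \<in> pw_affine"
    by (simp add: pw_affine_def)
qed

lemma pw_affine_scale: "u \<in> pw_affine \<Longrightarrow> cscale c u \<in> pw_affine"
proof -
  have "cscale c u \<in> P1 \<tau>" if uv: "u \<in> P1 \<tau>" for \<tau>
  proof -
    obtain a b where "\<forall>x\<in>\<tau>. u x = a + (\<Sum>i\<in>UNIV. b $ i * of_real (x $ i))"
      using uv unfolding P1_def by blast
    then have "\<forall>x\<in>\<tau>. cscale c u x = c * a + (\<Sum>i\<in>UNIV. (c *s b) $ i * of_real (x $ i))"
      by (simp add: sum_distrib_left algebra_simps)
    then show ?thesis unfolding P1_def by blast
  qed
  then show "u \<in> pw_affine \<Longrightarrow> cscale c u \<in> pw_affine"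
    by (simp add: pw_affine_def)
qed

lemma pw_affine_cconj: "u \<in> pw_affine \<Longrightarrow> cconj u \<in> pw_affine"
proof -
  have "cconj u \<in> P1 \<tau>" if uv: "u \<in> P1 \<tau>" for \<tau>
  proof -
    obtain a b where "\<forall>x\<in>\<tau>. u x = a + (\<Sum>i\<in>UNIV. b $ i * of_real (x $ i))"
      using uv unfolding P1_def by blast
    then have "\<forall>x\<in>\<tau>. cconj u x = cnj a + (\<Sum>i\<in>UNIV. (\<chi> i. cnj (b $ i)) $ i * of_real (x $ i))"
      by simp
    then show ?thesis unfolding P1_def by blast
  qed
  then show "u \<in> pw_affine \<Longrightarrow> cconj u \<in> pw_affine"
    by (simp add: pw_affine_def)
qed

lemma pw_affine_continuous_on: "u \<in> pw_affine \<Longrightarrow> continuous_on (closure \<Omega>) u"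
  using continuous_on_closed_Union[of \<T> "\<lambda>\<tau>. \<tau>" u] mesh_finite mesh_cell(2) mesh_Union
    P1_continuous_on pw_affineD by auto

lemma pw_affine_bounded: "u \<in> pw_affine \<Longrightarrow> bounded (u ` closure \<Omega>)"
  using bounded_domain pw_affine_continuous_on
  by (intro compact_imp_bounded compact_continuous_image) auto

lemma pw_affine_has_deriv:
  assumes u: "u \<in> pw_affine" and t: "\<tau> \<in> \<T>" and x: "x \<in> interior \<tau>"
  shows "((\<lambda>t. u (x + t *\<^sub>R axis i 1)) has_vector_derivative partial_deriv i u x) (at 0)"
proof -
  obtain c where "((\<lambda>t. u (x + t *\<^sub>R axis i 1)) has_vector_derivative c) (at 0)"
    using P1_has_vector_derivative pw_affineD[OF u t] x by blast
  then show ?thesis using partial_deriv_eq by metis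
qed

lemma pw_affine_ess_bounded:
  assumes u: "u \<in> pw_affine"
  shows "ess_bounded \<Omega> u" "ess_bounded \<Omega> (partial_deriv i u)"
proof -
  show "ess_bounded \<Omega> u"
  proof (rule piecewise_ess_bounded)
    fix \<tau> assume t: "\<tau> \<in> \<T>"
    have s: "interior \<tau> \<subseteq> closure \<Omega>" using mesh_cell(6)[OF t] interior_subset by blast
    show "continuous_on (interior \<tau>) u"
      using pw_affine_continuous_on[OF u] s continuous_on_subset by blast
    show "bounded (u ` interior \<tau>)"
      using pw_affine_bounded[OF u] s by (meson bounded_subset image_mono)
  qed
  show "ess_bounded \<Omega> (partial_deriv i u)"
  proof (rule piecewise_ess_bounded)
    fix \<tau> assume t: "\<tau> \<in> \<T>"
    obtain c where c: "\<And>x. x \<in> interior \<tau> \<Longrightarrow> partial_deriv i u x = c"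
      using P1_has_vector_derivative[OF pw_affineD[OF u t]] partial_deriv_eq by metis
    show "continuous_on (interior \<tau>) (partial_deriv i u)"
      using continuous_on_const by (rule continuous_on_eq) (simp add: c)
    have "partial_deriv i u ` interior \<tau> \<subseteq> {c}" using c by auto
    then show "bounded (partial_deriv i u ` interior \<tau>)" by (rule bounded_subset[rotated]) simp
  qed
qed

lemma partial_deriv_add:
  assumes "u \<in> pw_affine" "v \<in> pw_affine" "\<tau> \<in> \<T>" "x \<in> interior \<tau>"
  shows "partial_deriv i (u + v) x = partial_deriv i u x + partial_deriv i v x"
  using assms by (intro partial_deriv_eq)
    (auto intro!: has_vector_derivative_add pw_affine_has_deriv)

lemma partial_deriv_scale:
  assumes "u \<in> pw_affine" "\<tau> \<in> \<T>" "x \<in> interior \<tau>"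
  shows "partial_deriv i (cscale c u) x = c * partial_deriv i u x"
  using assms by (intro partial_deriv_eq)
    (auto intro!: has_vector_derivative_mult_right pw_affine_has_deriv)

lemma partial_deriv_cconj:
  assumes "u \<in> pw_affine" "\<tau> \<in> \<T>" "x \<in> interior \<tau>"
  shows "partial_deriv i (cconj u) x = cnj (partial_deriv i u x)"
  using assms by (intro partial_deriv_eq)
    (auto intro!: has_vector_derivative_cnj pw_affine_has_deriv)

end

section \<open>Weak derivatives of continuous piecewise affine functions\<close>

lemma difference_quotient_tendsto:
  fixes f :: "real \<Rightarrow> 'b::real_normed_vector"
  assumes "(f has_vector_derivative D) (at 0)"
  shows "((\<lambda>h. (1 / h) *\<^sub>R (f h - f 0)) \<longlongrightarrow> D) (at 0)"
proof -
  have "(\<lambda>h. norm (f (0 + h) - f 0 - h *\<^sub>R D) / norm h) \<midarrow>0\<rightarrow> 0"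
    using assms unfolding has_vector_derivative_def has_derivative_at by blast
  moreover have "eventually (\<lambda>h. norm (f (0 + h) - f 0 - h *\<^sub>R D) / norm h = norm ((1 / h) *\<^sub>R (f h - f 0) - D)) (at 0)"
  proof (rule eventually_at_filter[THEN iffD2], rule always_eventually, intro allI impI)
    fix h :: real assume "h \<noteq> 0"
    then have "(1 / h) *\<^sub>R (f h - f 0) - D = (1 / h) *\<^sub>R (f h - f 0 - h *\<^sub>R D)"
      by (simp add: scaleR_right_diff_distrib)
    then show "norm (f (0 + h) - f 0 - h *\<^sub>R D) / norm h = norm ((1 / h) *\<^sub>R (f h - f 0) - D)"
      by (simp add: divide_inverse mult.commute)
  qed
  ultimately have "((\<lambda>h. norm ((1 / h) *\<^sub>R (f h - f 0) - D)) \<longlongrightarrow> 0) (at 0)"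
    by (rule Lim_transform_eventually)
  then show ?thesis by (simp only: tendsto_norm_zero_iff LIM_zero_iff)
qed

lemma integral_shift_diff_eq_0:
  fixes w :: "real^3 \<Rightarrow> complex"
  assumes "integrable lborel w"
  shows "(\<integral>x. w (x + a) - w x \<partial>lborel) = 0"
proof -
  have m: "w \<in> borel_measurable borel" using assms by auto
  have d: "distr lborel borel (\<lambda>x. x + a) = (lborel :: (real^3) measure)"
  proof -
    have "(\<lambda>x. x + a) = (+) a" by (simp add: fun_eq_iff add.commute)
    then show ?thesis using lborel_distr_plus[of a] by simp
  qed
  have "integrable (distr lborel borel (\<lambda>x. x + a)) w" using assms unfolding d .
  then have i: "integrable lborel (\<lambda>x. w (x + a))"
    using m by (subst (asm) integrable_distr_eq) auto
  have "(\<integral>x. w x \<partial>distr lborel borel (\<lambda>x. x + a)) = (\<integral>x. w (x + a) \<partial>lborel)"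
    using m by (intro integral_distr) auto
  then have "(\<integral>x. w (x + a) \<partial>lborel) = (\<integral>x. w x \<partial>lborel)" unfolding d by simp
  then show ?thesis using i assms by simp
qed

text \<open>The Lipschitz bound is the mean value inequality with a bound for the compactly
  supported derivative. Taking \<open>max M1 M2\<close> lets one constant serve all three
  estimates.\<close>

lemma test_function_facts:
  assumes "\<phi> \<in> test_functions \<Omega>"
  obtains K M where "compact K" "K \<subseteq> \<Omega>" "\<And>x. x \<notin> K \<Longrightarrow> \<phi> x = 0"
    "\<And>x. ((\<lambda>t. \<phi> (x + t *\<^sub>R axis i 1)) has_real_derivative partial_deriv i \<phi> x) (at 0)"
    "continuous_on UNIV \<phi>" "continuous_on UNIV (partial_deriv i \<phi>)"
    "\<And>x. \<bar>\<phi> x\<bar> \<le> M" "\<And>x. \<bar>partial_deriv i \<phi> x\<bar> \<le> M"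
    "\<And>x s r. \<bar>\<phi> (x + s *\<^sub>R axis i 1) - \<phi> (x + r *\<^sub>R axis i 1)\<bar> \<le> M * \<bar>s - r\<bar>"
proof -
  obtain K where K: "compact K" "K \<subseteq> \<Omega>" "\<And>x. x \<notin> K \<Longrightarrow> \<phi> x = 0" and "smooth \<phi>"
    using assms by (auto simp: test_functions_def)
  then obtain P where P0: "P [] = \<phi>"
    and P: "\<And>is x. (P is has_derivative (\<lambda>h. \<Sum>i\<in>UNIV. h $ i * P (i # is) x)) (at x)"
    unfolding smooth_def by blast
  have line: "((\<lambda>t. \<phi> (x + t *\<^sub>R axis i 1)) has_real_derivative P [i] (x + t *\<^sub>R axis i 1)) (at t)" for x t
  proof -
    have "((\<lambda>t. x + t *\<^sub>R axis i (1::real)) has_derivative (\<lambda>t. t *\<^sub>R axis i 1)) (at t)"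
      by (auto intro!: derivative_eq_intros)
    from has_derivative_compose[OF this P[of "[]"]]
    have "((\<lambda>t. \<phi> (x + t *\<^sub>R axis i 1)) has_derivative
        (\<lambda>h. \<Sum>k\<in>UNIV. (h *\<^sub>R axis i 1) $ k * P [k] (x + t *\<^sub>R axis i 1))) (at t)"
      by (simp add: P0)
    moreover have "(\<Sum>k\<in>UNIV. (h *\<^sub>R axis i 1) $ k * P [k] y) = P [i] y * h" for h y
    proof -
      have "(\<Sum>k\<in>UNIV. (h *\<^sub>R axis i 1) $ k * P [k] y) = (\<Sum>k\<in>UNIV. if k = i then P [i] y * h else 0)"
        by (intro sum.cong) (auto simp: axis_def)
      then show ?thesis by simp
    qed
    ultimately show ?thesis by (simp add: has_field_derivative_def)
  qed
  have pd: "partial_deriv i \<phi> x = P [i] x" for x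
    using line[of x 0] unfolding partial_deriv_def
    by (intro vector_derivative_at) (simp add: has_real_derivative_iff_has_vector_derivative)
  have cont: "continuous_on UNIV (P is)" for "is"
    by (intro continuous_at_imp_continuous_on ballI has_derivative_continuous[OF P])
  \<comment> \<open>The complement of the compact support is open, so the derivative vanishes there
    as well; being continuous, it is bounded.\<close>
  have PK: "P [i] x = 0" if "x \<notin> K" for x
  proof -
    have "partial_deriv i \<phi> x = partial_deriv i (\<lambda>x. 0) x"
    proof (rule partial_deriv_cong_open)
      show "open (- K)" using K(1) by (simp add: compact_imp_closed open_Compl)
    qed (use that K(3) in auto)
    moreover have "partial_deriv i (\<lambda>x. 0 :: real) x = 0" by (simp add: partial_deriv_def)
    ultimately show ?thesis using pd by simp
  qed
  have bd: "\<exists>M. \<forall>x. \<bar>f x\<bar> \<le> M" if "continuous_on UNIV f" "\<And>x. x \<notin> K \<Longrightarrow> f x = 0" for f :: "real^3 \<Rightarrow> real"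
  proof -
    have "bounded (f ` K)"
      by (rule compact_imp_bounded[OF compact_continuous_image[OF continuous_on_subset[OF that(1) subset_UNIV] K(1)]])
    then obtain M where M: "\<And>x. x \<in> K \<Longrightarrow> \<bar>f x\<bar> \<le> M" unfolding bounded_iff by auto
    have "\<bar>f x\<bar> \<le> max M 0" for x using M[of x] that(2)[of x] by (cases "x \<in> K") (simp_all add: le_max_iff_disj)
    then show ?thesis by blast
  qed
  obtain M1 where M1: "\<And>x. \<bar>\<phi> x\<bar> \<le> M1" using bd[OF cont[of "[]", unfolded P0] K(3)] by blast
  obtain M2 where M2: "\<And>x. \<bar>P [i] x\<bar> \<le> M2" using bd[OF cont PK] by blast
  have lip: "\<bar>\<phi> (x + s *\<^sub>R axis i 1) - \<phi> (x + r *\<^sub>R axis i 1)\<bar> \<le> M2 * \<bar>s - r\<bar>" for x s r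
    using field_differentiable_bound[of UNIV "\<lambda>t. \<phi> (x + t *\<^sub>R axis i 1)" "\<lambda>t. P [i] (x + t *\<^sub>R axis i 1)" M2 s r]
      line M2 by auto
  have "M2 * \<bar>s - r\<bar> \<le> max M1 M2 * \<bar>s - r\<bar>" for s r :: real by (intro mult_right_mono) auto
  then have lip': "\<bar>\<phi> (x + s *\<^sub>R axis i 1) - \<phi> (x + r *\<^sub>R axis i 1)\<bar> \<le> max M1 M2 * \<bar>s - r\<bar>" for x s r
    using lip order_trans by blast
  show ?thesis
  proof (rule that[OF K, of "max M1 M2"])
    show "((\<lambda>t. \<phi> (x + t *\<^sub>R axis i 1)) has_real_derivative partial_deriv i \<phi> x) (at 0)" for x
      using line[of x 0] by (simp add: pd)
    show "continuous_on UNIV \<phi>" using cont[of "[]"] unfolding P0 .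
    have "partial_deriv i \<phi> = P [i]" by (rule ext) (rule pd)
    then show "continuous_on UNIV (partial_deriv i \<phi>)" using cont by simp
    show "\<bar>\<phi> x\<bar> \<le> max M1 M2" "\<bar>partial_deriv i \<phi> x\<bar> \<le> max M1 M2" for x
      using M1[of x] M2[of x] by (simp_all add: pd le_max_iff_disj)
  qed (fact lip' | assumption)+
qed

context mesh
begin

text \<open>The closed cells cut the parameter interval into finitely many closed sets that cover
  it, and a Lipschitz bound on each of them carries over to the interval with the same constant.
  That constant is the product rule: slope of u times sup of \<phi>, plus sup of u times Lipschitz
  constant of \<phi>.\<close>

lemma line_in_cells_lipschitz:
  assumes u: "u \<in> pw_affine"
    and seg: "\<And>s. s \<in> {0..t} \<Longrightarrow> x + s *\<^sub>R axis i 1 \<in> \<Omega>"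
    and c: "\<And>\<tau> x t. \<tau> \<in> \<T> \<Longrightarrow> x \<in> \<tau> \<Longrightarrow> x + t *\<^sub>R axis i 1 \<in> \<tau> \<Longrightarrow>
        norm (u (x + t *\<^sub>R axis i 1) - u x) \<le> C * \<bar>t\<bar>"
    and Mu: "\<And>x. x \<in> closure \<Omega> \<Longrightarrow> norm (u x) \<le> Mu" "Mu \<ge> 0" "C \<ge> 0"
    and M: "\<And>x. \<bar>\<phi> x\<bar> \<le> M" "\<And>x s r. \<bar>\<phi> (x + s *\<^sub>R axis i 1) - \<phi> (x + r *\<^sub>R axis i 1)\<bar> \<le> M * \<bar>s - r\<bar>"
  shows "lipschitz_on (C * M + Mu * M) {0..t} (\<lambda>s. u (x + s *\<^sub>R axis i 1) * of_real (\<phi> (x + s *\<^sub>R axis i 1)))"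
proof (rule lipschitz_on_closed_Union[of \<T> _ "\<lambda>\<tau>. (\<lambda>s. x + s *\<^sub>R axis i 1) -` \<tau>"])
  have M0: "M \<ge> 0" using M(1)[of x] by linarith
  then show nn: "C * M + Mu * M \<ge> 0" using Mu by simp
  show "finite \<T>" by (rule mesh_finite)
  show "closed ((\<lambda>s. x + s *\<^sub>R axis i 1) -` \<tau>)" if "\<tau> \<in> \<T>" for \<tau>
    using mesh_cell(2)[OF that] by (intro closed_vimage continuous_intros)
  show "{0..t} \<subseteq> (\<Union>\<tau>\<in>\<T>. (\<lambda>s. x + s *\<^sub>R axis i 1) -` \<tau>)"
  proof
    fix s assume "s \<in> {0..t}"
    then have "x + s *\<^sub>R axis i 1 \<in> \<Union>\<T>" using seg closure_subset mesh_Union by blast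
    then show "s \<in> (\<Union>\<tau>\<in>\<T>. (\<lambda>s. x + s *\<^sub>R axis i 1) -` \<tau>)" by auto
  qed
  show "lipschitz_on (C * M + Mu * M) ((\<lambda>s. x + s *\<^sub>R axis i 1) -` \<tau>)
      (\<lambda>s. u (x + s *\<^sub>R axis i 1) * of_real (\<phi> (x + s *\<^sub>R axis i 1)))" if t: "\<tau> \<in> \<T>" for \<tau>
  proof (rule lipschitz_onI[OF _ nn])
    fix s r assume "s \<in> (\<lambda>s. x + s *\<^sub>R axis i 1) -` \<tau>" "r \<in> (\<lambda>s. x + s *\<^sub>R axis i 1) -` \<tau>"
    then have mem: "x + s *\<^sub>R axis i 1 \<in> \<tau>" "x + r *\<^sub>R axis i 1 \<in> \<tau>" by auto
    let ?y = "\<lambda>s. x + s *\<^sub>R axis i 1"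
    have "?y s = ?y r + (s - r) *\<^sub>R axis i 1" by (simp add: algebra_simps)
    then have 1: "norm (u (?y s) - u (?y r)) \<le> C * \<bar>s - r\<bar>"
      using c[OF t, of "?y r" "s - r"] mem by metis
    have 2: "norm (u (?y r)) \<le> Mu" using Mu(1) mem mesh_cell(6)[OF t] by blast
    have "u (?y s) * of_real (\<phi> (?y s)) - u (?y r) * of_real (\<phi> (?y r)) =
        (u (?y s) - u (?y r)) * of_real (\<phi> (?y s)) + u (?y r) * of_real (\<phi> (?y s) - \<phi> (?y r))"
      by (simp add: algebra_simps)
    also have "norm \<dots> \<le> norm (u (?y s) - u (?y r)) * \<bar>\<phi> (?y s)\<bar> + norm (u (?y r)) * \<bar>\<phi> (?y s) - \<phi> (?y r)\<bar>"
      by (rule norm_triangle_le) (simp add: norm_mult flip: of_real_diff)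
    also have "\<dots> \<le> (C * \<bar>s - r\<bar>) * M + Mu * (M * \<bar>s - r\<bar>)"
      using Mu(2,3) by (intro add_mono mult_mono 1 2 M) auto
    also have "\<dots> = (C * M + Mu * M) * \<bar>s - r\<bar>" by (simp add: algebra_simps)
    finally show "dist (u (?y s) * of_real (\<phi> (?y s))) (u (?y r) * of_real (\<phi> (?y r)))
        \<le> (C * M + Mu * M) * dist s r"
      by (simp add: dist_norm)
  qed
qed

text \<open>
  Integration by parts: with \<open>w = u \<phi>\<close>, the difference quotients of \<open>w\<close> have integral zero by
  translation invariance and are bounded because \<open>u\<close> is Lipschitz along segments inside the domain,
  so dominated convergence applies.
\<close>

lemma pw_affine_integration_by_parts:
  assumes u: "u \<in> pw_affine" and \<phi>: "\<phi> \<in> test_functions \<Omega>"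
  shows "(\<integral>x. u x * of_real (partial_deriv i \<phi> x) \<partial>lebesgue_on \<Omega>) =
    - (\<integral>x. partial_deriv i u x * of_real (\<phi> x) \<partial>lebesgue_on \<Omega>)"
proof -
  obtain K M where K: "compact K" "K \<subseteq> \<Omega>" "\<And>x. x \<notin> K \<Longrightarrow> \<phi> x = 0"
    and d: "\<And>x. ((\<lambda>t. \<phi> (x + t *\<^sub>R axis i 1)) has_real_derivative partial_deriv i \<phi> x) (at 0)"
    and c\<phi>: "continuous_on UNIV \<phi>" "continuous_on UNIV (partial_deriv i \<phi>)"
    and M: "\<And>x. \<bar>\<phi> x\<bar> \<le> M" "\<And>x. \<bar>partial_deriv i \<phi> x\<bar> \<le> M"
      "\<And>x s r. \<bar>\<phi> (x + s *\<^sub>R axis i 1) - \<phi> (x + r *\<^sub>R axis i 1)\<bar> \<le> M * \<bar>s - r\<bar>"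
    using test_function_facts[OF \<phi>, of i] by metis
  \<comment> \<open>Segments of length at most \<delta> with an end in \<open>K\<close> stay in the
    domain; the cellwise Lipschitz bound is available on such segments.\<close>
  obtain \<delta> where \<delta>: "\<delta> > 0" "(\<Union>x\<in>K. cball x \<delta>) \<subseteq> \<Omega>"
    using compact_subset_open_imp_cball_epsilon_subset[OF K(1) open_domain K(2)] by blast
  let ?e = "axis i (1::real)"
  define w where "w x = u x * of_real (\<phi> x)" for x
  have w0: "w x = 0" if "x \<notin> K" for x using K(3)[OF that] by (simp add: w_def)
  \<comment> \<open>u may jump at the boundary of the domain, but w vanishes off \<open>K\<close>;
    the domain and the complement of \<open>K\<close> are open and cover the space.\<close>
  have "continuous_on (\<Omega> \<union> - K) w"
  proof (rule continuous_on_open_Un)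
    show "continuous_on \<Omega> w" unfolding w_def
      by (intro continuous_intros continuous_on_subset[OF pw_affine_continuous_on[OF u] closure_subset]
          continuous_on_subset[OF c\<phi>(1) subset_UNIV])
    show "continuous_on (- K) w"
      using continuous_on_const by (rule continuous_on_eq) (simp add: w0)
  qed (use open_domain K(1) in \<open>auto intro: compact_imp_closed\<close>)
  moreover have "\<Omega> \<union> - K = UNIV" using K(2) by blast
  ultimately have cw: "continuous_on UNIV w" by simp
  have "integrable lborel (\<lambda>x. indicator K x *\<^sub>R w x)"
    by (rule borel_integrable_compact[OF K(1) continuous_on_subset[OF cw subset_UNIV]])
  moreover have "(\<lambda>x. indicator K x *\<^sub>R w x) = w" by (auto simp: fun_eq_iff indicator_def w0)
  ultimately have iw: "integrable lborel w" by simp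
  obtain Mu where Mu: "\<And>x. x \<in> closure \<Omega> \<Longrightarrow> norm (u x) \<le> Mu" "Mu \<ge> 0"
  proof -
    obtain b where "\<And>x. x \<in> closure \<Omega> \<Longrightarrow> norm (u x) \<le> b"
      using pw_affine_bounded[OF u] unfolding bounded_iff by blast
    then show ?thesis using that[of "max b 0"] by (simp add: le_max_iff_disj)
  qed
  obtain C where C: "\<And>\<tau> x t. \<tau> \<in> \<T> \<Longrightarrow> x \<in> \<tau> \<Longrightarrow> x + t *\<^sub>R ?e \<in> \<tau> \<Longrightarrow> norm (u (x + t *\<^sub>R ?e) - u x) \<le> C * \<bar>t\<bar>"
      "C \<ge> 0"
  proof -
    have "\<forall>\<tau>\<in>\<T>. \<exists>c. \<forall>x. x \<in> \<tau> \<longrightarrow> (\<forall>t. x + t *\<^sub>R ?e \<in> \<tau> \<longrightarrow> u (x + t *\<^sub>R ?e) = u x + of_real t * c)"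
      using P1_affine_on_line pw_affineD[OF u] by blast
    then obtain c where c: "\<And>\<tau> x t. \<tau> \<in> \<T> \<Longrightarrow> x \<in> \<tau> \<Longrightarrow> x + t *\<^sub>R ?e \<in> \<tau> \<Longrightarrow> u (x + t *\<^sub>R ?e) = u x + of_real t * c \<tau>"
      by metis
    \<comment> \<open>Any common bound for the finitely many slopes will do; the sum is nonnegative
      and dominates each of them.\<close>
    define C where "C = (\<Sum>\<tau>\<in>\<T>. norm (c \<tau>))"
    have le: "norm (c \<tau>) \<le> C" if "\<tau> \<in> \<T>" for \<tau>
      unfolding C_def using mesh_finite that by (intro member_le_sum) auto
    show ?thesis
    proof (rule that[of C])
      fix \<tau> x t assume a: "\<tau> \<in> \<T>" "x \<in> \<tau>" "x + t *\<^sub>R ?e \<in> \<tau>"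
      show "norm (u (x + t *\<^sub>R ?e) - u x) \<le> C * \<bar>t\<bar>"
        using mult_left_mono[OF le[OF a(1)], of "\<bar>t\<bar>"] c[OF a] by (simp add: norm_mult mult.commute)
    qed (simp add: C_def sum_nonneg)
  qed
  define L where "L = C * M + Mu * M"
  have M0: "M \<ge> 0" using M(1)[of 0] by linarith
  have L0: "L \<ge> 0" using C(2) Mu(2) M0 by (simp add: L_def)
  have near: "x + s *\<^sub>R ?e \<in> \<Omega>" if xt: "x \<in> K \<or> x + t *\<^sub>R ?e \<in> K" "0 \<le> s" "s \<le> t" "t \<le> \<delta>" for x s t
  proof -
    have "dist x (x + s *\<^sub>R ?e) \<le> \<delta>" "dist (x + t *\<^sub>R ?e) (x + s *\<^sub>R ?e) \<le> \<delta>"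
    proof -
      show "dist x (x + s *\<^sub>R ?e) \<le> \<delta>" using that by (simp add: dist_norm norm_axis_1)
      have "(x + t *\<^sub>R ?e) - (x + s *\<^sub>R ?e) = (t - s) *\<^sub>R ?e" by (simp add: algebra_simps)
      then show "dist (x + t *\<^sub>R ?e) (x + s *\<^sub>R ?e) \<le> \<delta>" using that by (simp add: dist_norm norm_axis_1)
    qed
    moreover have "y \<in> \<Omega>" if "z \<in> K" "dist z y \<le> \<delta>" for z y
      using \<delta>(2) that by (meson UN_I mem_cball subsetD)
    ultimately show ?thesis using xt(1) by blast
  qed
  have wlip: "norm (w (x + t *\<^sub>R ?e) - w x) \<le> L * t" if t: "0 \<le> t" "t \<le> \<delta>" for x t
  proof (cases "x \<in> K \<or> x + t *\<^sub>R ?e \<in> K")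
    case True
    have "lipschitz_on L {0..t} (\<lambda>s. w (x + s *\<^sub>R ?e))"
      unfolding L_def w_def
      by (rule line_in_cells_lipschitz[OF u _ C(1) Mu(1) Mu(2) C(2) M(1) M(3)])
        (use near[OF True] t in auto)
    then show ?thesis using lipschitz_on_normD[of L "{0..t}" _ t 0] t by force
  next
    case False
    then show ?thesis using w0 L0 t by simp
  qed
  \<comment> \<open>A positive null sequence that starts at \<delta>, so that \<open>near\<close>
    and \<open>wlip\<close> apply to every member.\<close>
  define h where "h n = \<delta> / real (Suc n)" for n
  have h: "h n > 0" "h n \<le> \<delta>" for n using \<delta>(1) by (auto simp: h_def field_simps)
  have h_lim: "filterlim h (at 0) sequentially"
    unfolding filterlim_at
  proof
    show "h \<longlonglongrightarrow> 0" unfolding h_def by (rule LIMSEQ_Suc, rule lim_const_over_n)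
    show "\<forall>\<^sub>F n in sequentially. h n \<in> UNIV \<and> h n \<noteq> 0" using h(1) by (simp add: less_imp_neq[symmetric])
  qed
  define q where "q n x = (1 / h n) *\<^sub>R (w (x + h n *\<^sub>R ?e) - w x)" for n x
  define g where "g x = partial_deriv i u x * of_real (\<phi> x) + u x * of_real (partial_deriv i \<phi> x)" for x
  have cq: "continuous_on UNIV (q n)" for n
    unfolding q_def
    by (intro continuous_intros cw continuous_on_compose2[OF cw]) auto
  have q_int: "(\<integral>x. q n x \<partial>lebesgue_on \<Omega>) = 0" for n
  proof -
    have mq: "q n \<in> borel_measurable borel"
      by (rule borel_measurable_continuous_onI[OF cq])
    \<comment> \<open>By \<open>near\<close> with parameter 0, a point whose shift lies in
      \<open>K\<close> is in the domain. So q n vanishes outside, and its integral over the domain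
      is the one over the whole space, where translation invariance applies.\<close>
    have out: "q n x = 0" if "x \<notin> \<Omega>" for x
    proof -
      have "x \<notin> K" using that K(2) by blast
      moreover have "x + h n *\<^sub>R ?e \<notin> K"
        using near[of x "h n" 0] h[of n] that by auto
      ultimately show ?thesis by (simp add: q_def w0)
    qed
    have "(\<integral>x. q n x \<partial>lebesgue_on \<Omega>) = (\<integral>x. indicator \<Omega> x *\<^sub>R q n x \<partial>lebesgue)"
      using domain_measurable by (intro integral_restrict_space) auto
    also have "(\<lambda>x. indicator \<Omega> x *\<^sub>R q n x) = q n"
      by (auto simp: fun_eq_iff indicator_def out)
    also have "(\<integral>x. q n x \<partial>lebesgue) = (\<integral>x. q n x \<partial>lborel)"
      using mq by (intro integral_completion) auto
    also have "\<dots> = 0"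
      unfolding q_def using integral_shift_diff_eq_0[OF iw, of "h n *\<^sub>R ?e"] by simp
    finally show ?thesis .
  qed
  have e\<phi>: "ess_bounded \<Omega> (\<lambda>x. of_real (\<phi> x))" "ess_bounded \<Omega> (\<lambda>x. of_real (partial_deriv i \<phi> x))"
    by (rule ess_boundedI[of _ _ M]; (rule AE_I2)?; (simp add: M)?;
        intro continuous_imp_measurable_on_sets_lebesgue continuous_on_of_real domain_measurable(2)
          continuous_on_subset[OF c\<phi>(1) subset_UNIV] continuous_on_subset[OF c\<phi>(2) subset_UNIV])+
  have eg: "ess_bounded \<Omega> (\<lambda>x. partial_deriv i u x * of_real (\<phi> x))"
    "ess_bounded \<Omega> (\<lambda>x. u x * of_real (partial_deriv i \<phi> x))"
    by (intro ess_bounded_mult pw_affine_ess_bounded u e\<phi>)+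
  note ig = eg[THEN ess_bounded_integrable, OF domain_measurable(1)]
  have "(\<lambda>n. \<integral>x. q n x \<partial>lebesgue_on \<Omega>) \<longlonglongrightarrow> (\<integral>x. g x \<partial>lebesgue_on \<Omega>)"
  proof (rule integral_dominated_convergence[where w = "\<lambda>x. L"])
    show "g \<in> borel_measurable (lebesgue_on \<Omega>)"
      unfolding g_def using eg by (auto simp: ess_bounded_def)
    show "q n \<in> borel_measurable (lebesgue_on \<Omega>)" for n
      by (rule continuous_imp_measurable_on_sets_lebesgue[OF continuous_on_subset[OF cq subset_UNIV] domain_measurable(2)])
    show "integrable (lebesgue_on \<Omega>) (\<lambda>x. L)"
      using domain_measurable(1)
      by (intro finite_measure.integrable_const finite_measureI)
        (auto simp: emeasure_restrict_space fmeasurable_def)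
    show "AE x in lebesgue_on \<Omega>. norm (q n x) \<le> L" for n
    proof (rule AE_I2)
      fix x
      have "norm (q n x) = norm (w (x + h n *\<^sub>R ?e) - w x) / h n"
        using h(1)[of n] unfolding q_def norm_scaleR by simp
      then show "norm (q n x) \<le> L"
        using wlip[of "h n" x] h[of n] by (simp add: pos_divide_le_eq)
    qed
    show "AE x in lebesgue_on \<Omega>. (\<lambda>n. q n x) \<longlonglongrightarrow> g x"
    proof (rule AE_cells[OF open_domain order_refl])
      fix \<tau> x assume t: "\<tau> \<in> \<T>" "x \<in> interior \<tau>"
      have "((\<lambda>t. complex_of_real (\<phi> (x + t *\<^sub>R ?e))) has_vector_derivative of_real (partial_deriv i \<phi> x)) (at 0)"
        using d[of x] by (intro has_vector_derivative_of_real)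
          (simp add: has_real_derivative_iff_has_vector_derivative)
      from has_vector_derivative_mult[OF pw_affine_has_deriv[OF u t] this]
      have "((\<lambda>t. w (x + t *\<^sub>R ?e)) has_vector_derivative g x) (at 0)"
        by (simp add: w_def g_def add.commute)
      from filterlim_compose[OF difference_quotient_tendsto[OF this] h_lim]
      show "(\<lambda>n. q n x) \<longlonglongrightarrow> g x" by (simp add: q_def)
    qed
  qed
  then have "(\<integral>x. g x \<partial>lebesgue_on \<Omega>) = 0"
    unfolding q_int by (rule LIMSEQ_unique[OF _ tendsto_const])
  then show ?thesis
    unfolding g_def using Bochner_Integration.integral_add[OF ig]
    by (simp add: add_eq_0_iff)
qed

lemma pw_affine_H1:
  assumes u: "u \<in> pw_affine"
  shows "u \<in> H1 \<Omega>"
  unfolding H1_def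
  using pw_affine_integration_by_parts[OF u] ess_bounded_L2[OF _ domain_measurable(1)]
    pw_affine_ess_bounded[OF u] by blast

text \<open>The classical derivatives serve as weak ones by the integration by parts above.
  Membership can thus be checked cell by cell, as gluing requires.\<close>

lemma Vh_iff: "u \<in> Vh \<Omega> \<T> \<longleftrightarrow> u \<in> pw_affine \<and> (\<forall>x. x \<notin> closure \<Omega> \<longrightarrow> u x = 0)"
  using pw_affine_H1 by (auto simp: Vh_def pw_affine_def)

end

section \<open>The finite element spaces are finite-dimensional\<close>

lemma sum_fun_apply: "(\<Sum>i\<in>I. f i) x = (\<Sum>i\<in>I. f i x)"
  by (induction I rule: infinite_finite_induct) auto

lemma span_image_linear:
  assumes u: "u \<in> cfun.span S"
    and add: "\<And>u v. B (u + v) = B u + B v" and scl: "\<And>c u. B (cscale c u) = cscale c (B u)"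
  shows "B u \<in> cfun.span (B ` S)"
  using u
proof (induction rule: cfun.span_induct_alt)
  case base
  have "B 0 = cscale 0 (B 0)" using scl[of 0 0] by (simp add: fun_eq_iff)
  then have "B 0 = 0" by (simp only: cfun.scale_zero_left)
  then show ?case using cfun.span_zero by metis
next
  case (step c x y)
  have "cscale c (B x) + B y \<in> cfun.span (B ` S)"
    by (intro cfun.span_add cfun.span_scale cfun.span_base imageI step)
  then show ?case by (simp only: add scl)
qed

lemma conj_space_product:
  assumes W: "\<And>j. j \<in> {1..J} \<Longrightarrow> conj_space (W j)"
  shows "conj_space (product_space J W)"
proof -
  note Wc = conj_spaceD[OF W]
  have memI: "u \<in> product_space J W"
    if "\<And>j. j \<in> {1..J} \<Longrightarrow> (\<lambda>x. u (j, x)) \<in> W j" "\<And>j x. j \<notin> {1..J} \<Longrightarrow> u (j, x) = 0" for u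
    using that by (simp add: product_space_def)
  have memD: "(\<lambda>x. u (j, x)) \<in> W j" if "u \<in> product_space J W" "j \<in> {1..J}" for u j
    using that by (simp add: product_space_def)
  have mem0: "u (j, x) = 0" if "u \<in> product_space J W" "j \<notin> {1..J}" for u j x
    using that by (simp add: product_space_def)
  have sub: "cfun.subspace (product_space J W)"
  proof (rule cfun.subspaceI)
    show "0 \<in> product_space J W"
      by (rule memI) (use Wc(1) in \<open>simp_all add: zero_fun_def\<close>)
    show "u + v \<in> product_space J W" if uv: "u \<in> product_space J W" "v \<in> product_space J W" for u v
    proof (rule memI)
      fix j assume j: "j \<in> {1..J}"
      show "(\<lambda>x. (u + v) (j, x)) \<in> W j"
        using Wc(2)[OF j memD[OF uv(1) j] memD[OF uv(2) j]] by (simp add: plus_fun_def)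
    qed (use mem0[OF uv(1)] mem0[OF uv(2)] in simp)
    show "cscale c u \<in> product_space J W" if u: "u \<in> product_space J W" for c u
    proof (rule memI)
      fix j assume j: "j \<in> {1..J}"
      show "(\<lambda>x. cscale c u (j, x)) \<in> W j"
        using Wc(4)[OF j memD[OF u j], of c] by (simp add: cscale_def)
    qed (use u mem0 in simp)
  qed
  have cnj: "cconj u \<in> product_space J W" if u: "u \<in> product_space J W" for u
  proof (rule memI)
    fix j assume j: "j \<in> {1..J}"
    show "(\<lambda>x. cconj u (j, x)) \<in> W j"
      using Wc(5)[OF j memD[OF u j]] by (simp add: cconj_def)
  qed (use u mem0 in simp)
  \<comment> \<open>Zero extension of a function in the j-th factor; images of spanning sets of the
    factors span the product.\<close>
  define inj where "inj j f = (\<lambda>(k, x). if k = j then f x else 0)" for j :: nat and f :: "'a \<Rightarrow> complex"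
  have "\<forall>j\<in>{1..J}. \<exists>S. finite S \<and> W j \<subseteq> cfun.span S"
    using W unfolding conj_space_def cfun.finite_dim_def by blast
  then obtain S where S: "\<And>j. j \<in> {1..J} \<Longrightarrow> finite (S j)" "\<And>j. j \<in> {1..J} \<Longrightarrow> W j \<subseteq> cfun.span (S j)"
    by metis
  let ?S = "\<Union>j\<in>{1..J}. inj j ` S j"
  have "u \<in> cfun.span ?S" if u: "u \<in> product_space J W" for u
  proof -
    have "inj j (\<lambda>x. u (j, x)) \<in> cfun.span ?S" if j: "j \<in> {1..J}" for j
    proof -
      have "inj j (\<lambda>x. u (j, x)) \<in> cfun.span (inj j ` S j)"
        by (rule span_image_linear[OF subsetD[OF S(2)[OF j] memD[OF u j]]])
          (auto simp: inj_def fun_eq_iff)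
      moreover have "inj j ` S j \<subseteq> ?S" using j by blast
      ultimately show ?thesis using cfun.span_mono by blast
    qed
    then have "(\<Sum>j\<in>{1..J}. inj j (\<lambda>x. u (j, x))) \<in> cfun.span ?S"
      by (rule cfun.span_sum)
    moreover have "(\<Sum>j\<in>{1..J}. inj j (\<lambda>x. u (j, x))) = u"
    proof
      fix z :: "nat \<times> 'a"
      obtain k x where z: "z = (k, x)" by fastforce
      have "(\<Sum>j\<in>{1..J}. inj j (\<lambda>x. u (j, x))) z = (\<Sum>j\<in>{1..J}. if j = k then u (k, x) else 0)"
        unfolding sum_fun_apply z by (intro sum.cong) (auto simp: inj_def)
      also have "\<dots> = u z" using mem0[OF u, of k x] by (auto simp: z)
      finally show "(\<Sum>j\<in>{1..J}. inj j (\<lambda>x. u (j, x))) z = u z" .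
    qed
    ultimately show ?thesis by metis
  qed
  moreover have "finite ?S" using S(1) by blast
  ultimately show ?thesis
    unfolding conj_space_def cfun.finite_dim_def using sub cnj by blast
qed

lemma linear_map_restrict0: "linear_map V (restrict0 S ` V) (restrict0 S)"
  by (auto simp: linear_map_iff restrict0_def fun_eq_iff)

lemma restrict0_cconj: "restrict0 S (cconj u) = cconj (restrict0 S u)"
  by (auto simp: restrict0_def fun_eq_iff)

context mesh
begin

lemma conj_space_Vh: "conj_space (Vh \<Omega> \<T>)"
proof -
  have pw0: "0 \<in> pw_affine"
  proof -
    have "0 \<in> P1 \<tau>" for \<tau>
      unfolding P1_def by (rule CollectI, rule exI[of _ 0], rule exI[of _ 0]) simp
    then show ?thesis by (simp add: pw_affine_def)
  qed
  have sub: "cfun.subspace (Vh \<Omega> \<T>)"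
    by (rule cfun.subspaceI) (simp_all add: Vh_iff pw0 pw_affine_add pw_affine_scale)
  have cnj: "\<forall>u\<in>Vh \<Omega> \<T>. cconj u \<in> Vh \<Omega> \<T>"
    by (simp add: Vh_iff pw_affine_cconj)
  \<comment> \<open>Assigns to each point one of the cells containing it, so that shared faces count
    once. The functions \<open>one\<close> and \<open>coord\<close> may jump and lie outside
    \<open>Vh\<close>; what counts is a finite set whose span contains the space.\<close>
  define cell where "cell x = (SOME \<tau>. \<tau> \<in> \<T> \<and> x \<in> \<tau>)" for x
  have cell: "cell x \<in> \<T>" "x \<in> cell x" if "x \<in> closure \<Omega>" for x
  proof -
    have "\<exists>\<tau>. \<tau> \<in> \<T> \<and> x \<in> \<tau>" using that mesh_Union by blast
    then show "cell x \<in> \<T>" "x \<in> cell x" unfolding cell_def by (metis (mono_tags, lifting) someI_ex)+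
  qed
  define one where "one \<tau> x = (if x \<in> closure \<Omega> \<and> cell x = \<tau> then 1 else 0 :: complex)" for \<tau> x
  define coord where "coord \<tau> i x = (if x \<in> closure \<Omega> \<and> cell x = \<tau> then of_real (x $ i) else 0 :: complex)"
    for \<tau> i x
  let ?S = "one ` \<T> \<union> (\<lambda>(\<tau>, i). coord \<tau> i) ` (\<T> \<times> UNIV)"
  have "u \<in> cfun.span ?S" if u: "u \<in> Vh \<Omega> \<T>" for u
  proof -
    have "\<forall>\<tau>\<in>\<T>. \<exists>a b. \<forall>x\<in>\<tau>. u x = a + (\<Sum>i\<in>UNIV. b $ i * of_real (x $ i))"
      using u by (simp add: Vh_iff pw_affine_def P1_def)
    then obtain a b where ab: "\<And>\<tau> x. \<tau> \<in> \<T> \<Longrightarrow> x \<in> \<tau> \<Longrightarrow> u x = a \<tau> + (\<Sum>i\<in>UNIV. b \<tau> $ i * of_real (x $ i))"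
      by metis
    let ?v = "\<Sum>\<tau>\<in>\<T>. cscale (a \<tau>) (one \<tau>) + (\<Sum>i\<in>UNIV. cscale (b \<tau> $ i) (coord \<tau> i))"
    have "?v \<in> cfun.span ?S"
      by (intro cfun.span_sum cfun.span_add cfun.span_scale cfun.span_base) auto
    moreover have "?v = u"
    proof
      fix x
      show "?v x = u x"
      proof (cases "x \<in> closure \<Omega>")
        case True
        have "?v x = (\<Sum>\<tau>\<in>\<T>. if \<tau> = cell x then u x else 0)"
          unfolding sum_fun_apply plus_fun_apply
          by (intro sum.cong refl) (auto simp: one_def coord_def True ab[OF cell[OF True]])
        then show ?thesis using mesh_finite cell(1)[OF True] by simp
      next
        case False
        then show ?thesis using u by (simp add: sum_fun_apply one_def coord_def Vh_iff)
      qed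
    qed
    ultimately show ?thesis by metis
  qed
  moreover have "finite ?S" using mesh_finite by simp
  ultimately show ?thesis
    unfolding conj_space_def cfun.finite_dim_def using sub cnj by blast
qed

lemma trace_map_restrict0: "trace_map (Vh \<Omega> \<T>) (Vh_on S \<Omega> \<T>) (restrict0 S)"
  by unfold_locales (auto simp: conj_space_Vh Vh_on_def linear_map_restrict0 restrict0_cconj)

lemma conj_space_Vh_on: "conj_space (Vh_on S \<Omega> \<T>)"
  using trace_map.W[OF trace_map_restrict0] .

end

section \<open>The energy form\<close>

locale diffusion = mesh \<Omega> \<T>
  for \<Omega> :: "(real^3) set" and \<T> +
  fixes \<alpha> \<beta> :: "real^3 \<Rightarrow> real" and \<alpha>m \<alpha>p \<beta>m \<beta>p :: real
  assumes \<alpha>_meas: "\<alpha> \<in> borel_measurable (lebesgue_on \<Omega>)"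
    and \<beta>_meas: "\<beta> \<in> borel_measurable (lebesgue_on \<Omega>)"
    and \<alpha>m: "\<alpha>m > 0" and \<beta>m: "\<beta>m > 0"
    and \<alpha>_bounds: "\<And>x. x \<in> \<Omega> \<Longrightarrow> \<alpha>m \<le> \<alpha> x \<and> \<alpha> x \<le> \<alpha>p"
    and \<beta>_bounds: "\<And>x. x \<in> \<Omega> \<Longrightarrow> \<beta>m \<le> \<beta> x \<and> \<beta> x \<le> \<beta>p"
begin

abbreviation "energy \<equiv> energy_form \<alpha> \<beta>"

definition density :: "(real^3 \<Rightarrow> complex) \<Rightarrow> (real^3 \<Rightarrow> complex) \<Rightarrow> real^3 \<Rightarrow> complex" where
  "density u v x = of_real (\<alpha> x) * (\<Sum>i\<in>UNIV. partial_deriv i u x * partial_deriv i v x)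
     + of_real (\<beta> x) * u x * v x"

lemma energy_density: "energy G u v = (\<integral>x. density u v x \<partial>lebesgue_on G)"
  by (simp add: energy_form_def density_def)

lemma coefficient_ess_bounded: "ess_bounded \<Omega> (\<lambda>x. of_real (\<alpha> x))" "ess_bounded \<Omega> (\<lambda>x. of_real (\<beta> x))"
proof -
  show "ess_bounded \<Omega> (\<lambda>x. of_real (\<alpha> x))"
  proof (rule ess_boundedI[of _ _ \<alpha>p])
    show "AE x in lebesgue_on \<Omega>. norm (complex_of_real (\<alpha> x)) \<le> \<alpha>p"
      using \<alpha>_bounds \<alpha>m by (intro AE_I2) force
  qed (use \<alpha>_meas in simp)
  show "ess_bounded \<Omega> (\<lambda>x. of_real (\<beta> x))"
  proof (rule ess_boundedI[of _ _ \<beta>p])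
    show "AE x in lebesgue_on \<Omega>. norm (complex_of_real (\<beta> x)) \<le> \<beta>p"
      using \<beta>_bounds \<beta>m by (intro AE_I2) force
  qed (use \<beta>_meas in simp)
qed

lemma density_ess_bounded:
  assumes "u \<in> pw_affine" "v \<in> pw_affine"
  shows "ess_bounded \<Omega> (density u v)"
  unfolding density_def
  by (intro ess_bounded_add ess_bounded_mult ess_bounded_sum coefficient_ess_bounded
      pw_affine_ess_bounded assms) simp

lemma density_integrable:
  assumes "u \<in> pw_affine" "v \<in> pw_affine" "open G" "G \<subseteq> \<Omega>"
  shows "integrable (lebesgue_on G) (density u v)"
  using ess_bounded_integrable[OF ess_bounded_mono[OF density_ess_bounded[OF assms(1,2)] assms(4)
      sub_measurable(2)[OF assms(3,4)] domain_measurable(2)] sub_measurable(1)[OF assms(3,4)]] .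

lemma energy_add:
  assumes uvw: "u \<in> pw_affine" "v \<in> pw_affine" "w \<in> pw_affine" and G: "open G" "G \<subseteq> \<Omega>"
  shows "energy G (u + v) w = energy G u w + energy G v w"
proof -
  note i = density_integrable[OF _ _ G]
  have "AE x in lebesgue_on G. density (u + v) w x = density u w x + density v w x"
    using uvw by (intro AE_cells[OF G])
      (simp add: density_def partial_deriv_add algebra_simps sum.distrib)
  then have "energy G (u + v) w = (\<integral>x. density u w x + density v w x \<partial>lebesgue_on G)"
    unfolding energy_density
    by (intro integral_cong_AE borel_measurable_add borel_measurable_integrable i uvw pw_affine_add)
  then show ?thesis
    unfolding energy_density using i uvw by simp
qed

lemma energy_scale:
  assumes uw: "u \<in> pw_affine" "w \<in> pw_affine" and G: "open G" "G \<subseteq> \<Omega>"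
  shows "energy G (cscale c u) w = c * energy G u w"
proof -
  note i = density_integrable[OF _ _ G]
  have "AE x in lebesgue_on G. density (cscale c u) w x = c * density u w x"
    using uw by (intro AE_cells[OF G])
      (simp add: density_def partial_deriv_scale algebra_simps sum_distrib_left)
  then have "energy G (cscale c u) w = (\<integral>x. c * density u w x \<partial>lebesgue_on G)"
    unfolding energy_density
    by (intro integral_cong_AE borel_measurable_times borel_measurable_const
        borel_measurable_integrable i uw pw_affine_scale)
  then show ?thesis
    unfolding energy_density by simp
qed

lemma energy_cconj:
  assumes uw: "u \<in> pw_affine" "w \<in> pw_affine" and G: "open G" "G \<subseteq> \<Omega>"
  shows "energy G (cconj u) (cconj w) = cnj (energy G u w)"
proof -
  note i = density_integrable[OF _ _ G]
  have "AE x in lebesgue_on G. density (cconj u) (cconj w) x = cnj (density u w x)"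
    using uw by (intro AE_cells[OF G]) (simp add: density_def partial_deriv_cconj)
  moreover have "integrable (lebesgue_on G) (\<lambda>x. cnj (density u w x))"
    using i[OF uw] by simp
  ultimately have "energy G (cconj u) (cconj w) = (\<integral>x. cnj (density u w x) \<partial>lebesgue_on G)"
    unfolding energy_density
    by (intro integral_cong_AE borel_measurable_integrable i uw pw_affine_cconj)
  then show ?thesis
    unfolding energy_density by (simp add: Bochner_Integration.integral_cnj)
qed

text \<open>The \<alpha>-term is nonnegative and the \<beta>-term at least \<beta>m |u|^2. Zero
  energy hence makes u vanish almost everywhere on G, and by continuity everywhere on G.\<close>

lemma energy_positive:
  assumes u: "u \<in> pw_affine" and G: "open G" "G \<subseteq> \<Omega>"
  shows "Re (energy G u (cconj u)) \<ge> 0"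
    and "\<exists>x\<in>G. u x \<noteq> 0 \<Longrightarrow> Re (energy G u (cconj u)) > 0"
proof -
  note i = density_integrable[OF u pw_affine_cconj[OF u] G]
  let ?r = "\<lambda>x. Re (density u (cconj u) x)"
  have low: "AE x in lebesgue_on G. \<beta>m * (norm (u x))\<^sup>2 \<le> ?r x"
  proof (rule AE_cells[OF G])
    fix \<tau> x assume t: "\<tau> \<in> \<T>" "x \<in> interior \<tau>" and "x \<in> G"
    then have x: "x \<in> \<Omega>" using G by blast
    have sq: "z * cnj z = (complex_of_real (norm z))\<^sup>2" for z
      using complex_norm_square[of z] by simp
    have "density u (cconj u) x =
        of_real (\<alpha> x * (\<Sum>i\<in>UNIV. (norm (partial_deriv i u x))\<^sup>2) + \<beta> x * (norm (u x))\<^sup>2)"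
      by (simp add: density_def partial_deriv_cconj[OF u t] sq mult.assoc)
    then have "?r x = \<alpha> x * (\<Sum>i\<in>UNIV. (norm (partial_deriv i u x))\<^sup>2) + \<beta> x * (norm (u x))\<^sup>2"
      by (metis Re_complex_of_real)
    moreover have "\<alpha> x * (\<Sum>i\<in>UNIV. (norm (partial_deriv i u x))\<^sup>2) \<ge> 0"
      using \<alpha>_bounds[OF x] \<alpha>m by (intro mult_nonneg_nonneg sum_nonneg) auto
    moreover have "\<beta>m * (norm (u x))\<^sup>2 \<le> \<beta> x * (norm (u x))\<^sup>2"
      using \<beta>_bounds[OF x] by (intro mult_right_mono) auto
    ultimately show "\<beta>m * (norm (u x))\<^sup>2 \<le> ?r x" by linarith
  qed
  then have nonneg: "AE x in lebesgue_on G. 0 \<le> ?r x"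
  proof eventually_elim
    case (elim x)
    moreover have "0 \<le> \<beta>m * (norm (u x))\<^sup>2" using \<beta>m by simp
    ultimately show ?case by linarith
  qed
  have e: "Re (energy G u (cconj u)) = (\<integral>x. ?r x \<partial>lebesgue_on G)"
    unfolding energy_density using i by simp
  show ge: "Re (energy G u (cconj u)) \<ge> 0"
    unfolding e by (rule integral_nonneg_AE[OF nonneg])
  assume "\<exists>x\<in>G. u x \<noteq> 0"
  then obtain x where x: "x \<in> G" "u x \<noteq> 0" by blast
  have "Re (energy G u (cconj u)) \<noteq> 0"
  proof
    assume "Re (energy G u (cconj u)) = 0"
    moreover have "integrable (lebesgue_on G) ?r" using i by (rule integrable_Re)
    ultimately have "AE x in lebesgue_on G. ?r x = 0"
      using integral_nonneg_eq_0_iff_AE[OF _ nonneg] unfolding e by blast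
    with low have "AE x in lebesgue_on G. u x = 0"
    proof eventually_elim
      case (elim x)
      then have "(norm (u x))\<^sup>2 \<le> 0" using \<beta>m by (simp add: mult_le_0_iff)
      then show ?case by simp
    qed
    \<comment> \<open>u is continuous on the closed domain, so Z is closed; a closed set that
      contains almost all of an open set contains all of it.\<close>
    moreover define Z where "Z = {x \<in> closure \<Omega>. u x = 0}"
    ultimately have "AE x\<in>G in lebesgue. x \<in> Z"
      using sub_measurable(2)[OF G] G closure_subset by (auto simp: AE_restrict_space_iff Z_def elim!: eventually_mono)
    moreover have "closed Z"
      unfolding Z_def by (rule continuous_closed_preimage_constant[OF pw_affine_continuous_on[OF u] closed_closure])
    ultimately have "x \<in> Z" using mem_closed_if_AE_lebesgue_open[OF G(1) _ _ x(1)] by blast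
    then show False using x by (simp add: Z_def)
  qed
  then show "Re (energy G u (cconj u)) > 0" using ge by linarith
qed

text \<open>A nonzero value may first be found on the boundary, where the energy integral does not
  look; continuity moves it inside.\<close>

lemma nonzero_in_interior:
  assumes "u \<in> pw_affine" "G \<subseteq> \<Omega>" "x \<in> closure G" "u x \<noteq> 0"
  shows "\<exists>y\<in>G. u y \<noteq> 0"
proof (rule ccontr)
  assume *: "\<not> ?thesis"
  have "continuous_on (closure G) u"
    using pw_affine_continuous_on[OF assms(1)] closure_mono[OF assms(2)] continuous_on_subset by blast
  then have "u x = 0"
    by (rule continuous_constant_on_closure[OF _ _ assms(3)]) (use * in blast)
  then show False using assms(4) by blast
qed

lemma global_op_hpd: "hpd_operator (Vh \<Omega> \<T>) (global_op \<alpha> \<beta> \<Omega> \<T>)"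
proof
  let ?V = "Vh \<Omega> \<T>"
  note Vc = conj_spaceD[OF conj_space_Vh]
  note O = open_domain order_refl
  have pw: "u \<in> pw_affine" if "u \<in> ?V" for u using that by (simp add: Vh_iff)
  have ap: "global_op \<alpha> \<beta> \<Omega> \<T> u v = energy \<Omega> u v" if "v \<in> ?V" for u v
    using that by (simp add: global_op_def restrict0_def)
  have ap0: "global_op \<alpha> \<beta> \<Omega> \<T> u v = 0" if "v \<notin> ?V" for u v
    using that by (simp add: global_op_def restrict0_def)
  show "conj_space ?V" by (rule conj_space_Vh)
  have r: "energy \<Omega> u (v + w) = energy \<Omega> u v + energy \<Omega> u w"
    "energy \<Omega> u (cscale c v) = c * energy \<Omega> u v" if "u \<in> ?V" "v \<in> ?V" "w \<in> ?V" for u v w c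
    unfolding energy_form_commute[of _ _ _ u]
    using energy_add[OF pw pw pw O] energy_scale[OF pw pw O] that by auto
  show "linear_map ?V (dual_space ?V) (global_op \<alpha> \<beta> \<Omega> \<T>)"
    unfolding linear_map_iff
  proof (intro conjI ballI allI)
    show "global_op \<alpha> \<beta> \<Omega> \<T> \<in> ?V \<rightarrow> dual_space ?V"
      by (rule funcsetI) (simp add: dual_space_iff ap ap0 Vc r)
    show "global_op \<alpha> \<beta> \<Omega> \<T> (u + v) = global_op \<alpha> \<beta> \<Omega> \<T> u + global_op \<alpha> \<beta> \<Omega> \<T> v"
      if "u \<in> ?V" "v \<in> ?V" for u v
    proof
      fix w show "global_op \<alpha> \<beta> \<Omega> \<T> (u + v) w = (global_op \<alpha> \<beta> \<Omega> \<T> u + global_op \<alpha> \<beta> \<Omega> \<T> v) w"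
        by (cases "w \<in> ?V") (simp_all add: ap ap0 energy_add[OF pw pw pw O] that)
    qed
    show "global_op \<alpha> \<beta> \<Omega> \<T> (cscale c u) = cscale c (global_op \<alpha> \<beta> \<Omega> \<T> u)" if "u \<in> ?V" for c u
    proof
      fix w show "global_op \<alpha> \<beta> \<Omega> \<T> (cscale c u) w = cscale c (global_op \<alpha> \<beta> \<Omega> \<T> u) w"
        by (cases "w \<in> ?V") (simp_all add: ap ap0 energy_scale[OF pw pw O] that)
    qed
  qed
  show "hermitian_pos_def ?V (global_op \<alpha> \<beta> \<Omega> \<T>)"
    unfolding hermitian_pos_def_iff
  proof (intro conjI ballI impI)
    show "global_op \<alpha> \<beta> \<Omega> \<T> u (cconj v) = cnj (global_op \<alpha> \<beta> \<Omega> \<T> v (cconj u))"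
      if "u \<in> ?V" "v \<in> ?V" for u v
      using energy_cconj[OF pw[OF that(2)] pw[OF Vc(5)[OF that(1)]] O] that
      by (simp add: ap Vc energy_form_commute[of _ _ _ u])
    show "Re (global_op \<alpha> \<beta> \<Omega> \<T> u (cconj u)) > 0" if u: "u \<in> ?V" "u \<noteq> 0" for u
    proof -
      obtain x where x: "u x \<noteq> 0" using u(2) by (auto simp: fun_eq_iff)
      then have "x \<in> closure \<Omega>" using u(1) by (auto simp: Vh_iff)
      then show ?thesis
        using energy_positive(2)[OF pw[OF u(1)] O nonzero_in_interior[OF pw[OF u(1)] order_refl _ x]] u Vc
        by (simp add: ap)
    qed
  qed
qed

end

section \<open>Subdomain decomposition\<close>

locale decomposition = diffusion \<Omega> \<T> \<alpha> \<beta> \<alpha>m \<alpha>p \<beta>m \<beta>p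
  for \<Omega> :: "(real^3) set" and \<T> and \<alpha> \<beta> :: "real^3 \<Rightarrow> real" and \<alpha>m \<alpha>p \<beta>m \<beta>p :: real +
  fixes J :: nat and D :: "nat \<Rightarrow> (real^3) set"
  assumes partition: "subdomain_partition \<Omega> \<T> J D"
begin

lemma sub:
  assumes "j \<in> {1..J}"
  shows "open (D j)" "D j \<subseteq> \<Omega>" "D j \<noteq> {}" "bounded (D j)" "interior (closure (D j)) = D j"
    "\<exists>S\<subseteq>\<T>. closure (D j) = \<Union>S"
  using partition assms by (auto simp: subdomain_partition_def polyhedral_domain_def)

lemma disjoint: "disjoint_family_on D {1..J}"
  using partition by (simp add: subdomain_partition_def)

lemma cover: "closure \<Omega> = (\<Union>j\<in>{1..J}. closure (D j))"
  using partition by (simp add: subdomain_partition_def)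

lemma frontier_sub_closure: "frontier (D j) \<subseteq> closure (D j)"
  by (auto simp: frontier_def)

lemma sub_cases:
  assumes "j \<in> {1..J}" "x \<in> closure (D j)"
  shows "x \<in> D j \<or> x \<in> frontier (D j)"
  using assms sub(1)[OF assms(1)] by (auto simp: frontier_def interior_open)

text \<open>An open set disjoint from \<open>D j\<close> is disjoint from its closure, so a common
  point of both closures cannot lie in \<open>D i\<close>.\<close>

lemma overlap_frontier:
  assumes "i \<in> {1..J}" "j \<in> {1..J}" "i \<noteq> j" "x \<in> closure (D i)" "x \<in> closure (D j)"
  shows "x \<in> frontier (D i)"
proof -
  have "D i \<inter> D j = {}" using disjoint assms by (auto simp: disjoint_family_on_def)
  then have "D i \<inter> closure (D j) = {}" using sub(1)[OF assms(1)] open_Int_closure_eq_empty by blast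
  then show ?thesis using sub_cases[OF assms(1,4)] assms(5) by blast
qed

text \<open>The absence of cracks, \<open>interior (closure (D j)) = D j\<close>, makes the frontier
  that of the closure. The closure is a finite union of cells, whose frontier lies in the union of
  the cell frontiers.\<close>

lemma frontier_null:
  assumes j: "j \<in> {1..J}"
  shows "frontier (D j) \<subseteq> null"
proof -
  obtain S where S: "S \<subseteq> \<T>" "closure (D j) = \<Union>S" using sub(6)[OF j] by blast
  have "frontier (D j) = frontier (closure (D j))"
    using sub(1,5)[OF j] by (simp add: frontier_def interior_open)
  also have "\<dots> \<subseteq> (\<Union>\<tau>\<in>S. frontier \<tau>)"
    unfolding S(2) by (rule frontier_Union_subset[OF finite_subset[OF S(1) mesh_finite]])
  finally show ?thesis using S(1) by (auto simp: null_def)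
qed

text \<open>An interior point of the cell lies in some closed subdomain, hence in one of the cells
  composing it, and that cell absorbs the given one by conformity.\<close>

lemma cell_in_subdomain:
  assumes t: "\<tau> \<in> \<T>"
  shows "\<exists>j\<in>{1..J}. \<tau> \<subseteq> closure (D j)"
proof -
  obtain x where x: "x \<in> interior \<tau>" using mesh_cell(4)[OF t] by blast
  then have "x \<in> closure \<Omega>" using mesh_cell(6)[OF t] interior_subset by blast
  then obtain j where j: "j \<in> {1..J}" "x \<in> closure (D j)" using cover by blast
  then obtain S where S: "S \<subseteq> \<T>" "closure (D j) = \<Union>S" using sub(6) by blast
  then obtain \<tau>' where "\<tau>' \<in> S" "x \<in> \<tau>'" using j by blast
  then show ?thesis using mesh_absorb[OF t _ x, of \<tau>'] S j by blast
qed

text \<open>Off the negligible set \<open>null\<close> the domain is the disjoint union of the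
  subdomains: a point of a closed subdomain outside the open one is on its frontier.\<close>

lemma energy_decomposition:
  assumes "u \<in> pw_affine" "v \<in> pw_affine"
  shows "energy \<Omega> u v = (\<Sum>j\<in>{1..J}. energy (D j) u v)"
proof -
  let ?f = "density u v"
  have m: "S \<inter> space lebesgue \<in> sets lebesgue" if "S \<in> sets lebesgue" for S :: "(real^3) set"
    using that by simp
  have r: "(\<integral>x. ?f x \<partial>lebesgue_on S) = (\<integral>x. indicator S x *\<^sub>R ?f x \<partial>lebesgue)" if "S \<in> sets lebesgue" for S
    by (rule integral_restrict_space[OF m[OF that]])
  have i: "integrable lebesgue (\<lambda>x. indicator S x *\<^sub>R ?f x)" if "open S" "S \<subseteq> \<Omega>" for S
    using density_integrable[OF assms that] integrable_restrict_space[OF m[OF sub_measurable(2)[OF that]]]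
    by blast
  have iD: "integrable lebesgue (\<lambda>x. indicator (D j) x *\<^sub>R ?f x)" if "j \<in> {1..J}" for j
    using i sub(1,2)[OF that] by blast
  have "AE x in lebesgue. x \<notin> null"
    using null_negligible negligible_iff_null_sets by (intro AE_not_in) blast
  then have "AE x in lebesgue. indicator \<Omega> x *\<^sub>R ?f x = (\<Sum>j\<in>{1..J}. indicator (D j) x *\<^sub>R ?f x)"
  proof eventually_elim
    case (elim x)
    have "x \<in> \<Omega> \<longleftrightarrow> x \<in> (\<Union>j\<in>{1..J}. D j)"
    proof
      assume "x \<in> \<Omega>"
      then have "x \<in> closure \<Omega>" using closure_subset by blast
      then obtain j where j: "j \<in> {1..J}" "x \<in> closure (D j)" using cover by blast
      then show "x \<in> (\<Union>j\<in>{1..J}. D j)" using sub_cases[OF j] frontier_null[OF j(1)] elim by blast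
    qed (use sub(2) in blast)
    then have "indicator \<Omega> x = (indicator (\<Union>j\<in>{1..J}. D j) x :: real)" by (simp add: indicator_def)
    also have "\<dots> = (\<Sum>j\<in>{1..J}. indicator (D j) x)"
      by (rule indicator_UN_disjoint[OF _ disjoint]) simp
    finally show ?case by (simp add: scaleR_sum_left)
  qed
  then have "(\<integral>x. indicator \<Omega> x *\<^sub>R ?f x \<partial>lebesgue) = (\<integral>x. (\<Sum>j\<in>{1..J}. indicator (D j) x *\<^sub>R ?f x) \<partial>lebesgue)"
    by (intro integral_cong_AE borel_measurable_sum borel_measurable_integrable i[OF open_domain order_refl] iD)
  also have "\<dots> = (\<Sum>j\<in>{1..J}. \<integral>x. indicator (D j) x *\<^sub>R ?f x \<partial>lebesgue)"
    by (rule Bochner_Integration.integral_sum[OF iD])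
  also have "\<dots> = (\<Sum>j\<in>{1..J}. \<integral>x. ?f x \<partial>lebesgue_on (D j))"
    by (intro sum.cong refl r[symmetric] sub_measurable(2) sub(1,2))
  finally show ?thesis
    unfolding energy_density r[OF domain_measurable(2)] .
qed

section \<open>The product space, the block-diagonal operator and the local traces\<close>

abbreviation "VV \<equiv> VVh_dom \<Omega> \<T> J D"
abbreviation "WW \<equiv> VVh_skel \<Omega> \<T> J D"
abbreviation "component j u \<equiv> \<lambda>x. u (j, x)"

lemma conj_space_VV: "conj_space VV"
  unfolding VVh_dom_def by (rule conj_space_product) (rule conj_space_Vh_on)

text \<open>Each local function is a restriction of a global one; the representative w makes the
  energy lemmas for \<open>pw_affine\<close> applicable on each subdomain.\<close>

lemma VV_component:
  assumes "u \<in> VV" "j \<in> {1..J}"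
  obtains w where "w \<in> Vh \<Omega> \<T>" "w \<in> pw_affine" "component j u = restrict0 (closure (D j)) w"
    "\<And>x. x \<in> closure (D j) \<Longrightarrow> u (j, x) = w x"
proof -
  have "component j u \<in> Vh_on (closure (D j)) \<Omega> \<T>"
    using assms by (simp add: VVh_dom_def product_space_def)
  then obtain w where w: "w \<in> Vh \<Omega> \<T>" "component j u = restrict0 (closure (D j)) w"
    by (auto simp: Vh_on_def)
  have pw: "w \<in> pw_affine" using w(1) by (simp add: Vh_iff)
  have "u (j, x) = w x" if "x \<in> closure (D j)" for x
    using fun_cong[OF w(2), of x] that by (simp add: restrict0_def)
  then show ?thesis by (rule that[OF w(1) pw w(2)])
qed

definition block_form :: "(nat \<times> (real^3) \<Rightarrow> complex) \<Rightarrow> (nat \<times> (real^3) \<Rightarrow> complex) \<Rightarrow> complex" where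
  "block_form u v = (\<Sum>j\<in>{1..J}. energy (D j) (component j u) (component j v))"

lemma block_op_apply: "v \<in> VV \<Longrightarrow> block_op \<alpha> \<beta> \<Omega> \<T> J D u v = block_form u v"
  and block_op_outside: "v \<notin> VV \<Longrightarrow> block_op \<alpha> \<beta> \<Omega> \<T> J D u v = 0"
  by (simp_all add: block_op_def restrict0_def block_form_def)

lemma block_form_commute: "block_form u v = block_form v u"
  unfolding block_form_def by (intro sum.cong refl energy_form_commute)

lemma energy_component:
  assumes "j \<in> {1..J}" "\<And>x. x \<in> closure (D j) \<Longrightarrow> f x = w x" "\<And>x. x \<in> closure (D j) \<Longrightarrow> g x = w' x"
  shows "energy (D j) f g = energy (D j) w w'"
  by (rule energy_form_cong[OF sub(1)[OF assms(1)]]) (use assms(2,3) closure_subset in blast)+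

lemma block_form_add:
  assumes "u \<in> VV" "v \<in> VV" "w \<in> VV"
  shows "block_form (u + v) w = block_form u w + block_form v w"
  unfolding block_form_def sum.distrib[symmetric]
proof (rule sum.cong[OF refl])
  fix j assume j: "j \<in> {1..J}"
  obtain a where a: "a \<in> pw_affine" "\<And>x. x \<in> closure (D j) \<Longrightarrow> u (j, x) = a x"
    using VV_component[OF assms(1) j] by metis
  obtain b where b: "b \<in> pw_affine" "\<And>x. x \<in> closure (D j) \<Longrightarrow> v (j, x) = b x"
    using VV_component[OF assms(2) j] by metis
  obtain c where c: "c \<in> pw_affine" "\<And>x. x \<in> closure (D j) \<Longrightarrow> w (j, x) = c x"
    using VV_component[OF assms(3) j] by metis
  have "energy (D j) (component j (u + v)) (component j w) = energy (D j) (a + b) c"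
    by (rule energy_component[OF j]) (simp_all add: a(2) b(2) c(2))
  moreover have "energy (D j) (component j u) (component j w) = energy (D j) a c"
    by (rule energy_component[OF j]) (simp_all add: a(2) c(2))
  moreover have "energy (D j) (component j v) (component j w) = energy (D j) b c"
    by (rule energy_component[OF j]) (simp_all add: b(2) c(2))
  ultimately show "energy (D j) (component j (u + v)) (component j w) =
      energy (D j) (component j u) (component j w) + energy (D j) (component j v) (component j w)"
    using energy_add[OF a(1) b(1) c(1) sub(1,2)[OF j]] by simp
qed

lemma block_form_scale:
  assumes "u \<in> VV" "w \<in> VV"
  shows "block_form (cscale k u) w = k * block_form u w"
  unfolding block_form_def sum_distrib_left
proof (rule sum.cong[OF refl])
  fix j assume j: "j \<in> {1..J}"
  obtain a where a: "a \<in> pw_affine" "\<And>x. x \<in> closure (D j) \<Longrightarrow> u (j, x) = a x"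
    using VV_component[OF assms(1) j] by metis
  obtain c where c: "c \<in> pw_affine" "\<And>x. x \<in> closure (D j) \<Longrightarrow> w (j, x) = c x"
    using VV_component[OF assms(2) j] by metis
  have "energy (D j) (component j (cscale k u)) (component j w) = energy (D j) (cscale k a) c"
    by (rule energy_component[OF j]) (simp_all add: a(2) c(2))
  moreover have "energy (D j) (component j u) (component j w) = energy (D j) a c"
    by (rule energy_component[OF j]) (simp_all add: a(2) c(2))
  ultimately show "energy (D j) (component j (cscale k u)) (component j w) =
      k * energy (D j) (component j u) (component j w)"
    using energy_scale[OF a(1) c(1) sub(1,2)[OF j]] by simp
qed

lemma block_form_cconj:
  assumes "u \<in> VV" "w \<in> VV"
  shows "block_form (cconj u) (cconj w) = cnj (block_form u w)"
  unfolding block_form_def cnj_sum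
proof (rule sum.cong[OF refl])
  fix j assume j: "j \<in> {1..J}"
  obtain a where a: "a \<in> pw_affine" "\<And>x. x \<in> closure (D j) \<Longrightarrow> u (j, x) = a x"
    using VV_component[OF assms(1) j] by metis
  obtain c where c: "c \<in> pw_affine" "\<And>x. x \<in> closure (D j) \<Longrightarrow> w (j, x) = c x"
    using VV_component[OF assms(2) j] by metis
  have "energy (D j) (component j (cconj u)) (component j (cconj w)) = energy (D j) (cconj a) (cconj c)"
    by (rule energy_component[OF j]) (simp_all add: a(2) c(2))
  moreover have "energy (D j) (component j u) (component j w) = energy (D j) a c"
    by (rule energy_component[OF j]) (simp_all add: a(2) c(2))
  ultimately show "energy (D j) (component j (cconj u)) (component j (cconj w)) =
      cnj (energy (D j) (component j u) (component j w))"
    using energy_cconj[OF a(1) c(1) sub(1,2)[OF j]] by simp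
qed

lemma block_form_positive:
  assumes u: "u \<in> VV" "u \<noteq> 0"
  shows "Re (block_form u (cconj u)) > 0"
proof -
  have comp: "\<exists>w\<in>pw_affine. (\<forall>x\<in>closure (D j). u (j, x) = w x) \<and>
      energy (D j) (component j u) (component j (cconj u)) = energy (D j) w (cconj w)"
    if j: "j \<in> {1..J}" for j
  proof -
    obtain a where a: "a \<in> pw_affine" "\<And>x. x \<in> closure (D j) \<Longrightarrow> u (j, x) = a x"
      using VV_component[OF u(1) j] by metis
    have "energy (D j) (component j u) (component j (cconj u)) = energy (D j) a (cconj a)"
      by (rule energy_component[OF j]) (simp_all add: a(2))
    then show ?thesis using a by blast
  qed
  have nonneg: "Re (energy (D j) (component j u) (component j (cconj u))) \<ge> 0" if j: "j \<in> {1..J}" for j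
    using comp[OF j] energy_positive(1)[OF _ sub(1,2)[OF j]] by metis
  obtain z where "u z \<noteq> 0" using u(2) by (auto simp: fun_eq_iff)
  then obtain j x where jx: "u (j, x) \<noteq> 0" by (cases z) auto
  then have j: "j \<in> {1..J}" using u(1) by (auto simp: VVh_dom_def product_space_def)
  have x: "x \<in> closure (D j)"
  proof -
    obtain w where "component j u = restrict0 (closure (D j)) w" using VV_component[OF u(1) j] by metis
    then have "u (j, x) = restrict0 (closure (D j)) w x" by (rule fun_cong)
    then show ?thesis using jx by (auto simp: restrict0_def split: if_splits)
  qed
  obtain w where w: "w \<in> pw_affine" "\<forall>x\<in>closure (D j). u (j, x) = w x"
    "energy (D j) (component j u) (component j (cconj u)) = energy (D j) w (cconj w)"
    using comp[OF j] by blast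
  have "w x \<noteq> 0" using w(2) x jx by metis
  then have "Re (energy (D j) (component j u) (component j (cconj u))) > 0"
    unfolding w(3)
    using energy_positive(2)[OF w(1) sub(1,2)[OF j]] nonzero_in_interior[OF w(1) sub(2)[OF j] x] by blast
  then show ?thesis
    unfolding block_form_def Re_sum using nonneg j by (intro sum_pos2[of _ j]) auto
qed

lemma block_op_hpd: "hpd_operator VV (block_op \<alpha> \<beta> \<Omega> \<T> J D)"
proof
  let ?L = "block_op \<alpha> \<beta> \<Omega> \<T> J D"
  note Vc = conj_spaceD[OF conj_space_VV]
  note ap = block_op_apply block_op_outside
  show "conj_space VV" by (rule conj_space_VV)
  have r: "block_form u (v + w) = block_form u v + block_form u w"
    "block_form u (cscale c v) = c * block_form u v" if "u \<in> VV" "v \<in> VV" "w \<in> VV" for u v w c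
    unfolding block_form_commute[of u]
    using block_form_add block_form_scale that by auto
  show "linear_map VV (dual_space VV) ?L"
    unfolding linear_map_iff
  proof (intro conjI ballI allI)
    show "?L \<in> VV \<rightarrow> dual_space VV"
      by (rule funcsetI) (simp add: dual_space_iff ap Vc r)
    show "?L (u + v) = ?L u + ?L v" if "u \<in> VV" "v \<in> VV" for u v
    proof
      fix w show "?L (u + v) w = (?L u + ?L v) w"
        by (cases "w \<in> VV") (simp_all add: ap block_form_add that)
    qed
    show "?L (cscale c u) = cscale c (?L u)" if "u \<in> VV" for c u
    proof
      fix w show "?L (cscale c u) w = cscale c (?L u) w"
        by (cases "w \<in> VV") (simp_all add: ap block_form_scale that)
    qed
  qed
  show "hermitian_pos_def VV ?L"
    unfolding hermitian_pos_def_iff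
  proof (intro conjI ballI impI)
    show "?L u (cconj v) = cnj (?L v (cconj u))" if "u \<in> VV" "v \<in> VV" for u v
      using block_form_cconj[OF that(2) Vc(5)[OF that(1)]] that
      by (simp add: ap Vc block_form_commute[of u])
    show "Re (?L u (cconj u)) > 0" if "u \<in> VV" "u \<noteq> 0" for u
      using block_form_positive[OF that] Vc that by (simp add: ap)
  qed
qed

lemma VV_skel_trace_map: "trace_map VV WW (local_traces J D)"
proof
  show "conj_space VV" by (rule conj_space_VV)
  have into: "local_traces J D u \<in> WW" if u: "u \<in> VV" for u
  proof -
    have "(\<lambda>x. local_traces J D u (j, x)) \<in> Vh_on (frontier (D j)) \<Omega> \<T>" if j: "j \<in> {1..J}" for j
    proof -
      obtain w where w: "w \<in> Vh \<Omega> \<T>" "\<And>x. x \<in> closure (D j) \<Longrightarrow> u (j, x) = w x"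
        using VV_component[OF u j] by metis
      have "(\<lambda>x. local_traces J D u (j, x)) = restrict0 (frontier (D j)) w"
        using j w(2) frontier_sub_closure[of j] by (auto simp: local_traces_def restrict0_def fun_eq_iff)
      then show ?thesis using w(1) by (auto simp: Vh_on_def)
    qed
    moreover have "local_traces J D u (j, x) = 0" if "j \<notin> {1..J}" for j x
      using that by (auto simp: local_traces_def restrict0_def)
    ultimately show ?thesis by (simp add: VVh_skel_def product_space_def)
  qed
  have "q \<in> local_traces J D ` VV" if q: "q \<in> WW" for q
  proof -
    have "\<forall>j\<in>{1..J}. \<exists>w\<in>Vh \<Omega> \<T>. (\<lambda>x. q (j, x)) = restrict0 (frontier (D j)) w"
      using q by (auto simp: VVh_skel_def product_space_def Vh_on_def)
    then obtain w where w: "\<And>j. j \<in> {1..J} \<Longrightarrow> w j \<in> Vh \<Omega> \<T>"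
      "\<And>j. j \<in> {1..J} \<Longrightarrow> (\<lambda>x. q (j, x)) = restrict0 (frontier (D j)) (w j)" by metis
    \<comment> \<open>Each trace is extended by its own global function w j, independently of the
      neighbours: a tuple has no matching condition at interfaces.\<close>
    define u where "u = (\<lambda>(j, x). if j \<in> {1..J} then restrict0 (closure (D j)) (w j) x else 0)"
    have "component j u \<in> Vh_on (closure (D j)) \<Omega> \<T>" if j: "j \<in> {1..J}" for j
    proof -
      have "component j u = restrict0 (closure (D j)) (w j)" using j by (simp add: u_def fun_eq_iff)
      then show ?thesis using w(1)[OF j] by (simp add: Vh_on_def)
    qed
    moreover have "u (j, x) = 0" if "j \<notin> {1..J}" for j x using that by (auto simp: u_def)
    ultimately have "u \<in> VV" by (simp add: VVh_dom_def product_space_def)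
    moreover have "local_traces J D u = q"
    proof
      fix z :: "nat \<times> (real^3)"
      obtain j x where z: "z = (j, x)" by fastforce
      show "local_traces J D u z = q z"
      proof (cases "j \<in> {1..J}")
        case True
        then show ?thesis
          using fun_cong[OF w(2)[OF True], of x] frontier_sub_closure[of j]
          by (auto simp: z local_traces_def u_def restrict0_def)
      next
        case False
        then have "q (j, x) = 0" using q by (simp add: VVh_skel_def product_space_def)
        then show ?thesis using False by (auto simp: z local_traces_def restrict0_def)
      qed
    qed
    ultimately show ?thesis by blast
  qed
  then show "local_traces J D ` VV = WW" using into by blast
  show "linear_map VV WW (local_traces J D)"
    unfolding linear_map_iff using into by (auto simp: local_traces_def restrict0_def fun_eq_iff)
  show "local_traces J D (cconj u) = cconj (local_traces J D u)" for u
    by (simp add: local_traces_def restrict0_cconj)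
qed

lemma DtN_schur: "schur VV WW (local_traces J D) (block_op \<alpha> \<beta> \<Omega> \<T> J D)"
  using VV_skel_trace_map block_op_hpd by (simp add: schur_def)

lemma DtN_op_eq: "DtN_op \<alpha> \<beta> \<Omega> \<T> J D = schur.S VV WW (local_traces J D) (block_op \<alpha> \<beta> \<Omega> \<T> J D)"
  unfolding DtN_op_def schur.S_def[OF DtN_schur] schur.K_def[OF DtN_schur] ..

section \<open>Conforming functions as tuples, gluing, and assembly of the global problem\<close>

lemma skeleton_sub: "skeleton J D \<subseteq> closure \<Omega>"
  unfolding skeleton_def cover using frontier_sub_closure by blast

lemma skeleton_nonempty: "skeleton J D \<noteq> {}"
proof -
  obtain j where j: "j \<in> {1..J}" using domain_nonempty cover closure_subset by blast
  have "frontier (D j) \<noteq> {}"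
    using sub(3,4)[OF j] not_bounded_UNIV by (auto simp: frontier_eq_empty)
  then show ?thesis using j by (auto simp: skeleton_def)
qed

text \<open>The embedding of conforming functions into tuples. By \<open>glue\<close>, its range
  contains every tuple whose traces come from one function on the skeleton.\<close>

definition broken :: "(real^3 \<Rightarrow> complex) \<Rightarrow> nat \<times> (real^3) \<Rightarrow> complex" where
  "broken u = restrict0 (SIGMA j:{1..J}. closure (D j)) (\<lambda>(j, x). u x)"

lemma broken_in:
  assumes "u \<in> Vh \<Omega> \<T>"
  shows "broken u \<in> VV"
proof -
  have "component j (broken u) \<in> Vh_on (closure (D j)) \<Omega> \<T>" if j: "j \<in> {1..J}" for j
  proof -
    have "component j (broken u) = restrict0 (closure (D j)) u"
      using j by (auto simp: broken_def restrict0_def fun_eq_iff)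
    then show ?thesis using assms by (simp add: Vh_on_def)
  qed
  moreover have "broken u (j, x) = 0" if "j \<notin> {1..J}" for j x
    using that by (auto simp: broken_def restrict0_def)
  ultimately show ?thesis by (simp add: VVh_dom_def product_space_def)
qed

lemma block_form_broken:
  assumes "u \<in> Vh \<Omega> \<T>" "v \<in> Vh \<Omega> \<T>"
  shows "block_form (broken u) (broken v) = energy \<Omega> u v"
proof -
  have "energy (D j) (component j (broken u)) (component j (broken v)) = energy (D j) u v"
    if j: "j \<in> {1..J}" for j
    by (rule energy_component[OF j]) (use j in \<open>auto simp: broken_def restrict0_def\<close>)
  then show ?thesis
    using assms by (simp add: block_form_def Vh_iff energy_decomposition)
qed

text \<open>The commuting square behind the assembly; through it a variational equation for tuples
  yields one for conforming functions.\<close>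

lemma traces_broken: "local_traces J D (broken u) = skel_restriction J D (skel_trace J D u)"
  using frontier_sub_closure
  by (fastforce simp: local_traces_def broken_def skel_restriction_def skel_trace_def restrict0_def
      skeleton_def fun_eq_iff)

lemma skel_restriction_linear: "linear_map (Vh_on (skeleton J D) \<Omega> \<T>) WW (skel_restriction J D)"
proof -
  have "skel_restriction J D p \<in> WW" if p: "p \<in> Vh_on (skeleton J D) \<Omega> \<T>" for p
  proof -
    obtain u where "u \<in> Vh \<Omega> \<T>" "p = skel_trace J D u"
      using p by (auto simp: Vh_on_def skel_trace_def)
    then show ?thesis
      using traces_broken[of u] trace_map.B_in[OF VV_skel_trace_map broken_in] by metis
  qed
  then show ?thesis
    by (auto simp: linear_map_iff skel_restriction_def restrict0_def fun_eq_iff)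
qed

text \<open>
  Local functions whose traces come from one function on the skeleton agree on interfaces, hence
  glue to a continuous piecewise affine function.
\<close>

lemma glue:
  assumes v: "v \<in> VV" and tr: "local_traces J D v = skel_restriction J D p"
    and p: "p \<in> Vh_on (skeleton J D) \<Omega> \<T>"
  obtains u where "u \<in> Vh \<Omega> \<T>" "v = broken u" "skel_trace J D u = p"
proof -
  have vp: "v (j, x) = p x" if "j \<in> {1..J}" "x \<in> frontier (D j)" for j x
    using fun_cong[OF tr, of "(j, x)"] that by (simp add: local_traces_def skel_restriction_def restrict0_def)
  have agree: "v (i, x) = v (j, x)"
    if "i \<in> {1..J}" "j \<in> {1..J}" "x \<in> closure (D i)" "x \<in> closure (D j)" for i j x
    using vp[of i x] vp[of j x] overlap_frontier[of i j x] overlap_frontier[of j i x] that by metis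
  \<comment> \<open>Chooses which subdomain supplies the value at an interface point; by
    \<open>agree\<close> all choices give the same value.\<close>
  define idx where "idx x = (SOME j. j \<in> {1..J} \<and> x \<in> closure (D j))" for x
  define u where "u x = (if x \<in> closure \<Omega> then v (idx x, x) else 0)" for x
  have uv: "u x = v (j, x)" if j: "j \<in> {1..J}" "x \<in> closure (D j)" for j x
  proof -
    have "x \<in> closure \<Omega>" using j cover by blast
    moreover have "idx x \<in> {1..J} \<and> x \<in> closure (D (idx x))"
      unfolding idx_def by (rule someI[of _ j]) (use j in blast)
    ultimately show ?thesis using agree[of "idx x" j x] j by (simp add: u_def)
  qed
  \<comment> \<open>No cell straddles an interface, so on \<tau> the glued function coincides with a
    single piecewise affine one.\<close>
  have "u \<in> P1 \<tau>" if t: "\<tau> \<in> \<T>" for \<tau>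
  proof -
    obtain j where j: "j \<in> {1..J}" "\<tau> \<subseteq> closure (D j)" using cell_in_subdomain[OF t] by blast
    obtain w where w: "w \<in> pw_affine" "\<And>x. x \<in> closure (D j) \<Longrightarrow> v (j, x) = w x"
      using VV_component[OF v j(1)] by metis
    have "u x = w x" if "x \<in> \<tau>" for x using uv[OF j(1)] w(2) j(2) that by (metis subsetD)
    then show ?thesis using pw_affineD[OF w(1) t] by (simp add: P1_def)
  qed
  then have uVh: "u \<in> Vh \<Omega> \<T>" by (simp add: Vh_iff pw_affine_def u_def)
  moreover have "v = broken u"
  proof
    fix z :: "nat \<times> (real^3)"
    obtain j x where z: "z = (j, x)" by fastforce
    show "v z = broken u z"
    proof (cases "j \<in> {1..J}")
      case True
      obtain w where "component j v = restrict0 (closure (D j)) w" using VV_component[OF v True] by metis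
      then have "v (j, x) = 0" if "x \<notin> closure (D j)" using fun_cong that by (fastforce simp: restrict0_def)
      then show ?thesis using uv[OF True, of x] True by (auto simp: z broken_def restrict0_def)
    next
      case False
      then have "v (j, x) = 0" using v by (simp add: VVh_dom_def product_space_def)
      then show ?thesis using False by (auto simp: z broken_def restrict0_def)
    qed
  qed
  moreover have "skel_trace J D u = p"
  proof
    fix x
    show "skel_trace J D u x = p x"
    proof (cases "x \<in> skeleton J D")
      case True
      then obtain j where j: "j \<in> {1..J}" "x \<in> frontier (D j)" by (auto simp: skeleton_def)
      then have "u x = p x" using uv[OF j(1)] vp[OF j] frontier_sub_closure[of j] by (metis subsetD)
      then show ?thesis using True by (simp add: skel_trace_def restrict0_def)
    next
      case False
      then show ?thesis using p by (auto simp: Vh_on_def skel_trace_def restrict0_def)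
    qed
  qed
  ultimately show ?thesis using that by blast
qed

lemma Vh_skel_trace_map: "trace_map (Vh \<Omega> \<T>) (Vh_on (skeleton J D) \<Omega> \<T>) (skel_trace J D)"
proof -
  have "skel_trace J D = restrict0 (skeleton J D)" by (simp add: skel_trace_def fun_eq_iff)
  then show ?thesis using trace_map_restrict0 by simp
qed

lemma global_schur: "schur (Vh \<Omega> \<T>) (Vh_on (skeleton J D) \<Omega> \<T>) (skel_trace J D) (global_op \<alpha> \<beta> \<Omega> \<T>)"
  using Vh_skel_trace_map global_op_hpd by (simp add: schur_def)

text \<open>The harmonic tuple with traces R p satisfies its variational equation against all
  tuples, and it glues to a conforming u. Testing with \<open>broken\<close> w turns the equation
  into the global problem for u with datum R^* T_L R p, and \<open>S_eqI\<close> identifies this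
  datum with the global Schur complement at p.\<close>

lemma assembled_DtN:
  assumes p: "p \<in> Vh_on (skeleton J D) \<Omega> \<T>"
  shows "schur.S (Vh \<Omega> \<T>) (Vh_on (skeleton J D) \<Omega> \<T>) (skel_trace J D) (global_op \<alpha> \<beta> \<Omega> \<T>) p =
    dual_map (Vh_on (skeleton J D) \<Omega> \<T>) (skel_restriction J D)
      (DtN_op \<alpha> \<beta> \<Omega> \<T> J D (skel_restriction J D p))"
proof -
  let ?W = "Vh_on (skeleton J D) \<Omega> \<T>"
  let ?R = "skel_restriction J D" and ?T = "DtN_op \<alpha> \<beta> \<Omega> \<T> J D"
  interpret L: schur VV WW "local_traces J D" "block_op \<alpha> \<beta> \<Omega> \<T> J D" by (rule DtN_schur)
  interpret G: schur "Vh \<Omega> \<T>" ?W "skel_trace J D" "global_op \<alpha> \<beta> \<Omega> \<T>" by (rule global_schur)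
  have T: "?T = L.S" by (rule DtN_op_eq)
  have R: "?R q \<in> WW" if "q \<in> ?W" for q
    using skel_restriction_linear that by (auto simp: linear_map_iff)
  obtain v where v: "v \<in> VV" "local_traces J D v = ?R p"
    "\<And>w. w \<in> VV \<Longrightarrow> block_op \<alpha> \<beta> \<Omega> \<T> J D v w = ?T (?R p) (local_traces J D w)"
    using L.S_lift[OF R[OF p]] T by metis
  obtain u where u: "u \<in> Vh \<Omega> \<T>" "v = broken u" "skel_trace J D u = p"
    using glue[OF v(1,2) p] by blast
  let ?\<phi> = "dual_map ?W ?R (?T (?R p))"
  have "G.S (skel_trace J D u) = ?\<phi>"
  proof (rule G.S_eqI[OF u(1)])
    show "?\<phi> \<in> dual_space ?W"
      unfolding T by (rule dual_map_in_dual[OF G.W skel_restriction_linear L.S_in[OF R[OF p]]])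
    fix w assume w: "w \<in> Vh \<Omega> \<T>"
    have "global_op \<alpha> \<beta> \<Omega> \<T> u w = block_form v (broken w)"
      using w by (simp add: global_op_def restrict0_def u(2) block_form_broken[OF u(1) w])
    also have "\<dots> = ?T (?R p) (local_traces J D (broken w))"
      using v(3)[OF broken_in[OF w]] block_op_apply[OF broken_in[OF w]] by simp
    also have "\<dots> = ?\<phi> (skel_trace J D w)"
      using G.B_in[OF w] by (simp add: traces_broken dual_map_def restrict0_def)
    finally show "global_op \<alpha> \<beta> \<Omega> \<T> u w = ?\<phi> (skel_trace J D w)" .
  qed
  then show ?thesis by (simp only: u(3))
qed

text \<open>The trace of the constant 1 is nonzero on the nonempty skeleton. This guarantees
  eigenvalues, so that \<open>Max\<close> and \<open>Min\<close> in the condition number are taken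
  over nonempty sets.\<close>

lemma skel_space_nontrivial: "Vh_on (skeleton J D) \<Omega> \<T> \<noteq> {0}"
proof
  assume *: "Vh_on (skeleton J D) \<Omega> \<T> = {0}"
  define one where "one x = (if x \<in> closure \<Omega> then 1 else 0 :: complex)" for x
  have "one \<in> P1 \<tau>" if "\<tau> \<in> \<T>" for \<tau>
    unfolding P1_def
    by (rule CollectI, rule exI[of _ 1], rule exI[of _ 0]) (use mesh_cell(6)[OF that] in \<open>auto simp: one_def\<close>)
  then have "one \<in> Vh \<Omega> \<T>" by (simp add: Vh_iff pw_affine_def one_def)
  then have 0: "restrict0 (skeleton J D) one = 0" using * by (auto simp: Vh_on_def)
  obtain x where x: "x \<in> skeleton J D" using skeleton_nonempty by blast
  then have "restrict0 (skeleton J D) one x = 1"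
    using skeleton_sub by (auto simp: restrict0_def one_def)
  then show False using 0 by simp
qed

end

theorem corollary3p3:
  fixes \<Omega> :: "(real^3) set" and \<T> :: "(real^3) set set"
    and J :: nat and D :: "nat \<Rightarrow> (real^3) set"
    and \<alpha> \<beta> :: "real^3 \<Rightarrow> real" and \<alpha>m \<alpha>p \<beta>m \<beta>p :: real
    and Lt :: "(real^3 \<Rightarrow> complex) \<Rightarrow> (real^3 \<Rightarrow> complex) \<Rightarrow> complex"
  assumes "polyhedral_domain \<Omega>"
    and "tetrahedral_mesh \<Omega> \<T>"
    and "subdomain_partition \<Omega> \<T> J D"
    and "\<alpha> \<in> borel_measurable (lebesgue_on \<Omega>)" and "\<beta> \<in> borel_measurable (lebesgue_on \<Omega>)"
    and "\<alpha>m > 0" and "\<alpha>p > 0" and "\<beta>m > 0" and "\<beta>p > 0"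
    and "\<forall>x\<in>\<Omega>. \<alpha>m \<le> \<alpha> x \<and> \<alpha> x \<le> \<alpha>p" and "\<forall>x\<in>\<Omega>. \<beta>m \<le> \<beta> x \<and> \<beta> x \<le> \<beta>p"
    and "linear_map (Vh \<Omega> \<T>) (dual_space (Vh \<Omega> \<T>)) Lt"
    and "hermitian_pos_def (Vh \<Omega> \<T>) Lt"
  shows "cond_number (Vh_on (skeleton J D) \<Omega> \<T>)
           ((skel_trace J D \<circ> inv_into (Vh \<Omega> \<T>) Lt \<circ> dual_map (Vh \<Omega> \<T>) (skel_trace J D))
            \<circ> (dual_map (Vh_on (skeleton J D) \<Omega> \<T>) (skel_restriction J D)
               \<circ> DtN_op \<alpha> \<beta> \<Omega> \<T> J D \<circ> skel_restriction J D))
         \<le> cond_number (Vh \<Omega> \<T>) (inv_into (Vh \<Omega> \<T>) Lt \<circ> global_op \<alpha> \<beta> \<Omega> \<T>)"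
proof -
  interpret decomposition \<Omega> \<T> \<alpha> \<beta> \<alpha>m \<alpha>p \<beta>m \<beta>p J D
    using assms by unfold_locales auto
  let ?V = "Vh \<Omega> \<T>" and ?W = "Vh_on (skeleton J D) \<Omega> \<T>"
  have "hpd_operator ?V Lt"
    using assms conj_space_Vh by unfold_locales
  then have Lt: "schur ?V ?W (skel_trace J D) Lt"
    using Vh_skel_trace_map by (simp add: schur_def)
  \<comment> \<open>The two operators are compared on the skeleton space only, which is all that
    eigenvalues see.\<close>
  have "cond_number ?W
      ((skel_trace J D \<circ> inv_into ?V Lt \<circ> dual_map ?V (skel_trace J D))
        \<circ> (dual_map ?W (skel_restriction J D) \<circ> DtN_op \<alpha> \<beta> \<Omega> \<T> J D \<circ> skel_restriction J D)) =
    cond_number ?W (schur.K ?V (skel_trace J D) Lt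
      \<circ> schur.S ?V ?W (skel_trace J D) (global_op \<alpha> \<beta> \<Omega> \<T>))"
    by (rule cond_number_cong) (simp add: assembled_DtN schur.K_def[OF Lt])
  also have "\<dots> \<le> cond_number ?V (inv_into ?V Lt \<circ> global_op \<alpha> \<beta> \<Omega> \<T>)"
    by (rule cond_number_schur_le[OF global_schur Lt skel_space_nontrivial])
  finally show ?thesis .
qed

end
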